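(* Consider the one-dimensional nearest-neighbor symmetric exclusion process on $\mathbb{Z}$ (jump probability $p(1)=p(-1)=1/2$), and let $J_{-1,0}(t)$ be the current through the bond $(-1,0)$ up to time $t$. Let $\rho\in(0,1)$. Starting under $\nu'_\rho$, as $t\to\infty$, $$\frac1{t^{1/4}}J_{-1,0}(t)\ \Rightarrow\ \mathrm{N}(0,\rho^2\sigma^2),\qquad \sigma^2=\sqrt{\frac2\pi}\,\frac{1-\rho}{\rho}.$$
   Context: The exclusion process $\eta_t$ on $\{0,1\}^{\mathbb{Z}}$ has generator $Lf(\eta)=\sum_{x,y\in\mathbb{Z}}\eta(x)(1-\eta(y))p(y-x)[f(\eta^{x,y})-f(\eta)]$, with $\eta^{x,y}$ exchanging the values at $x$ and $y$; so each particle attempts a jump to each neighboring site at rate $1/2$, and jumps to occupied sites are suppressed. $J_{-1,0}(t)$ is the net number of particles that have crossed the bond $(-1,0)$ by time $t$: the number of crossings by particles from left ($-1$) to right ($0$) minus the number of crossings from right to left. $\nu_\rho=\prod_{x\in\mathbb{Z}}\mathrm{Bern}(\rho)$ and $\nu'_\rho=\nu_\rho(\cdot\mid\eta(0)=1)$. $\Rightarrow$ denotes convergence in distribution. *)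

theory Defs
  imports "HOL-Probability.Probability"
begin

section \<open>Configurations and the exclusion generator\<close>

text \<open>The set of configurations on the integers carries the product topology and the product
  sigma-algebra; a site is occupied iff its value is \<^const>\<open>True\<close>.\<close>

type_synonym config = "int \<Rightarrow> bool"

definition config_space :: "config measure" where
  "config_space = PiM UNIV (\<lambda>_. count_space UNIV)"

definition exchange :: "int \<Rightarrow> int \<Rightarrow> config \<Rightarrow> config" where
  "exchange x y \<eta> = \<eta>(x := \<eta> y, y := \<eta> x)"

definition excl_gen :: "(int \<Rightarrow> real) \<Rightarrow> (config \<Rightarrow> real) \<Rightarrow> config \<Rightarrow> real" where
  "excl_gen p f \<eta> =
     (\<Sum>\<^sub>\<infinity>(x, y)\<in>UNIV. of_bool (\<eta> x) * (1 - of_bool (\<eta> y)) * p (y - x)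
        * (f (exchange x y \<eta>) - f \<eta>))"

definition nn_symmetric :: "int \<Rightarrow> real" where
  "nn_symmetric z = (if z = 1 \<or> z = -1 then 1 / 2 else 0)"

definition cylinder :: "(config \<Rightarrow> real) \<Rightarrow> bool" where
  "cylinder f \<longleftrightarrow> (\<exists>A. finite A \<and> (\<forall>\<eta> \<zeta>. (\<forall>x\<in>A. \<eta> x = \<zeta> x) \<longrightarrow> f \<eta> = f \<zeta>))"

section \<open>Markov semigroups and their generators\<close>

text \<open>As the configuration space is compact, \<^typ>\<open>config \<Rightarrow>\<^sub>C real\<close> is the Banach space of all
  continuous real functions on it, with the supremum norm.\<close>

type_synonym operators = "real \<Rightarrow> (config \<Rightarrow>\<^sub>C real) \<Rightarrow> (config \<Rightarrow>\<^sub>C real)"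

definition markov_semigroup :: "operators \<Rightarrow> bool" where
  "markov_semigroup S \<longleftrightarrow>
     (\<forall>t\<ge>0. linear (S t)) \<and>
     (\<forall>f. S 0 f = f) \<and>
     (\<forall>f. \<forall>t\<ge>0. ((\<lambda>s. S s f) \<longlongrightarrow> S t f) (at_right t)) \<and>
     (\<forall>f. \<forall>s\<ge>0. \<forall>t\<ge>0. S (s + t) f = S s (S t f)) \<and>
     (\<forall>t\<ge>0. S t (const_bcontfun 1) = const_bcontfun 1) \<and>
     (\<forall>f. \<forall>t\<ge>0. (\<forall>\<eta>. 0 \<le> apply_bcontfun f \<eta>) \<longrightarrow> (\<forall>\<eta>. 0 \<le> apply_bcontfun (S t f) \<eta>))"

text \<open>Unbounded operators are represented by their graphs.\<close>

definition generator_graph :: "operators \<Rightarrow> ((config \<Rightarrow>\<^sub>C real) \<times> (config \<Rightarrow>\<^sub>C real)) set" where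
  "generator_graph S = {(f, g). ((\<lambda>t. (S t f - f) /\<^sub>R t) \<longlongrightarrow> g) (at_right 0)}"

definition excl_pregenerator_graph ::
    "(int \<Rightarrow> real) \<Rightarrow> ((config \<Rightarrow>\<^sub>C real) \<times> (config \<Rightarrow>\<^sub>C real)) set" where
  "excl_pregenerator_graph p =
     {(f, g). cylinder (apply_bcontfun f) \<and> apply_bcontfun g = excl_gen p (apply_bcontfun f)}"

section \<open>The exclusion process\<close>

definition past :: "'w measure \<Rightarrow> (real \<Rightarrow> 'w \<Rightarrow> config) \<Rightarrow> real \<Rightarrow> 'w measure" where
  "past M \<eta> s =
     sigma (space M) {\<eta> u -` A \<inter> space M | u A. 0 \<le> u \<and> u \<le> s \<and> A \<in> sets config_space}"

definition cadlag :: "(real \<Rightarrow> config) \<Rightarrow> bool" where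
  "cadlag w \<longleftrightarrow> (\<forall>t\<ge>0. (w \<longlongrightarrow> w t) (at_right t)) \<and> (\<forall>t>0. \<exists>l. (w \<longlongrightarrow> l) (at_left t))"

text \<open>The process is indexed by \<^typ>\<open>real\<close>, but only its values at nonnegative times matter.
  For summable jump rates the cylinder functions are a core, so that the Markov semigroup is
  determined by the condition on its generator.\<close>

definition exclusion_process :: "(int \<Rightarrow> real) \<Rightarrow> 'w measure \<Rightarrow> (real \<Rightarrow> 'w \<Rightarrow> config) \<Rightarrow> bool" where
  "exclusion_process p M \<eta> \<longleftrightarrow>
     prob_space M \<and>
     (\<forall>t\<ge>0. \<eta> t \<in> measurable M config_space) \<and>
     (\<forall>\<omega>\<in>space M. cadlag (\<lambda>t. \<eta> t \<omega>)) \<and>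
     (\<exists>S. markov_semigroup S \<and>
        generator_graph S = closure (excl_pregenerator_graph p) \<and>
        (\<forall>s\<ge>0. \<forall>t\<ge>0. \<forall>f. AE \<omega> in M.
           real_cond_exp M (past M \<eta> s) (\<lambda>\<omega>'. apply_bcontfun f (\<eta> (s + t) \<omega>')) \<omega>
             = apply_bcontfun (S t f) (\<eta> s \<omega>)))"

section \<open>The current\<close>

definition left_limit :: "(real \<Rightarrow> config) \<Rightarrow> real \<Rightarrow> config" where
  "left_limit w u = (\<lambda>x. Lim (at_left u) (\<lambda>s. w s x))"

definition jump_times :: "int \<Rightarrow> int \<Rightarrow> (real \<Rightarrow> config) \<Rightarrow> real set" where
  "jump_times x y w = {u. 0 < u \<and> left_limit w u x \<and> \<not> left_limit w u y \<and> \<not> w u x \<and> w u y}"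

text \<open>Along a cadlag path the sets below are finite. With nearest-neighbor jumps, a particle
  crosses the bond between neighbors \<open>x\<close> and \<open>y\<close> exactly when it jumps between these two sites.\<close>

definition current :: "int \<Rightarrow> int \<Rightarrow> (real \<Rightarrow> config) \<Rightarrow> real \<Rightarrow> real" where
  "current x y w t =
     real (card (jump_times x y w \<inter> {..t})) - real (card (jump_times y x w \<inter> {..t}))"

section \<open>Initial distributions and limit laws\<close>

definition bernoulli_config :: "real \<Rightarrow> config measure" where
  "bernoulli_config \<rho> = PiM UNIV (\<lambda>_. measure_pmf (bernoulli_pmf \<rho>))"

definition bernoulli_config_at_origin :: "real \<Rightarrow> config measure" where
  "bernoulli_config_at_origin \<rho> = uniform_measure (bernoulli_config \<rho>) {\<eta>. \<eta> 0}"

text \<open>The second parameter of \<^const>\<open>normal_density\<close> is the standard deviation, that of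
  the following law is the variance.\<close>

definition normal_law :: "real \<Rightarrow> real \<Rightarrow> real measure" where
  "normal_law m v = density lborel (\<lambda>x. ennreal (normal_density m (sqrt v) x))"

definition converges_in_distribution_at_top ::
    "'w measure \<Rightarrow> (real \<Rightarrow> 'w \<Rightarrow> real) \<Rightarrow> real measure \<Rightarrow> bool" where
  "converges_in_distribution_at_top M X \<mu> \<longleftrightarrow>
     (\<forall>T. filterlim T at_top sequentially \<longrightarrow>
        weak_conv_m (\<lambda>n. distr M borel (X (T n))) \<mu>)"

end

(* The law of the current is computed by duality. Let A be the exclusion process on the box [-n, n]
   started from the step configuration on [0, n], run in discrete time with a small step, and write
   eta(A) for the number of common particles of eta and A. The function
   u(k, eta) = E exp(i theta (eta(A_k) - eta(A_0))) solves, up to a boundary error that vanishes as n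
   tends to infinity, the Euler scheme of the generator in which an exchange across the bond (-1, 0)
   is twisted by a phase exp(i theta) or exp(-i theta). Hence E exp(i theta J_t) is close to the
   integral of u under the initial distribution. Under the Bernoulli measure this integral equals
   E |phi(theta)|^(2 N), where phi is the characteristic function of a Bernoulli variable and N is the
   number of particles of A to the left of the origin; conditioning on a particle at the origin costs
   at most |theta|. Finally Var N is at most 2 E N by the energy identity of the one-particle walk,
   and E N is comparable with E X^+ for a simple random walk X run for time t, which is asymptotic to
   sqrt (t / (2 pi)) by the central limit theorem. *)
theory Submission
  imports Defs
begin

section \<open>Lazy random walks and the stirring chain\<close>

text \<open>The dual comes from the stirring picture. If every site, occupied or not, is carried
  along by swaps, the current through (-1, 0) is formally the number of initial particles that end
  in {0..} minus the number that start there. The set of starting points that end in {0..} is, as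
  swaps are reversible, a copy of the exclusion process from {0..}, independent of eta; hence the
  law of eta(A) - eta(A_0). The hypotheses give no such construction, only a path whose semigroup is
  known through its generator on cylinder functions. So the identity is proved in law, by a backward
  equation checked over one short time step. The current depends on the path and is first rebuilt
  from snapshots on a fine grid; the half-line {0..} is not local and is cut to a box, at the price
  of the two bonds that leave it. For given t the box and the accuracy are fixed, and only then does
  the time step tend to 0. The scale shows in the exponent: |phi|^2 = 1 - q with q of order theta^2
  and E N of order sqrt t, so theta is of order t^(-1/4). Replacing N by E N then costs about q *
  sqrt (E N), again of order t^(-1/4).\<close>

definition lazy_step :: "real \<Rightarrow> 'b set \<Rightarrow> ('b \<Rightarrow> 'a \<Rightarrow> 'a) \<Rightarrow> 'a \<Rightarrow> 'a pmf" where
  "lazy_step r B f a =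
     bind_pmf (bernoulli_pmf (r * card B))
       (\<lambda>b. if b then map_pmf (\<lambda>y. f y a) (pmf_of_set B) else return_pmf a)"

primrec lazy_chain :: "real \<Rightarrow> 'b set \<Rightarrow> ('b \<Rightarrow> 'a \<Rightarrow> 'a) \<Rightarrow> 'a \<Rightarrow> nat \<Rightarrow> 'a pmf" where
  "lazy_chain r B f a 0 = return_pmf a"
| "lazy_chain r B f a (Suc k) = bind_pmf (lazy_chain r B f a k) (lazy_step r B f)"

text \<open>The one-step operator in the form \<open>I + r L\<close>: the map belonging to each
  \<open>y\<close> is applied with probability \<open>r\<close>, so an Euler step of a
  continuous-time jump dynamics is itself the step of a Markov chain.\<close>

definition lazy_op :: "real \<Rightarrow> 'b set \<Rightarrow> ('b \<Rightarrow> 'a \<Rightarrow> 'a) \<Rightarrow> ('a \<Rightarrow> 'c::real_vector) \<Rightarrow> 'a \<Rightarrow> 'c" where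
  "lazy_op r B f F a = F a + r *\<^sub>R (\<Sum>y\<in>B. F (f y a) - F a)"

locale lazy =
  fixes r :: real and B :: "'b set" and f :: "'b \<Rightarrow> 'a \<Rightarrow> 'a"
  assumes finite_B: "finite B" and B_ne: "B \<noteq> {}"
    and r_nonneg: "0 \<le> r" and r_card: "r * card B \<le> 1"
begin

lemma finite_set_step: "finite (set_pmf (lazy_step r B f a))"
  using finite_B B_ne by (auto simp: lazy_step_def split: if_splits)

lemma finite_set_chain: "finite (set_pmf (lazy_chain r B f a k))"
  by (induction k) (auto simp: finite_set_step)

lemma expectation_step:
  fixes F :: "'a \<Rightarrow> 'c::{banach, second_countable_topology}"
  shows "measure_pmf.expectation (lazy_step r B f a) F = lazy_op r B f F a"
proof -
  have c: "real (card B) > 0"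
    using finite_B B_ne by (simp add: card_gt_0_iff)
  let ?p = "r * card B"
  have p: "0 \<le> ?p" "?p \<le> 1"
    using r_nonneg r_card by auto
  have "measure_pmf.expectation (lazy_step r B f a) F =
     (\<Sum>b\<in>UNIV. pmf (bernoulli_pmf ?p) b *\<^sub>R
        measure_pmf.expectation (if b then map_pmf (\<lambda>y. f y a) (pmf_of_set B) else return_pmf a) F)"
    unfolding lazy_step_def using finite_B B_ne by (intro pmf_expectation_bind) auto
  also have "\<dots> = ?p *\<^sub>R measure_pmf.expectation (pmf_of_set B) (\<lambda>y. F (f y a)) + (1 - ?p) *\<^sub>R F a"
    using p by (simp add: UNIV_bool)
  also have "measure_pmf.expectation (pmf_of_set B) (\<lambda>y. F (f y a)) = (\<Sum>y\<in>B. F (f y a)) /\<^sub>R card B"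
    using finite_B B_ne
    by (subst integral_measure_pmf[of B]) (auto simp: scaleR_sum_right inverse_eq_divide)
  also have "?p *\<^sub>R \<dots> = r *\<^sub>R (\<Sum>y\<in>B. F (f y a))"
    using c by simp
  also have "\<dots> + (1 - ?p) *\<^sub>R F a = lazy_op r B f F a"
    by (simp add: lazy_op_def sum_subtractf scaleR_diff_right scaleR_diff_left
      sum_constant_scaleR)
  finally show ?thesis .
qed

text \<open>The chain appends its newest step at the end, so averaging that step first means
  applying the operator to \<open>F\<close>. Every recursion in \<open>k\<close> below comes from
  this.\<close>

lemma expectation_chain_Suc:
  fixes F :: "'a \<Rightarrow> 'c::{banach, second_countable_topology}"
  shows "measure_pmf.expectation (lazy_chain r B f a (Suc k)) F =
    measure_pmf.expectation (lazy_chain r B f a k) (lazy_op r B f F)"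
proof -
  let ?A = "set_pmf (lazy_chain r B f a k)"
  have "measure_pmf.expectation (lazy_chain r B f a (Suc k)) F =
      (\<Sum>b\<in>?A. pmf (lazy_chain r B f a k) b *\<^sub>R measure_pmf.expectation (lazy_step r B f b) F)"
    using finite_set_step finite_set_chain unfolding lazy_chain.simps
    by (intro pmf_expectation_bind) auto
  also have "\<dots> = measure_pmf.expectation (lazy_chain r B f a k) (lazy_op r B f F)"
    unfolding expectation_step using finite_set_chain
    by (subst integral_measure_pmf[of ?A]) auto
  finally show ?thesis .
qed

lemma integrable_chain [simp]:
  fixes F :: "'a \<Rightarrow> 'c::{banach, second_countable_topology}"
  shows "integrable (measure_pmf (lazy_chain r B f a k)) F"
  by (intro integrable_measure_pmf_finite finite_set_chain)

end

section \<open>Swaps on a box, and duality of linear functions with the one-particle walk\<close>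

definition sites :: "nat \<Rightarrow> int set" where "sites n = {- int n..int n}"

definition bonds :: "nat \<Rightarrow> int set" where "bonds n = {- int n..<int n}"

lemma finite_sites [simp]: "finite (sites n)" and finite_bonds [simp]: "finite (bonds n)"
  and card_bonds [simp]: "card (bonds n) = 2 * n"
  by (auto simp: sites_def bonds_def)

abbreviation bond_swap :: "int \<Rightarrow> config \<Rightarrow> config" where
  "bond_swap y \<equiv> exchange y (y + 1)"

abbreviation bond_transpose :: "int \<Rightarrow> int \<Rightarrow> int" where
  "bond_transpose y \<equiv> Transposition.transpose y (y + 1)"

lemma bond_swap_apply: "bond_swap y \<eta> x = \<eta> (bond_transpose y x)"
  by (auto simp: exchange_def Transposition.transpose_def)

lemma bond_transpose_sites:
  assumes "y \<in> bonds n" shows "bond_transpose y x \<in> sites n \<longleftrightarrow> x \<in> sites n"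
  using assms by (auto simp: Transposition.transpose_def sites_def bonds_def split: if_splits)

lemma sum_bond_transpose:
  assumes "y \<in> bonds n"
  shows "(\<Sum>x\<in>sites n. F (bond_transpose y x)) = (\<Sum>x\<in>sites n. F x)"
  using assms by (intro sum.reindex_bij_witness[of _ "bond_transpose y" "bond_transpose y"])
    (auto simp: bond_transpose_sites)

definition step_config :: "nat \<Rightarrow> config" where
  "step_config n x \<longleftrightarrow> 0 \<le> x \<and> x \<le> int n"

abbreviation stirring :: "nat \<Rightarrow> real \<Rightarrow> nat \<Rightarrow> config pmf" where
  "stirring n r k \<equiv> lazy_chain r (bonds n) bond_swap (step_config n) k"

abbreviation walk_op :: "nat \<Rightarrow> real \<Rightarrow> (int \<Rightarrow> 'c::real_vector) \<Rightarrow> int \<Rightarrow> 'c" where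
  "walk_op n r \<equiv> lazy_op r (bonds n) bond_transpose"

definition pairing :: "nat \<Rightarrow> (int \<Rightarrow> real) \<Rightarrow> config \<Rightarrow> real" where
  "pairing n c \<eta> = (\<Sum>x\<in>sites n. c x * of_bool (\<eta> x))"

lemma pairing_bond_swap:
  assumes "y \<in> bonds n"
  shows "pairing n c (bond_swap y \<eta>) = pairing n (\<lambda>x. c (bond_transpose y x)) \<eta>"
  unfolding pairing_def bond_swap_apply
  using sum_bond_transpose[OF assms, of "\<lambda>x. c x * of_bool (\<eta> (bond_transpose y x))", symmetric]
  by simp

text \<open>A swap of the configuration can be moved onto the coefficients, so linear functions of
  the configuration are closed under stirring and evolve by the walk of a single particle.\<close>

lemma pairing_walk_op:
  "pairing n (walk_op n r c) \<eta> = lazy_op r (bonds n) bond_swap (pairing n c) \<eta>"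
proof -
  define e where "e x = (of_bool (\<eta> x) :: real)" for x
  have "pairing n (walk_op n r c) \<eta> = (\<Sum>x\<in>sites n. c x * e x) +
      r * (\<Sum>x\<in>sites n. \<Sum>y\<in>bonds n. (c (bond_transpose y x) - c x) * e x)"
    unfolding pairing_def e_def[symmetric]
    by (simp add: lazy_op_def sum.distrib algebra_simps sum_distrib_left sum_distrib_right sum_subtractf)
  also have "(\<Sum>x\<in>sites n. \<Sum>y\<in>bonds n. (c (bond_transpose y x) - c x) * e x) =
     (\<Sum>y\<in>bonds n. pairing n c (bond_swap y \<eta>) - pairing n c \<eta>)"
    by (subst sum.swap, rule sum.cong)
       (simp_all add: pairing_bond_swap, simp add: pairing_def sum_subtractf left_diff_distrib e_def)
  also have "(\<Sum>x\<in>sites n. c x * e x) = pairing n c \<eta>"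
    by (simp add: pairing_def e_def)
  finally show ?thesis by (simp add: lazy_op_def[abs_def])
qed

lemma pairing_swap_diff:
  assumes "y \<in> bonds n"
  shows "pairing n c (bond_swap y \<eta>) - pairing n c \<eta> =
    (c (y + 1) - c y) * (of_bool (\<eta> y) - of_bool (\<eta> (y + 1)))"
proof -
  have "pairing n c (bond_swap y \<eta>) - pairing n c \<eta> =
      (\<Sum>x\<in>sites n. c x * (of_bool (bond_swap y \<eta> x) - of_bool (\<eta> x)))"
    by (simp add: pairing_def sum_subtractf algebra_simps)
  also have "\<dots> = (\<Sum>x\<in>{y, y + 1}. c x * (of_bool (bond_swap y \<eta> x) - of_bool (\<eta> x)))"
    using assms by (intro sum.mono_neutral_right) (auto simp: sites_def bonds_def exchange_def)
  finally show ?thesis by (auto simp: exchange_def algebra_simps)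
qed

text \<open>By Cauchy--Schwarz over the \<open>2 n\<close> bonds the second-order term of the dissipated energy is at most
  half of the first-order one.\<close>

lemma walk_op_energy:
  fixes c :: "int \<Rightarrow> real"
  assumes "0 \<le> r" "r * (4 * n) \<le> 1"
  shows "r * (\<Sum>y\<in>bonds n. (c (y + 1) - c y)\<^sup>2) \<le>
    (\<Sum>x\<in>sites n. (c x)\<^sup>2) - (\<Sum>x\<in>sites n. (walk_op n r c x)\<^sup>2)"
proof -
  let ?S = "sites n" and ?B = "bonds n"
  define d where "d y x = c (bond_transpose y x) - c x" for y x
  define En where "En = (\<Sum>y\<in>?B. (c (y + 1) - c y)\<^sup>2)"
  have dsq: "(\<Sum>x\<in>?S. (d y x)\<^sup>2) = 2 * (c (y + 1) - c y)\<^sup>2" if "y \<in> ?B" for y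
  proof -
    have "(\<Sum>x\<in>?S. (d y x)\<^sup>2) = (\<Sum>x\<in>{y, y + 1}. (d y x)\<^sup>2)"
      using that by (intro sum.mono_neutral_right) (auto simp: sites_def bonds_def d_def Transposition.transpose_def)
    then show ?thesis by (simp add: d_def power2_commute)
  qed
  have cross: "(\<Sum>x\<in>?S. c x * d y x) = - ((c (y + 1) - c y)\<^sup>2)" if "y \<in> ?B" for y
  proof -
    have "(\<Sum>x\<in>?S. c x * d y x) = (\<Sum>x\<in>{y, y + 1}. c x * d y x)"
      using that by (intro sum.mono_neutral_right) (auto simp: sites_def bonds_def d_def Transposition.transpose_def)
    then show ?thesis by (simp add: d_def power2_eq_square algebra_simps)
  qed
  have "(\<Sum>x\<in>?S. (walk_op n r c x)\<^sup>2) =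
      (\<Sum>x\<in>?S. (c x)\<^sup>2) + 2 * r * (\<Sum>x\<in>?S. \<Sum>y\<in>?B. c x * d y x) + r\<^sup>2 * (\<Sum>x\<in>?S. (\<Sum>y\<in>?B. d y x)\<^sup>2)"
    unfolding lazy_op_def d_def[symmetric]
    by (simp add: power2_eq_square algebra_simps sum.distrib sum_distrib_left)
  also have "(\<Sum>x\<in>?S. \<Sum>y\<in>?B. c x * d y x) = - En"
    by (subst sum.swap) (simp add: cross En_def sum_negf)
  finally have eq: "(\<Sum>x\<in>?S. (walk_op n r c x)\<^sup>2) =
      (\<Sum>x\<in>?S. (c x)\<^sup>2) - 2 * r * En + r\<^sup>2 * (\<Sum>x\<in>?S. (\<Sum>y\<in>?B. d y x)\<^sup>2)" by simp
  have "(\<Sum>x\<in>?S. (\<Sum>y\<in>?B. d y x)\<^sup>2) \<le> (\<Sum>x\<in>?S. (2 * n) * (\<Sum>y\<in>?B. (d y x)\<^sup>2))"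
    using sum_squared_le_sum_of_squares[of _ ?B] by (intro sum_mono) (simp add: mult.commute)
  also have "\<dots> = (2 * n) * (\<Sum>y\<in>?B. \<Sum>x\<in>?S. (d y x)\<^sup>2)"
    unfolding sum_distrib_left[symmetric] by (subst sum.swap) (rule refl)
  also have "\<dots> = 4 * n * En"
    by (simp add: dsq En_def sum_distrib_left[symmetric])
  finally have "r\<^sup>2 * (\<Sum>x\<in>?S. (\<Sum>y\<in>?B. d y x)\<^sup>2) \<le> r\<^sup>2 * (4 * n * En)"
    by (intro mult_left_mono) auto
  also have "\<dots> = r * (4 * n) * (r * En)"
    by (simp add: power2_eq_square)
  also have "\<dots> \<le> 1 * (r * En)"
    using assms by (intro mult_right_mono) (auto simp: En_def intro!: sum_nonneg mult_nonneg_nonneg)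
  finally show ?thesis using eq unfolding En_def[symmetric] by linarith
qed

text \<open>As \<open>r * card B \<le> 1\<close>, the operator averages with nonnegative weights.
  The predicate \<open>P\<close> describes a set closed under the moves, on which alone the
  comparison is assumed; for the walk this set is the box.\<close>

lemma lazy_op_mono:
  fixes F G :: "'a \<Rightarrow> real"
  assumes "lazy r B" and "\<And>a. P a \<Longrightarrow> F a \<le> G a" and "\<And>y a. y \<in> B \<Longrightarrow> P a \<Longrightarrow> P (f y a)" and "P a"
  shows "lazy_op r B f F a \<le> lazy_op r B f G a"
proof -
  interpret lazy r B f by fact
  have eq: "lazy_op r B f H a = (1 - r * card B) * H a + r * (\<Sum>y\<in>B. H (f y a))" for H :: "'a \<Rightarrow> real"
    by (simp add: lazy_op_def sum_subtractf algebra_simps)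
  show ?thesis unfolding eq using assms(2-4) r_nonneg r_card
    by (intro add_mono mult_left_mono sum_mono) auto
qed

lemma lazy_op_const: "lazy_op r B f (\<lambda>_. c) = (\<lambda>_. c)"
  by (simp add: lazy_op_def fun_eq_iff)

lemma lazy_stirring:
  assumes "0 \<le> r" "r * (2 * n) \<le> 1" "1 \<le> n"
  shows "lazy r (bonds n)"
  using assms by unfold_locales (auto simp: bonds_def)

section \<open>The stirring chain and the fluctuations of its particle number left of the
  origin\<close>

text \<open>The bound with \<open>4 * n\<close> is twice as strict as what makes the transition
  probabilities meaningful; it is the form in which the energy inequality absorbs its second-order
  term.\<close>

locale stirring_chain =
  fixes r :: real and n :: nat
  assumes r0: "0 \<le> r" and r4: "r * (4 * n) \<le> 1" and n1: "1 \<le> n"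
begin

lemma r2: "r * (2 * n) \<le> 1"
proof -
  have "r * (2 * n) \<le> r * (4 * n)"
    using r0 by (intro mult_left_mono) auto
  then show ?thesis using r4 by linarith
qed

sublocale lazy r "bonds n" bond_swap by (rule lazy_stirring[OF r0 r2 n1])

sublocale walk: lazy r "bonds n" bond_transpose by (rule lazy_stirring[OF r0 r2 n1])

abbreviation \<Lambda> where "\<Lambda> \<equiv> sites n"
abbreviation \<mu> where "\<mu> k \<equiv> stirring n r k"

definition dens :: "nat \<Rightarrow> int \<Rightarrow> real" where
  "dens k x = measure_pmf.expectation (\<mu> k) (\<lambda>A. of_bool (A x))"

lemma dens_0: "dens 0 x = of_bool (step_config n x)"
  by (simp add: dens_def)

lemma dens_Suc: "dens (Suc k) x = walk_op n r (dens k) x"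
  unfolding dens_def expectation_chain_Suc
  by (simp add: lazy_op_def[abs_def] bond_swap_apply)

lemma dens_nonneg: "0 \<le> dens k x" and dens_le_1: "dens k x \<le> 1"
proof -
  show "0 \<le> dens k x"
    unfolding dens_def by (rule Bochner_Integration.integral_nonneg) simp
  show "dens k x \<le> 1"
    unfolding dens_def by (rule measure_pmf.integral_le_const) simp_all
qed

lemma sum_walk_op: "(\<Sum>x\<in>\<Lambda>. walk_op n r c x) = (\<Sum>x\<in>\<Lambda>. c x)" for c :: "int \<Rightarrow> real"
proof -
  have "(\<Sum>x\<in>\<Lambda>. walk_op n r c x) = (\<Sum>x\<in>\<Lambda>. c x) + r * (\<Sum>x\<in>\<Lambda>. \<Sum>y\<in>bonds n. c (bond_transpose y x) - c x)"
    by (simp add: lazy_op_def sum.distrib sum_distrib_left)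
  also have "(\<Sum>x\<in>\<Lambda>. \<Sum>y\<in>bonds n. c (bond_transpose y x) - c x) = 0"
    by (subst sum.swap) (simp add: sum_subtractf sum_bond_transpose)
  finally show ?thesis by simp
qed

text \<open>Conditioning on the state before the last step, that step adds a variance of at most
  \<open>r\<close> times the Dirichlet energy of \<open>c\<close> and turns \<open>c\<close> into
  \<open>walk_op n r c\<close>. By the energy inequality the added variance is at most the loss of
  squared norm of \<open>c\<close>, so the contributions telescope.\<close>

lemma variance_bound:
  "measure_pmf.expectation (\<mu> k) (\<lambda>A. (pairing n c A - pairing n ((walk_op n r ^^ k) c) (step_config n))\<^sup>2)
    \<le> (\<Sum>x\<in>\<Lambda>. (c x)\<^sup>2) - (\<Sum>x\<in>\<Lambda>. ((walk_op n r ^^ k) c x)\<^sup>2)"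
proof (induction k arbitrary: c)
  case 0
  then show ?case by simp
next
  case (Suc k)
  define b where "b = pairing n ((walk_op n r ^^ Suc k) c) (step_config n)"
  define En where "En = (\<Sum>y\<in>bonds n. (c (y + 1) - c y)\<^sup>2)"
  \<comment> \<open>With \<open>s\<close> and \<open>d\<close> as below, the left side is s^2 + 2 r
    s (sum of d) + r (sum of d^2), while the square on the right is (s + r (sum of d))^2. The latter
    only has an additional nonnegative square, and the sum of d^2 is at most the energy.\<close>
  have key: "lazy_op r (bonds n) bond_swap (\<lambda>A. (pairing n c A - b)\<^sup>2) A
      \<le> (pairing n (walk_op n r c) A - b)\<^sup>2 + r * En" for A
  proof -
    define s where "s = pairing n c A - b"
    define d where "d y = pairing n c (bond_swap y A) - pairing n c A" for y
    have "lazy_op r (bonds n) bond_swap (\<lambda>A. (pairing n c A - b)\<^sup>2) A =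
        s\<^sup>2 + r * (\<Sum>y\<in>bonds n. (s + d y)\<^sup>2 - s\<^sup>2)"
      by (simp add: lazy_op_def s_def d_def)
    also have "(\<Sum>y\<in>bonds n. (s + d y)\<^sup>2 - s\<^sup>2) = 2 * s * (\<Sum>y\<in>bonds n. d y) + (\<Sum>y\<in>bonds n. (d y)\<^sup>2)"
      by (simp add: power2_sum sum.distrib sum_distrib_left[symmetric])
    finally have 1: "lazy_op r (bonds n) bond_swap (\<lambda>A. (pairing n c A - b)\<^sup>2) A =
        s\<^sup>2 + r * (2 * s * (\<Sum>y\<in>bonds n. d y) + (\<Sum>y\<in>bonds n. (d y)\<^sup>2))" .
    have "(\<Sum>y\<in>bonds n. (d y)\<^sup>2) \<le> En"
      unfolding En_def d_def
      by (intro sum_mono) (auto simp: pairing_swap_diff power2_commute)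
    then have 2: "r * (\<Sum>y\<in>bonds n. (d y)\<^sup>2) \<le> r * En"
      using r0 by (rule mult_left_mono)
    have 3: "pairing n (walk_op n r c) A - b = s + r * (\<Sum>y\<in>bonds n. d y)"
      by (simp add: pairing_walk_op lazy_op_def s_def d_def)
    show ?thesis
      unfolding 1 3 power2_sum using 2 zero_le_power2[of "r * (\<Sum>y\<in>bonds n. d y)"]
      by (simp add: distrib_left mult.assoc mult.left_commute, linarith)
  qed
  have "measure_pmf.expectation (\<mu> (Suc k)) (\<lambda>A. (pairing n c A - b)\<^sup>2)
     \<le> measure_pmf.expectation (\<mu> k) (\<lambda>A. (pairing n (walk_op n r c) A - b)\<^sup>2 + r * En)"
    unfolding expectation_chain_Suc by (rule Bochner_Integration.integral_mono) (simp_all add: key)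
  also have "\<dots> = measure_pmf.expectation (\<mu> k) (\<lambda>A. (pairing n (walk_op n r c) A - b)\<^sup>2) + r * En"
    by simp
  also have "\<dots> \<le> (\<Sum>x\<in>\<Lambda>. (walk_op n r c x)\<^sup>2) - (\<Sum>x\<in>\<Lambda>. ((walk_op n r ^^ Suc k) c x)\<^sup>2) + r * En"
    using Suc.IH[of "walk_op n r c"] unfolding b_def funpow_Suc_right o_apply by (rule add_right_mono)
  also have "\<dots> \<le> (\<Sum>x\<in>\<Lambda>. (c x)\<^sup>2) - (\<Sum>x\<in>\<Lambda>. ((walk_op n r ^^ Suc k) c x)\<^sup>2)"
    using walk_op_energy[OF r0 r4, of c] by (simp add: En_def)
  finally show ?case unfolding b_def .
qed

lemma expectation_pairing:
  "measure_pmf.expectation (\<mu> k) (pairing n c) = pairing n ((walk_op n r ^^ k) c) (step_config n)"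
proof (induction k arbitrary: c)
  case (Suc k)
  have eq: "lazy_op r (bonds n) bond_swap (pairing n c) = pairing n (walk_op n r c)"
    by (rule ext) (rule pairing_walk_op[symmetric])
  have "measure_pmf.expectation (\<mu> (Suc k)) (pairing n c) =
      pairing n ((walk_op n r ^^ k) (walk_op n r c)) (step_config n)"
    unfolding expectation_chain_Suc eq by (rule Suc.IH)
  then show ?case
    by (simp only: funpow_Suc_right o_apply)
qed simp

definition crossed :: "config \<Rightarrow> real" where
  "crossed A = (\<Sum>x\<in>{- int n..-1}. of_bool (A x))"

definition mean_crossed :: "nat \<Rightarrow> real" where
  "mean_crossed k = (\<Sum>x\<in>{- int n..-1}. dens k x)"

lemma crossed_pairing: "crossed A = pairing n (\<lambda>x. of_bool (x < 0)) A"
  unfolding crossed_def pairing_def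
  by (intro sum.mono_neutral_cong_left) (auto simp: sites_def)

lemma mean_crossed: "measure_pmf.expectation (\<mu> k) crossed = mean_crossed k"
  unfolding crossed_def mean_crossed_def dens_def by (subst Bochner_Integration.integral_sum) auto

text \<open>For the propagated indicator \<open>g\<close> of the left half, the variance bound
  becomes the sum of g (1 - g). It is estimated by 1 - g on the left and by g on the right. The sum
  of g on the right is the mean by duality, and the sum of 1 - g on the left equals it because the
  walk conserves total mass; hence the factor 2.\<close>

lemma crossed_variance:
  "measure_pmf.expectation (\<mu> k) (\<lambda>A. (crossed A - mean_crossed k)\<^sup>2) \<le> 2 * mean_crossed k"
proof -
  define c where "c x = (of_bool (x < 0) :: real)" for x :: int
  define g where "g = (walk_op n r ^^ k) c"
  have g: "0 \<le> g x \<and> g x \<le> 1" for x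
    unfolding g_def
  proof (induction k arbitrary: x)
    case 0
    show ?case by (simp add: c_def)
  next
    case (Suc k)
    show ?case
      using lazy_op_mono[OF walk.lazy_axioms, of "\<lambda>_. True" "\<lambda>_. 0" "(walk_op n r ^^ k) c" bond_transpose x]
        lazy_op_mono[OF walk.lazy_axioms, of "\<lambda>_. True" "(walk_op n r ^^ k) c" "\<lambda>_. 1" bond_transpose x] Suc
      by (simp add: lazy_op_const)
  qed
  have sumg: "(\<Sum>x\<in>\<Lambda>. g x) = (\<Sum>x\<in>\<Lambda>. c x)"
    unfolding g_def by (induction k) (auto simp: sum_walk_op)
  have mean: "mean_crossed k = pairing n g (step_config n)"
    unfolding mean_crossed[symmetric] crossed_pairing g_def c_def[symmetric] expectation_pairing ..
  have split: "\<Lambda> = {- int n..-1} \<union> {0..int n}" by (auto simp: sites_def)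
  have sp: "(\<Sum>x\<in>\<Lambda>. F x) = (\<Sum>x\<in>{- int n..-1}. F x) + (\<Sum>x\<in>{0..int n}. F x)" for F :: "int \<Rightarrow> real"
    unfolding split by (rule sum.union_disjoint) auto
  have mean': "mean_crossed k = (\<Sum>x\<in>{0..int n}. g x)"
    unfolding mean pairing_def sp by (simp add: step_config_def)
  have "measure_pmf.expectation (\<mu> k) (\<lambda>A. (crossed A - mean_crossed k)\<^sup>2) \<le>
      (\<Sum>x\<in>\<Lambda>. (c x)\<^sup>2) - (\<Sum>x\<in>\<Lambda>. (g x)\<^sup>2)"
    using variance_bound[of k c] by (simp add: mean g_def crossed_pairing c_def[abs_def])
  also have "(\<Sum>x\<in>\<Lambda>. (c x)\<^sup>2) = (\<Sum>x\<in>\<Lambda>. g x)"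
    unfolding sumg by (intro sum.cong) (auto simp: c_def)
  also have "(\<Sum>x\<in>\<Lambda>. g x) - (\<Sum>x\<in>\<Lambda>. (g x)\<^sup>2) = (\<Sum>x\<in>\<Lambda>. g x * (1 - g x))"
    by (simp add: sum_subtractf power2_eq_square algebra_simps)
  also have "\<dots> \<le> (\<Sum>x\<in>{- int n..-1}. 1 - g x) + (\<Sum>x\<in>{0..int n}. g x)"
    unfolding sp using g by (intro add_mono sum_mono) (auto intro: mult_left_le_one_le mult_left_le)
  also have "(\<Sum>x\<in>{- int n..-1}. 1 - g x) = (\<Sum>x\<in>{0..int n}. g x)"
  proof -
    have "(\<Sum>x\<in>{- int n..-1}. g x) + (\<Sum>x\<in>{0..int n}. g x) = real n"
      using sumg unfolding sp by (simp add: c_def)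
    then show ?thesis by (simp add: sum_subtractf)
  qed
  finally show ?thesis by (simp add: mean')
qed

lemma crossed_abs_deviation:
  "measure_pmf.expectation (\<mu> k) (\<lambda>A. \<bar>crossed A - mean_crossed k\<bar>) \<le> sqrt (2 * mean_crossed k)"
proof -
  have "(measure_pmf.expectation (\<mu> k) (\<lambda>A. \<bar>crossed A - mean_crossed k\<bar>))\<^sup>2
     \<le> measure_pmf.expectation (\<mu> k) (\<lambda>A. \<bar>crossed A - mean_crossed k\<bar>\<^sup>2)"
    using measure_pmf.variance_positive[of "\<mu> k" "\<lambda>A. \<bar>crossed A - mean_crossed k\<bar>"]
    by (subst (asm) measure_pmf.variance_eq) auto
  also have "\<dots> \<le> 2 * mean_crossed k"
    using crossed_variance by simp
  finally show ?thesis by (rule real_le_rsqrt)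
qed

end

section \<open>The current along a path\<close>

text \<open>A net passage read off from two snapshots. It is a local function of the two
  configurations, which is what estimates over a time step can handle, and it agrees with the true
  current as long as the two sites change at most once in between.\<close>

definition crossing :: "int \<Rightarrow> int \<Rightarrow> config \<Rightarrow> config \<Rightarrow> real" where
  "crossing x y \<eta> \<zeta> =
     of_bool (\<eta> x \<and> \<not> \<eta> y \<and> \<not> \<zeta> x \<and> \<zeta> y) - of_bool (\<eta> y \<and> \<not> \<eta> x \<and> \<not> \<zeta> y \<and> \<zeta> x)"

text \<open>The values at a site form a discrete space, so convergence of configurations makes each
  coordinate eventually constant.\<close>

lemma eventually_coordinate:
  assumes "((w :: real \<Rightarrow> config) \<longlongrightarrow> l) F"
  shows "\<forall>\<^sub>F s in F. w s x = l x"
proof -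
  have "open ((\<lambda>\<eta> :: config. \<eta> x) -` {l x})"
    by (intro open_vimage continuous_on_product_coordinates discrete_topology_class.open_discrete)
  then show ?thesis
    using topological_tendstoD[OF assms, of "(\<lambda>\<eta>. \<eta> x) -` {l x}"] by simp
qed

lemma cadlag_right_nbhd:
  assumes "cadlag w" "0 \<le> u"
  shows "\<exists>e>0. \<forall>s\<in>{u..<u + e}. w s x = w u x"
proof -
  have "\<forall>\<^sub>F s in at_right u. w s x = w u x"
    using assms by (intro eventually_coordinate) (auto simp: cadlag_def)
  then obtain b where b: "b > u" "\<And>s. s > u \<Longrightarrow> s < b \<Longrightarrow> w s x = w u x"
    by (auto simp: eventually_at_right_field)
  show ?thesis
  proof (intro exI[of _ "b - u"] conjI ballI)
    fix s assume "s \<in> {u..<u + (b - u)}"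
    then show "w s x = w u x" using b(2)[of s] by (cases "s = u") auto
  qed (use b in auto)
qed

lemma cadlag_left_nbhd:
  assumes "cadlag w" "0 < u"
  shows "\<exists>e>0. \<exists>l. \<forall>s\<in>{u - e<..<u}. w s x = l"
proof -
  obtain l where "(w \<longlongrightarrow> l) (at_left u)"
    using assms by (auto simp: cadlag_def)
  then have "\<forall>\<^sub>F s in at_left u. w s x = l x"
    by (rule eventually_coordinate)
  then obtain b where "b < u" "\<And>s. s > b \<Longrightarrow> s < u \<Longrightarrow> w s x = l x"
    by (auto simp: eventually_at_left_field)
  then show ?thesis
    by (intro exI[of _ "u - b"] conjI exI[of _ "l x"]) auto
qed

lemma left_limit_eqI:
  assumes "b < u" "\<And>s. b < s \<Longrightarrow> s < u \<Longrightarrow> w s x = l"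
  shows "left_limit w u x = l"
  unfolding left_limit_def
proof (rule tendsto_Lim)
  show "((\<lambda>s. w s x) \<longlongrightarrow> l) (at_left u)"
    using assms by (intro tendsto_eventually) (auto simp: eventually_at_left_field)
qed simp

text \<open>The values at \<open>x\<close> and \<open>y\<close> can switch only at \<open>u\<close>.
  This time may lie outside \<open>{a<..b}\<close>; then the configurations at \<open>a\<close> and
  \<open>b\<close> agree on the two sites and both sides are empty.\<close>

lemma jump_times_interval:
  assumes "0 \<le> a" "a < b"
    and before: "\<And>s z. a \<le> s \<Longrightarrow> s \<le> b \<Longrightarrow> s < u \<Longrightarrow> z \<in> {x, y} \<Longrightarrow> w s z = w a z"
    and after: "\<And>s z. a \<le> s \<Longrightarrow> s \<le> b \<Longrightarrow> u \<le> s \<Longrightarrow> z \<in> {x, y} \<Longrightarrow> w s z = w b z"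
  shows "jump_times x y w \<inter> {a<..b} =
    (if w a x \<and> \<not> w a y \<and> \<not> w b x \<and> w b y then {u} else {})"
proof -
  have jump: "v = u \<and> left_limit w v z = w a z \<or> left_limit w v z = w v z"
    if v: "a < v" "v \<le> b" and z: "z \<in> {x, y}" for v z
  proof (cases "v \<le> u")
    case True
    then have "left_limit w v z = w a z"
      using v z by (intro left_limit_eqI[of a] before) auto
    then show ?thesis using True v z before[of v z] by (cases "v = u") auto
  next
    case False
    then have "left_limit w v z = w b z"
      using v z by (intro left_limit_eqI[of "max a u"] after) auto
    then show ?thesis using False v z after[of v z] by auto
  qed
  have range: "a < u \<and> u \<le> b" if "w a z \<noteq> w b z" "z \<in> {x, y}" for z
    using that after[of a z] before[of b z] \<open>a < b\<close> by force
  have at_u: "left_limit w u z = w a z \<and> w u z = w b z" if "a < u" "u \<le> b" "z \<in> {x, y}" for z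
    using that by (intro conjI left_limit_eqI[of a] after before) auto
  show ?thesis
  proof (cases "w a x \<and> \<not> w a y \<and> \<not> w b x \<and> w b y")
    case True
    then have u: "a < u" "u \<le> b" using range[of x] by auto
    have sub: "jump_times x y w \<inter> {a<..b} \<subseteq> {u}"
    proof
      fix v assume "v \<in> jump_times x y w \<inter> {a<..b}"
      then have v: "a < v" "v \<le> b" and "left_limit w v x" "\<not> w v x"
        by (simp_all add: jump_times_def)
      then show "v \<in> {u}" using jump[OF v, of x] by auto
    qed
    have "left_limit w u x = w a x" "w u x = w b x" "left_limit w u y = w a y" "w u y = w b y"
      using at_u[OF u, of x] at_u[OF u, of y] by blast+
    moreover have "0 < u" using u \<open>0 \<le> a\<close> by linarith
    ultimately have "u \<in> jump_times x y w"
      using True unfolding jump_times_def by blast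
    then have "jump_times x y w \<inter> {a<..b} = {u}"
      using u sub by auto
    then show ?thesis using True by simp
  next
    case False
    have "v \<notin> jump_times x y w" if v: "a < v" "v \<le> b" for v
    proof
      assume "v \<in> jump_times x y w"
      then have j: "left_limit w v x" "\<not> left_limit w v y" "\<not> w v x" "w v y"
        by (auto simp: jump_times_def)
      then have "v = u" using jump[of v x] v by auto
      then show False using j at_u[of x] at_u[of y] v False by auto
    qed
    then show ?thesis using False by auto
  qed
qed

text \<open>Near each time the path on \<open>{x, y}\<close> has one value before and one value
  after. By compactness a fine grid puts each cell inside such a neighbourhood, so a cell contains
  at most one switch and its endpoints reveal it. How fine the grid must be depends on the path,
  hence the eventual equality.\<close>

lemma current_eq_sum_crossing:
  assumes "cadlag w" "0 < t"
  shows "\<forall>\<^sub>F m in sequentially.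
    current x y w t = (\<Sum>k<m. crossing x y (w (real k * (t / real m))) (w (real (Suc k) * (t / real m))))"
proof -
  \<comment> \<open>The left value is tested only at nonnegative times, since the path is
    unconstrained before time 0; at \<open>u = 0\<close> that clause is vacuous.\<close>
  define Q where "Q u e \<longleftrightarrow>
      (\<exists>l. \<forall>s z. u - e < s \<longrightarrow> s < u \<longrightarrow> 0 \<le> s \<longrightarrow> z \<in> {x, y} \<longrightarrow> w s z = l z) \<and>
      (\<forall>s z. u \<le> s \<longrightarrow> s < u + e \<longrightarrow> z \<in> {x, y} \<longrightarrow> w s z = w u z)" for u e
  have Q: "\<exists>e>0. Q u e" if "0 \<le> u" for u
  proof -
    obtain e1 where e1: "e1 > 0" "\<forall>s\<in>{u..<u + e1}. w s x = w u x"
      using cadlag_right_nbhd[OF assms(1) \<open>0 \<le> u\<close>] by blast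
    obtain e2 where e2: "e2 > 0" "\<forall>s\<in>{u..<u + e2}. w s y = w u y"
      using cadlag_right_nbhd[OF assms(1) \<open>0 \<le> u\<close>] by blast
    have left: "\<exists>e>0. \<exists>l. \<forall>s. u - e < s \<longrightarrow> s < u \<longrightarrow> 0 \<le> s \<longrightarrow> w s z = l" for z
    proof (cases "u = 0")
      case True
      then show ?thesis by (intro exI[of _ 1]) auto
    next
      case False
      then obtain e l where "e > 0" "\<forall>s\<in>{u - e<..<u}. w s z = l"
        using cadlag_left_nbhd[OF assms(1), of u z] \<open>0 \<le> u\<close> by auto
      then show ?thesis by (intro exI[of _ e] conjI exI[of _ l]) auto
    qed
    obtain e3 lx where e3: "e3 > 0" "\<forall>s. u - e3 < s \<longrightarrow> s < u \<longrightarrow> 0 \<le> s \<longrightarrow> w s x = lx"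
      using left by blast
    obtain e4 ly where e4: "e4 > 0" "\<forall>s. u - e4 < s \<longrightarrow> s < u \<longrightarrow> 0 \<le> s \<longrightarrow> w s y = ly"
      using left by blast
    define e where "e = min (min e1 e2) (min e3 e4)"
    have "e \<le> e1" "e \<le> e2" "e \<le> e3" "e \<le> e4" "e > 0"
      using e1 e2 e3 e4 by (auto simp: e_def)
    have 1: "w s z = (if z = x then lx else ly)"
      if "u - e < s" "s < u" "0 \<le> s" "z \<in> {x, y}" for s z
    proof (cases "z = x")
      case True
      then show ?thesis using e3(2)[rule_format, of s] that \<open>e \<le> e3\<close> by simp
    next
      case False
      then show ?thesis using e4(2)[rule_format, of s] that \<open>e \<le> e4\<close> by simp
    qed
    have 2: "w s z = w u z" if "u \<le> s" "s < u + e" "z \<in> {x, y}" for s z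
    proof (cases "z = x")
      case True
      then show ?thesis using e1(2)[rule_format, of s] that \<open>e \<le> e1\<close> by simp
    next
      case False
      then show ?thesis using e2(2)[rule_format, of s] that \<open>e \<le> e2\<close> by simp
    qed
    have "Q u e"
      unfolding Q_def
    proof (intro conjI exI allI impI)
      fix s z assume "u - e < s" "s < u" "0 \<le> s" "z \<in> {x, y}"
      then show "w s z = (if z = x then lx else ly)" by (rule 1)
    next
      fix s z assume "u \<le> s" "s < u + e" "z \<in> {x, y}"
      then show "w s z = w u z" by (rule 2)
    qed
    then show ?thesis using \<open>e > 0\<close> by blast
  qed
  \<comment> \<open>A Lebesgue number of the cover by good balls: a cell shorter than
    \<open>\<delta>\<close> lies in one ball, whose centre then serves as the switching time in
    \<open>jump_times_interval\<close>.\<close>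
  obtain \<delta> where \<delta>: "0 < \<delta>"
    "\<And>T. T \<subseteq> {0..t} \<Longrightarrow> diameter T < \<delta> \<Longrightarrow> \<exists>B\<in>{ball u e |u e. 0 \<le> u \<and> Q u e}. T \<subseteq> B"
  proof (rule Lebesgue_number_lemma[of "{0..t}" "{ball u e |u e. 0 \<le> u \<and> Q u e}"])
    show "{0..t} \<subseteq> \<Union> {ball u e |u e. 0 \<le> u \<and> Q u e}"
    proof
      fix u assume "u \<in> {0..t}"
      then have "0 \<le> u" by simp
      moreover from Q[OF this] obtain e where "e > 0" "Q u e" by blast
      ultimately show "u \<in> \<Union> {ball u e |u e. 0 \<le> u \<and> Q u e}"
        by (intro UnionI[of "ball u e"] CollectI exI conjI refl) simp_all
    qed
    obtain e where "Q 0 e" using Q[of 0] by auto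
    then have "ball 0 e \<in> {ball u e |u e. 0 \<le> u \<and> Q u e}"
      by (intro CollectI exI conjI refl) simp_all
    then show "{ball u e |u e. 0 \<le> u \<and> Q u e} \<noteq> {}" by (metis empty_iff)
    show "compact {0..t}" by simp
    show "open B" if "B \<in> {ball u e |u e. 0 \<le> u \<and> Q u e}" for B
      using that by (elim CollectE exE conjE) simp
    fix d assume "0 < d"
      "\<And>T. T \<subseteq> {0..t} \<Longrightarrow> diameter T < d \<Longrightarrow> \<exists>B\<in>{ball u e |u e. 0 \<le> u \<and> Q u e}. T \<subseteq> B"
    then show thesis by (rule that)
  qed
  obtain N :: nat where N: "t / \<delta> < real N"
    using reals_Archimedean2 by blast
  have "t / real m < \<delta>" if "N \<le> m" for m
  proof -
    have "t / \<delta> < real m" using N that by linarith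
    then have "t < \<delta> * real m" using \<delta>(1) by (simp add: field_simps)
    moreover have "0 < real m"
      using \<open>t / \<delta> < real m\<close> divide_nonneg_nonneg[of t \<delta>] \<delta>(1) assms(2) by linarith
    ultimately show ?thesis by (simp add: field_simps)
  qed
  then have "\<forall>\<^sub>F m in sequentially. t / real m < \<delta>"
    by (auto simp: eventually_sequentially)
  then show ?thesis
    using eventually_gt_at_top[of 0]
  proof eventually_elim
    case (elim m)
    define a where "a k = real k * (t / real m)" for k
    have h0: "t / real m > 0" using elim assms by simp
    have a_0: "a 0 = 0" by (simp add: a_def)
    have a_nonneg: "0 \<le> a k" for k using h0 unfolding a_def by (intro mult_nonneg_nonneg) auto
    have a_diff: "a (Suc k) - a k = t / real m" for k
      unfolding a_def by (simp only: of_nat_Suc distrib_right)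
    have a_m: "a m = t" using elim by (simp add: a_def)
    have a_le: "a (Suc k) \<le> t" if "k < m" for k
    proof -
      have "a (Suc k) \<le> a m"
        unfolding a_def using that h0 by (intro mult_right_mono) auto
      then show ?thesis using a_m by simp
    qed
    have step: "jump_times p q w \<inter> {a k<..a (Suc k)} =
        (if w (a k) p \<and> \<not> w (a k) q \<and> \<not> w (a (Suc k)) p \<and> w (a (Suc k)) q then {u} else {})"
      if "k < m" and pq: "{p, q} = {x, y}" and
        u: "0 \<le> u" "Q u e" "{a k..a (Suc k)} \<subseteq> ball u e" for k p q u e
    proof (rule jump_times_interval)
      show a0: "0 \<le> a k" and ab: "a k < a (Suc k)"
        using a_nonneg[of k] a_diff[of k] h0 by auto
      have inb: "u - e < s \<and> s < u + e" if "a k \<le> s" "s \<le> a (Suc k)" for s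
      proof -
        have "s \<in> ball u e" using u(3) that by auto
        then show ?thesis by (auto simp: dist_real_def)
      qed
      obtain l where l: "\<And>s z. u - e < s \<Longrightarrow> s < u \<Longrightarrow> 0 \<le> s \<Longrightarrow> z \<in> {x, y} \<Longrightarrow> w s z = l z"
        using u(2) unfolding Q_def by blast
      have r: "\<And>s z. u \<le> s \<Longrightarrow> s < u + e \<Longrightarrow> z \<in> {x, y} \<Longrightarrow> w s z = w u z"
        using u(2) unfolding Q_def by blast
      show "w s z = w (a k) z" if "a k \<le> s" "s \<le> a (Suc k)" "s < u" "z \<in> {p, q}" for s z
      proof -
        have "w s z = l z"
          using that pq inb[of s] a0 by (intro l) auto
        also have "\<dots> = w (a k) z"
          using that pq inb[of "a k"] a0 ab by (intro l[symmetric]) auto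
        finally show ?thesis .
      qed
      show "w s z = w (a (Suc k)) z" if "a k \<le> s" "s \<le> a (Suc k)" "u \<le> s" "z \<in> {p, q}" for s z
      proof -
        have "w s z = w u z"
          using that pq inb[of s] by (intro r) auto
        also have "\<dots> = w (a (Suc k)) z"
          using that pq inb[of "a (Suc k)"] ab by (intro r[symmetric]) auto
        finally show ?thesis .
      qed
    qed
    have nb: "\<exists>u e. 0 \<le> u \<and> Q u e \<and> {a k..a (Suc k)} \<subseteq> ball u e" if "k < m" for k
    proof -
      have sub: "{a k..a (Suc k)} \<subseteq> {0..t}"
        using a_nonneg[of k] a_le[OF that] by auto
      have "diameter {a k..a (Suc k)} < \<delta>"
        using elim(1) a_diff[of k] h0 by (subst diameter_closed_interval) auto
      from \<delta>(2)[OF sub this] obtain U where "U \<in> {ball u e |u e. 0 \<le> u \<and> Q u e}" and U: "{a k..a (Suc k)} \<subseteq> U"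
        by (elim bexE)
      then obtain u e where "U = ball u e" "0 \<le> u" "Q u e"
        by (elim CollectE exE conjE)
      then show ?thesis using U by (intro exI[of _ u] exI[of _ e]) simp
    qed
    \<comment> \<open>Finiteness is carried through the induction because \<open>card\<close> is
      additive only on finite sets and is 0 on infinite ones.\<close>
    have "finite (jump_times p q w \<inter> {..a k}) \<and> real (card (jump_times p q w \<inter> {..a k})) =
        (\<Sum>j<k. of_bool (w (a j) p \<and> \<not> w (a j) q \<and> \<not> w (a (Suc j)) p \<and> w (a (Suc j)) q))"
      if "k \<le> m" and pq: "{p, q} = {x, y}" for p q k
      using that(1)
    proof (induction k)
      case 0
      have "jump_times p q w \<inter> {..a 0} = {}" by (auto simp: jump_times_def a_0)
      then show ?case by simp
    next
      case (Suc k)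
      have "a k \<le> a (Suc k)" using a_diff[of k] h0 by simp
      then have eq: "jump_times p q w \<inter> {..a (Suc k)} =
          (jump_times p q w \<inter> {..a k}) \<union> (jump_times p q w \<inter> {a k<..a (Suc k)})" by auto
      obtain u e where "0 \<le> u" "Q u e" "{a k..a (Suc k)} \<subseteq> ball u e"
        using nb[of k] Suc.prems by auto
      then have st: "jump_times p q w \<inter> {a k<..a (Suc k)} =
          (if w (a k) p \<and> \<not> w (a k) q \<and> \<not> w (a (Suc k)) p \<and> w (a (Suc k)) q then {u} else {})"
        using Suc.prems pq by (intro step[of k p q u e]) simp_all
      have card: "card (jump_times p q w \<inter> {..a (Suc k)}) = card (jump_times p q w \<inter> {..a k}) +
          card (jump_times p q w \<inter> {a k<..a (Suc k)})"
        unfolding eq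
      proof (rule card_Un_disjoint)
        show "finite (jump_times p q w \<inter> {..a k})" using Suc by simp
        show "finite (jump_times p q w \<inter> {a k<..a (Suc k)})" unfolding st by simp
      qed auto
      have "finite (jump_times p q w \<inter> {..a (Suc k)})"
        unfolding eq st using Suc by (intro finite_UnI) auto
      moreover have "real (card (jump_times p q w \<inter> {a k<..a (Suc k)})) =
          of_bool (w (a k) p \<and> \<not> w (a k) q \<and> \<not> w (a (Suc k)) p \<and> w (a (Suc k)) q)"
        unfolding st by simp
      ultimately show ?case
        unfolding card using Suc by (simp only: of_nat_add sum.lessThan_Suc Suc_leD)
    qed
    from this[of m x y] this[of m y x] show ?case
      unfolding a_def[symmetric] current_def crossing_def sum_subtractf a_m
      by (simp only: insert_commute order_refl)
  qed
qed

section \<open>Local functions and the generator\<close>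

definition local_on :: "int set \<Rightarrow> (config \<Rightarrow> 'a) \<Rightarrow> bool" where
  "local_on L f \<longleftrightarrow> (\<forall>\<eta> \<zeta>. (\<forall>x\<in>L. \<eta> x = \<zeta> x) \<longrightarrow> f \<eta> = f \<zeta>)"

lemma local_onD: "local_on L f \<Longrightarrow> (\<And>x. x \<in> L \<Longrightarrow> \<eta> x = \<zeta> x) \<Longrightarrow> f \<eta> = f \<zeta>"
  by (auto simp: local_on_def)

definition config_of :: "int set \<Rightarrow> config" where "config_of b = (\<lambda>x. x \<in> b)"

definition pattern :: "int set \<Rightarrow> int set \<Rightarrow> config \<Rightarrow> real" where
  "pattern L b \<zeta> = of_bool (\<forall>x\<in>L. \<zeta> x = (x \<in> b))"

lemma local_on_pattern: "local_on L (pattern L b)"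
  by (auto simp: local_on_def pattern_def)

text \<open>The patterns on \<open>L\<close> are the indicators of a finite partition. Statements
  about all local functions with values in a vector space thus reduce to finitely many real
  indicators, which is how estimates become uniform over a whole class of local functions.\<close>

lemma local_on_expansion:
  fixes f :: "config \<Rightarrow> 'a::real_vector"
  assumes "finite L" "local_on L f"
  shows "f \<zeta> = (\<Sum>b\<in>Pow L. pattern L b \<zeta> *\<^sub>R f (config_of b))"
proof -
  let ?b = "{x\<in>L. \<zeta> x}"
  have "(\<Sum>b\<in>Pow L. pattern L b \<zeta> *\<^sub>R f (config_of b)) = (\<Sum>b\<in>{?b}. pattern L b \<zeta> *\<^sub>R f (config_of b))"
    using \<open>finite L\<close> by (intro sum.mono_neutral_right) (auto simp: pattern_def)
  also have "\<dots> = f (config_of ?b)"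
    by (simp add: pattern_def)
  also have "\<dots> = f \<zeta>"
    by (rule local_onD[OF assms(2)]) (simp add: config_of_def)
  finally show ?thesis ..
qed

lemma open_cylinder_set:
  fixes \<eta> :: config
  assumes "finite L" shows "open {\<zeta> :: config. \<forall>x\<in>L. \<zeta> x = \<eta> x}"
proof -
  have "{\<zeta> :: config. \<forall>x\<in>L. \<zeta> x = \<eta> x} = (\<Inter>x\<in>L. (\<lambda>\<zeta>. \<zeta> x) -` {\<eta> x})" by auto
  also have "open \<dots>"
    using assms by (intro open_INT ballI open_vimage continuous_on_product_coordinates
      discrete_topology_class.open_discrete)
  finally show ?thesis .
qed

lemma local_on_continuous:
  fixes f :: "config \<Rightarrow> 'a::topological_space"
  assumes "finite L" "local_on L f"
  shows "continuous_on UNIV f"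
proof (subst continuous_on_open_vimage[OF open_UNIV], intro allI impI)
  fix B :: "'a set" assume "open B"
  show "open (f -` B \<inter> UNIV)"
  proof (subst open_subopen, intro ballI)
    fix \<eta> assume "\<eta> \<in> f -` B \<inter> UNIV"
    then have "f \<eta> \<in> B" by simp
    have "{\<zeta>. \<forall>x\<in>L. \<zeta> x = \<eta> x} \<subseteq> f -` B \<inter> UNIV"
    proof
      fix \<zeta> assume "\<zeta> \<in> {\<zeta>. \<forall>x\<in>L. \<zeta> x = \<eta> x}"
      then have "f \<zeta> = f \<eta>" by (intro local_onD[OF assms(2)]) simp
      then show "\<zeta> \<in> f -` B \<inter> UNIV" using \<open>f \<eta> \<in> B\<close> by simp
    qed
    then show "\<exists>T. open T \<and> \<eta> \<in> T \<and> T \<subseteq> f -` B \<inter> UNIV"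
      using open_cylinder_set[OF assms(1), of \<eta>]
      by (intro exI[of _ "{\<zeta>. \<forall>x\<in>L. \<zeta> x = \<eta> x}"]) simp
  qed
qed

lemma local_on_finite_range:
  assumes "finite L" "local_on L f"
  shows "finite (range f)"
proof (rule finite_subset)
  have "f \<zeta> = f (config_of {x\<in>L. \<zeta> x})" for \<zeta>
    by (rule local_onD[OF assms(2)]) (simp add: config_of_def)
  then show "range f \<subseteq> (\<lambda>b. f (config_of b)) ` Pow L" by blast
qed (use assms in simp)

lemma local_on_bcontfun:
  fixes f :: "config \<Rightarrow> 'a::real_normed_vector"
  assumes "finite L" "local_on L f"
  shows "apply_bcontfun (Bcontfun f) = f"
  using assms
  by (intro Bcontfun_inverse)
     (auto simp: bcontfun_def local_on_continuous intro: finite_imp_bounded local_on_finite_range)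

lemma measurable_coordinate [measurable]: "(\<lambda>\<eta>. \<eta> x) \<in> measurable config_space (count_space UNIV)"
  unfolding config_space_def by (rule measurable_component_singleton) simp

lemma pattern_measurable [measurable]:
  assumes "finite L" shows "pattern L b \<in> borel_measurable config_space"
  unfolding pattern_def[abs_def] using assms by measurable

lemma local_on_measurable:
  fixes f :: "config \<Rightarrow> 'a::{real_normed_vector, second_countable_topology}"
  assumes "finite L" "local_on L f"
  shows "f \<in> borel_measurable config_space"
proof -
  have "f = (\<lambda>\<zeta>. \<Sum>b\<in>Pow L. pattern L b \<zeta> *\<^sub>R f (config_of b))"
    by (rule ext) (rule local_on_expansion[OF assms])
  also have "\<dots> \<in> borel_measurable config_space"
    using assms(1) by measurable
  finally show ?thesis .
qed

section \<open>The generator on local functions\<close>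

text \<open>The range consists of the bonds inside \<open>sites n\<close> together with the two that
  leave it: exactly the bonds whose swap touches the box. Values in a vector space allow complex
  functions.\<close>

definition nn_gen :: "nat \<Rightarrow> (config \<Rightarrow> 'a::real_vector) \<Rightarrow> config \<Rightarrow> 'a" where
  "nn_gen n f \<eta> = (\<Sum>x\<in>{- int n - 1..int n}. (1 / 2) *\<^sub>R (f (bond_swap x \<eta>) - f \<eta>))"

lemma exchange_commute: "exchange x y \<eta> = exchange y x \<eta>"
  by (auto simp: exchange_def fun_eq_iff)

text \<open>If the two ends of a bond differ, exactly one of the two orientations permits a jump, at
  rate 1/2, and the jump is the swap; if they agree, neither does and the swap changes nothing. So
  each bond contributes half of the swap increment, as in stirring, and bonds away from the box
  contribute 0.\<close>

lemma excl_gen_eq_nn_gen: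
  assumes "local_on (sites n) f"
  shows "excl_gen nn_symmetric f \<eta> = nn_gen n f \<eta>"
proof -
  define T where "T x y = of_bool (\<eta> x) * (1 - of_bool (\<eta> y)) * nn_symmetric (y - x)
        * (f (exchange x y \<eta>) - f \<eta>)" for x y
  define X where "X = {- int n - 1..int n}"
  let ?D1 = "(\<lambda>x. (x, x + 1)) ` X" and ?D2 = "(\<lambda>x. (x + 1, x)) ` X"
  have far: "f (bond_swap x \<eta>) = f \<eta>" if "x \<notin> X" for x
    using that by (intro local_onD[OF assms]) (auto simp: exchange_def sites_def X_def)
  have T0: "T x y = 0" if "(x, y) \<notin> ?D1 \<union> ?D2" for x y
  proof (cases "nn_symmetric (y - x) = 0")
    case True
    then show ?thesis by (simp add: T_def)
  next
    case False
    then consider "y = x + 1" | "x = y + 1" by (auto simp: nn_symmetric_def split: if_splits)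
    then show ?thesis
    proof cases
      case 1
      then show ?thesis using that far[of x] by (auto simp: T_def)
    next
      case 2
      then show ?thesis using that far[of y] by (auto simp: T_def exchange_commute[of "y + 1" y])
    qed
  qed
  have "excl_gen nn_symmetric f \<eta> = infsum (\<lambda>(x, y). T x y) UNIV"
    by (simp add: excl_gen_def T_def)
  also have "\<dots> = infsum (\<lambda>(x, y). T x y) (?D1 \<union> ?D2)"
    using T0 by (intro infsum_cong_neutral) auto
  also have "\<dots> = (\<Sum>(x, y)\<in>?D1 \<union> ?D2. T x y)"
    by (rule infsum_finite) (auto simp: X_def)
  also have "\<dots> = (\<Sum>(x, y)\<in>?D1. T x y) + (\<Sum>(x, y)\<in>?D2. T x y)"
    by (rule sum.union_disjoint) (auto simp: X_def)
  also have "\<dots> = (\<Sum>x\<in>X. T x (x + 1)) + (\<Sum>x\<in>X. T (x + 1) x)"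
    by (subst (1 2) sum.reindex) (auto simp: inj_on_def)
  also have "\<dots> = (\<Sum>x\<in>X. T x (x + 1) + T (x + 1) x)"
    by (simp add: sum.distrib)
  also have "\<dots> = (\<Sum>x\<in>X. (1 / 2) *\<^sub>R (f (bond_swap x \<eta>) - f \<eta>))"
  proof (rule sum.cong[OF refl])
    fix x
    have "bond_swap x \<eta> = \<eta>" if "\<eta> x = \<eta> (x + 1)"
      using that by (auto simp: exchange_def fun_eq_iff)
    then show "T x (x + 1) + T (x + 1) x = (1 / 2) *\<^sub>R (f (bond_swap x \<eta>) - f \<eta>)"
      by (cases "\<eta> x = \<eta> (x + 1)") (auto simp: T_def nn_symmetric_def exchange_commute[of "x + 1" x])
  qed
  finally show ?thesis by (simp add: nn_gen_def X_def)
qed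

lemma local_on_nn_gen:
  assumes "local_on (sites n) f"
  shows "local_on (sites (Suc n)) (nn_gen n f)"
  unfolding local_on_def
proof (intro allI impI)
  fix \<eta> \<zeta> :: config assume eq: "\<forall>x\<in>sites (Suc n). \<eta> x = \<zeta> x"
  have "f (bond_swap x \<eta>) = f (bond_swap x \<zeta>)" if "x \<in> {- int n - 1..int n}" for x
    using that eq by (intro local_onD[OF assms]) (auto simp: exchange_def sites_def)
  moreover have "f \<eta> = f \<zeta>"
    using eq by (intro local_onD[OF assms]) (auto simp: sites_def)
  ultimately show "nn_gen n f \<eta> = nn_gen n f \<zeta>"
    by (simp add: nn_gen_def)
qed

lemma nn_gen_scaleR_sum:
  fixes c :: "'i \<Rightarrow> 'a::real_vector"
  shows "nn_gen n (\<lambda>\<zeta>. \<Sum>i\<in>I. g i \<zeta> *\<^sub>R c i) \<eta> = (\<Sum>i\<in>I. nn_gen n (g i) \<eta> *\<^sub>R c i)"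
proof -
  have "nn_gen n (\<lambda>\<zeta>. \<Sum>i\<in>I. g i \<zeta> *\<^sub>R c i) \<eta> =
     (\<Sum>x\<in>{- int n - 1..int n}. \<Sum>i\<in>I. ((1 / 2) *\<^sub>R (g i (bond_swap x \<eta>) - g i \<eta>)) *\<^sub>R c i)"
    unfolding nn_gen_def by (simp add: sum_subtractf[symmetric] scaleR_sum_right scaleR_diff_left[symmetric])
  also have "\<dots> = (\<Sum>i\<in>I. nn_gen n (g i) \<eta> *\<^sub>R c i)"
    unfolding nn_gen_def by (subst sum.swap) (simp add: scaleR_sum_left)
  finally show ?thesis .
qed

text \<open>A local function lies in the domain of the generator, and the difference quotient
  converges in the supremum norm; the first-order expansion is therefore uniform in the
  configuration.\<close>

lemma semigroup_expansion:
  fixes f :: "config \<Rightarrow> real"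
  assumes gen: "generator_graph S = closure (excl_pregenerator_graph nn_symmetric)"
    and loc: "local_on (sites n) f" and "0 < \<epsilon>"
  shows "\<forall>\<^sub>F h in at_right 0. \<forall>\<eta>. \<bar>apply_bcontfun (S h (Bcontfun f)) \<eta> - (f \<eta> + h * nn_gen n f \<eta>)\<bar> \<le> \<epsilon> * h"
proof -
  let ?F = "Bcontfun f" and ?G = "Bcontfun (nn_gen n f)"
  have F: "apply_bcontfun ?F = f" by (rule local_on_bcontfun[OF finite_sites loc])
  have G: "apply_bcontfun ?G = nn_gen n f"
    by (rule local_on_bcontfun[OF finite_sites local_on_nn_gen[OF loc]])
  have "cylinder f"
    unfolding cylinder_def using loc unfolding local_on_def by (intro exI[of _ "sites n"]) simp
  then have "(?F, ?G) \<in> excl_pregenerator_graph nn_symmetric"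
    using loc by (simp add: excl_pregenerator_graph_def F G fun_eq_iff excl_gen_eq_nn_gen)
  then have "(?F, ?G) \<in> generator_graph S"
    unfolding gen using closure_subset by blast
  then have "((\<lambda>t. (S t ?F - ?F) /\<^sub>R t) \<longlongrightarrow> ?G) (at_right 0)"
    by (simp add: generator_graph_def)
  then have "\<forall>\<^sub>F h in at_right 0. dist ((S h ?F - ?F) /\<^sub>R h) ?G < \<epsilon>"
    using \<open>0 < \<epsilon>\<close> by (rule tendstoD)
  moreover have "\<forall>\<^sub>F h in at_right 0. 0 < (h::real)"
    by (simp add: eventually_at_right_less)
  ultimately show ?thesis
  proof eventually_elim
    case (elim h)
    show ?case
    proof
      fix \<eta>
      have "dist (((S h ?F - ?F) /\<^sub>R h) \<eta>) (?G \<eta>) \<le> \<epsilon>"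
        using dist_bounded[of "(S h ?F - ?F) /\<^sub>R h" \<eta> ?G] elim(1) by linarith
      then have "\<bar>(S h ?F \<eta> - f \<eta>) / h - nn_gen n f \<eta>\<bar> \<le> \<epsilon>"
        by (simp add: dist_real_def F G divide_inverse mult.commute)
      then have "\<bar>(S h ?F \<eta> - f \<eta>) / h - nn_gen n f \<eta>\<bar> * h \<le> \<epsilon> * h"
        using elim by (intro mult_right_mono) auto
      also have "\<bar>(S h ?F \<eta> - f \<eta>) / h - nn_gen n f \<eta>\<bar> * h = \<bar>((S h ?F \<eta> - f \<eta>) / h - nn_gen n f \<eta>) * h\<bar>"
        using elim by (simp add: abs_mult)
      also have "((S h ?F \<eta> - f \<eta>) / h - nn_gen n f \<eta>) * h = S h ?F \<eta> - (f \<eta> + h * nn_gen n f \<eta>)"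
        using elim by (simp add: field_simps)
      finally show "\<bar>S h ?F \<eta> - (f \<eta> + h * nn_gen n f \<eta>)\<bar> \<le> \<epsilon> * h" .
    qed
  qed
qed

section \<open>One time step of the process\<close>

lemma space_config_space [simp]: "space config_space = UNIV"
  by (simp add: config_space_def space_PiM)

locale nn_exclusion =
  fixes M :: "'w measure" and \<eta> :: "real \<Rightarrow> 'w \<Rightarrow> config"
  assumes excl: "exclusion_process nn_symmetric M \<eta>"
begin

sublocale prob_space M
  using excl by (simp add: exclusion_process_def)

lemma measurable_eta [measurable]: "0 \<le> t \<Longrightarrow> \<eta> t \<in> measurable M config_space"
  using excl by (simp add: exclusion_process_def)

lemma cadlag_eta: "\<omega> \<in> space M \<Longrightarrow> cadlag (\<lambda>t. \<eta> t \<omega>)"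
  using excl by (simp add: exclusion_process_def)

lemma space_past [simp]: "space (past M \<eta> s) = space M"
  by (auto simp: past_def intro!: space_measure_of)

lemma sets_past:
  "sets (past M \<eta> s) = sigma_sets (space M)
     {\<eta> u -` A \<inter> space M | u A. 0 \<le> u \<and> u \<le> s \<and> A \<in> sets config_space}"
  unfolding past_def by (rule sets_measure_of) auto

lemma subalgebra_past: "subalgebra M (past M \<eta> s)"
  unfolding subalgebra_def sets_past using measurable_sets[OF measurable_eta]
  by (auto intro!: sets.sigma_sets_subset)

lemma measurable_eta_past:
  assumes "0 \<le> u" "u \<le> s"
  shows "\<eta> u \<in> measurable (past M \<eta> s) config_space"
proof (rule measurableI)
  fix A assume "A \<in> sets config_space"
  then show "\<eta> u -` A \<inter> space (past M \<eta> s) \<in> sets (past M \<eta> s)"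
    unfolding sets_past space_past using assms by (intro sigma_sets.Basic CollectI exI[of _ u] exI[of _ A]) simp
qed simp

lemma local_past:
  fixes f :: "config \<Rightarrow> 'a::{real_normed_vector, second_countable_topology}"
  assumes "finite L" "local_on L f" "0 \<le> u" "u \<le> s"
  shows "(\<lambda>\<omega>. f (\<eta> u \<omega>)) \<in> borel_measurable (past M \<eta> s)"
  by (rule measurable_compose[OF measurable_eta_past[OF assms(3,4)] local_on_measurable[OF assms(1,2)]])

lemma local_M:
  fixes f :: "config \<Rightarrow> 'a::{real_normed_vector, second_countable_topology}"
  assumes "finite L" "local_on L f" "0 \<le> u"
  shows "(\<lambda>\<omega>. f (\<eta> u \<omega>)) \<in> borel_measurable M"
  by (rule measurable_compose[OF measurable_eta[OF assms(3)] local_on_measurable[OF assms(1,2)]])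

lemma past_M: "f \<in> borel_measurable (past M \<eta> s) \<Longrightarrow> f \<in> borel_measurable M"
  by (rule measurable_from_subalg[OF subalgebra_past])

text \<open>Against a weight known at time \<open>s\<close>, the Markov property replaces
  \<open>f\<close> at time \<open>s + h\<close> by the semigroup at time \<open>s\<close>, and the
  uniform expansion applies pointwise. The order of quantifiers matters: one \<open>h\<close> serves
  all \<open>s\<close> and all \<open>W\<close>, so the errors of many steps can be added
  up.\<close>

lemma step_real:
  fixes f :: "config \<Rightarrow> real"
  assumes loc: "local_on (sites n) f" and "0 < \<epsilon>"
  shows "\<forall>\<^sub>F h in at_right 0. \<forall>s\<ge>0. \<forall>W. W \<in> borel_measurable (past M \<eta> s) \<longrightarrow> (\<forall>\<omega>. \<bar>W \<omega>\<bar> \<le> 1) \<longrightarrow>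
    \<bar>(\<integral>\<omega>. W \<omega> * f (\<eta> (s + h) \<omega>) \<partial>M) - (\<integral>\<omega>. W \<omega> * (f (\<eta> s \<omega>) + h * nn_gen n f (\<eta> s \<omega>)) \<partial>M)\<bar> \<le> \<epsilon> * h"
proof -
  obtain S where gen: "generator_graph S = closure (excl_pregenerator_graph nn_symmetric)"
    and S: "\<And>s t f. 0 \<le> s \<Longrightarrow> 0 \<le> t \<Longrightarrow> AE \<omega> in M.
           real_cond_exp M (past M \<eta> s) (\<lambda>\<omega>'. apply_bcontfun f (\<eta> (s + t) \<omega>')) \<omega>
             = apply_bcontfun (S t f) (\<eta> s \<omega>)"
    using excl unfolding exclusion_process_def by blast
  have F: "apply_bcontfun (Bcontfun f) = f" by (rule local_on_bcontfun[OF finite_sites loc])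
  obtain K where K: "\<And>\<zeta>. \<bar>f \<zeta>\<bar> \<le> K"
    using finite_imp_bounded[OF local_on_finite_range[OF finite_sites loc]]
    by (auto simp: bounded_iff)
  obtain K' where K': "\<And>\<zeta>. \<bar>nn_gen n f \<zeta>\<bar> \<le> K'"
    using finite_imp_bounded[OF local_on_finite_range[OF finite_sites local_on_nn_gen[OF loc]]]
    by (auto simp: bounded_iff)
  have "\<forall>\<^sub>F h in at_right 0. 0 < (h::real)"
    by (simp add: eventually_at_right_less)
  with semigroup_expansion[OF gen loc \<open>0 < \<epsilon>\<close>] show ?thesis
  proof (eventually_elim, intro allI impI)
    fix h s W
    assume h: "\<forall>\<eta>. \<bar>apply_bcontfun (S h (Bcontfun f)) \<eta> - (f \<eta> + h * nn_gen n f \<eta>)\<bar> \<le> \<epsilon> * h"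
      and "0 < h" "0 \<le> s" and W: "W \<in> borel_measurable (past M \<eta> s)" and W1: "\<forall>\<omega>. \<bar>W \<omega>\<bar> \<le> (1::real)"
    interpret F: finite_measure_subalgebra M "past M \<eta> s"
      by unfold_locales (rule subalgebra_past)
    have [measurable]: "W \<in> borel_measurable M" by (rule past_M[OF W])
    have [measurable]: "(\<lambda>\<omega>. f (\<eta> (s + h) \<omega>)) \<in> borel_measurable M"
      using \<open>0 < h\<close> \<open>0 \<le> s\<close> by (intro local_M[OF finite_sites loc]) auto
    have [measurable]: "(\<lambda>\<omega>. f (\<eta> s \<omega>)) \<in> borel_measurable M"
      using \<open>0 \<le> s\<close> by (intro local_M[OF finite_sites loc]) auto
    have [measurable]: "(\<lambda>\<omega>. nn_gen n f (\<eta> s \<omega>)) \<in> borel_measurable M"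
      using \<open>0 \<le> s\<close> by (intro local_M[OF finite_sites local_on_nn_gen[OF loc]]) auto
    let ?R = "real_cond_exp M (past M \<eta> s) (\<lambda>\<omega>. f (\<eta> (s + h) \<omega>))"
    have bd: "\<bar>W \<omega> * x\<bar> \<le> B" if "\<bar>x\<bar> \<le> B" for \<omega> x B
      using mult_mono[OF W1[rule_format, of \<omega>] that] by (simp add: abs_mult)
    have int1: "integrable M (\<lambda>\<omega>. W \<omega> * f (\<eta> (s + h) \<omega>))"
      by (rule integrable_const_bound[where B=K]) (auto intro!: AE_I2 bd K)
    note R = F.real_cond_exp_intg[OF int1 W]
    have int2: "integrable M (\<lambda>\<omega>. W \<omega> * (f (\<eta> s \<omega>) + h * nn_gen n f (\<eta> s \<omega>)))"
    proof (rule integrable_const_bound[where B="K + h * K'"])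
      have "\<bar>f \<zeta> + h * nn_gen n f \<zeta>\<bar> \<le> K + h * K'" for \<zeta>
      proof -
        have "h * \<bar>nn_gen n f \<zeta>\<bar> \<le> h * K'" using K'[of \<zeta>] \<open>0 < h\<close> by (intro mult_left_mono) auto
        then have "\<bar>h * nn_gen n f \<zeta>\<bar> \<le> h * K'" using \<open>0 < h\<close> by (simp add: abs_mult)
        then show ?thesis using K[of \<zeta>] by linarith
      qed
      then show "AE \<omega> in M. norm (W \<omega> * (f (\<eta> s \<omega>) + h * nn_gen n f (\<eta> s \<omega>))) \<le> K + h * K'"
        unfolding real_norm_def by (intro AE_I2 bd)
    qed measurable
    have "(\<integral>\<omega>. W \<omega> * f (\<eta> (s + h) \<omega>) \<partial>M) - (\<integral>\<omega>. W \<omega> * (f (\<eta> s \<omega>) + h * nn_gen n f (\<eta> s \<omega>)) \<partial>M)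
        = (\<integral>\<omega>. W \<omega> * ?R \<omega> \<partial>M) - (\<integral>\<omega>. W \<omega> * (f (\<eta> s \<omega>) + h * nn_gen n f (\<eta> s \<omega>)) \<partial>M)"
      by (subst R(2)) simp_all
    also have "\<dots> = (\<integral>\<omega>. W \<omega> * ?R \<omega> - W \<omega> * (f (\<eta> s \<omega>) + h * nn_gen n f (\<eta> s \<omega>)) \<partial>M)"
      by (rule Bochner_Integration.integral_diff[symmetric, OF _ int2]) (rule R(1), simp)
    finally have eq: "(\<integral>\<omega>. W \<omega> * f (\<eta> (s + h) \<omega>) \<partial>M) - (\<integral>\<omega>. W \<omega> * (f (\<eta> s \<omega>) + h * nn_gen n f (\<eta> s \<omega>)) \<partial>M)
        = (\<integral>\<omega>. W \<omega> * ?R \<omega> - W \<omega> * (f (\<eta> s \<omega>) + h * nn_gen n f (\<eta> s \<omega>)) \<partial>M)" .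
    have "AE \<omega> in M. ?R \<omega> = apply_bcontfun (S h (Bcontfun f)) (\<eta> s \<omega>)"
      using S[of s h "Bcontfun f"] \<open>0 < h\<close> \<open>0 \<le> s\<close> by (simp add: F)
    then have "AE \<omega> in M. \<bar>W \<omega> * ?R \<omega> - W \<omega> * (f (\<eta> s \<omega>) + h * nn_gen n f (\<eta> s \<omega>))\<bar> \<le> \<epsilon> * h"
    proof eventually_elim
      case (elim \<omega>)
      show ?case
        unfolding elim right_diff_distrib[symmetric] by (rule bd) (rule h[rule_format])
    qed
    then have "(\<integral>\<omega>. \<bar>W \<omega> * ?R \<omega> - W \<omega> * (f (\<eta> s \<omega>) + h * nn_gen n f (\<eta> s \<omega>))\<bar> \<partial>M) \<le> \<epsilon> * h"
      using R(1) int2 by (intro integral_le_const integrable_abs Bochner_Integration.integrable_diff) auto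
    then show "\<bar>(\<integral>\<omega>. W \<omega> * f (\<eta> (s + h) \<omega>) \<partial>M) - (\<integral>\<omega>. W \<omega> * (f (\<eta> s \<omega>) + h * nn_gen n f (\<eta> s \<omega>)) \<partial>M)\<bar> \<le> \<epsilon> * h"
      unfolding eq using integral_abs_bound[of M "\<lambda>\<omega>. W \<omega> * ?R \<omega> - W \<omega> * (f (\<eta> s \<omega>) + h * nn_gen n f (\<eta> s \<omega>))"]
      by linarith
  qed
qed

lemma local_on_euler:
  fixes f :: "config \<Rightarrow> real"
  assumes "local_on (sites n) f"
  shows "local_on (sites (Suc n)) (\<lambda>\<zeta>. f \<zeta> + h * nn_gen n f \<zeta>)"
  unfolding local_on_def
proof (intro allI impI)
  fix \<xi> \<zeta> :: config assume "\<forall>x\<in>sites (Suc n). \<xi> x = \<zeta> x"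
  then have "f \<xi> = f \<zeta>" "nn_gen n f \<xi> = nn_gen n f \<zeta>"
    by (auto intro!: local_onD[OF assms] local_onD[OF local_on_nn_gen[OF assms]] simp: sites_def)
  then show "f \<xi> + h * nn_gen n f \<xi> = f \<zeta> + h * nn_gen n f \<zeta>" by simp
qed

lemma integrable_local:
  fixes g :: "config \<Rightarrow> real" and W :: "'w \<Rightarrow> complex"
  assumes "local_on (sites k) g" "0 \<le> u" "W \<in> borel_measurable M" "\<And>\<omega>. cmod (W \<omega>) \<le> 1"
  shows "integrable M (\<lambda>\<omega>. g (\<eta> u \<omega>) *\<^sub>R W \<omega>)"
proof -
  obtain K where K: "\<And>\<zeta>. \<bar>g \<zeta>\<bar> \<le> K"
    using finite_imp_bounded[OF local_on_finite_range[OF finite_sites assms(1)]]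
    by (auto simp: bounded_iff)
  show ?thesis
  proof (rule integrable_const_bound[where B=K])
    have "\<bar>g (\<eta> u \<omega>)\<bar> * cmod (W \<omega>) \<le> K * 1" for \<omega>
      using order_trans[OF abs_ge_zero K] by (intro mult_mono K assms(4)) auto
    then show "AE \<omega> in M. norm (g (\<eta> u \<omega>) *\<^sub>R W \<omega>) \<le> K"
      by (intro AE_I2) simp
    show "(\<lambda>\<omega>. g (\<eta> u \<omega>) *\<^sub>R W \<omega>) \<in> borel_measurable M"
      by (intro borel_measurable_scaleR assms(3) local_M[OF finite_sites assms(1,2)])
  qed
qed

lemma step_complex:
  fixes f :: "config \<Rightarrow> real"
  assumes loc: "local_on (sites n) f" and "0 < \<epsilon>"
  shows "\<forall>\<^sub>F h in at_right 0. \<forall>s\<ge>0. \<forall>W. W \<in> borel_measurable (past M \<eta> s) \<longrightarrow> (\<forall>\<omega>. cmod (W \<omega>) \<le> 1) \<longrightarrow>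
    cmod ((\<integral>\<omega>. f (\<eta> (s + h) \<omega>) *\<^sub>R W \<omega> \<partial>M) - (\<integral>\<omega>. (f (\<eta> s \<omega>) + h * nn_gen n f (\<eta> s \<omega>)) *\<^sub>R W \<omega> \<partial>M)) \<le> \<epsilon> * h"
proof -
  \<comment> \<open>The real and the imaginary part of \<open>W\<close> are treated separately, each
    with half of the error.\<close>
  have "\<epsilon> / 2 > 0" using \<open>0 < \<epsilon>\<close> by simp
  have "\<forall>\<^sub>F h in at_right 0. 0 < (h::real)"
    by (simp add: eventually_at_right_less)
  with step_real[OF loc \<open>\<epsilon> / 2 > 0\<close>] show ?thesis
  proof (eventually_elim, intro allI impI)
    fix h s :: real and W :: "'w \<Rightarrow> complex"
    assume H: "\<forall>s\<ge>0. \<forall>W. W \<in> borel_measurable (past M \<eta> s) \<longrightarrow> (\<forall>\<omega>. \<bar>W \<omega>\<bar> \<le> 1) \<longrightarrow>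
      \<bar>(\<integral>\<omega>. W \<omega> * f (\<eta> (s + h) \<omega>) \<partial>M) - (\<integral>\<omega>. W \<omega> * (f (\<eta> s \<omega>) + h * nn_gen n f (\<eta> s \<omega>)) \<partial>M)\<bar> \<le> \<epsilon> / 2 * h"
      and "0 < h" "0 \<le> s" and W: "W \<in> borel_measurable (past M \<eta> s)" and W1: "\<forall>\<omega>. cmod (W \<omega>) \<le> 1"
    have WM [measurable]: "W \<in> borel_measurable M" by (rule past_M[OF W])
    have [measurable]: "W \<in> borel_measurable (past M \<eta> s)" by (rule W)
    have i1: "integrable M (\<lambda>\<omega>. f (\<eta> (s + h) \<omega>) *\<^sub>R W \<omega>)"
      using \<open>0 < h\<close> \<open>0 \<le> s\<close> W1 by (intro integrable_local[OF loc _ WM]) auto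
    have i2: "integrable M (\<lambda>\<omega>. (f (\<eta> s \<omega>) + h * nn_gen n f (\<eta> s \<omega>)) *\<^sub>R W \<omega>)"
      using W1 by (intro integrable_local[OF local_on_euler[OF loc] \<open>0 \<le> s\<close> WM]) auto
    let ?D = "(\<integral>\<omega>. f (\<eta> (s + h) \<omega>) *\<^sub>R W \<omega> \<partial>M) - (\<integral>\<omega>. (f (\<eta> s \<omega>) + h * nn_gen n f (\<eta> s \<omega>)) *\<^sub>R W \<omega> \<partial>M)"
    have "\<bar>Re ?D\<bar> \<le> \<epsilon> / 2 * h"
    proof -
      have "\<bar>Re (W \<omega>)\<bar> \<le> 1" for \<omega>
        using abs_Re_le_cmod[of "W \<omega>"] W1[rule_format, of \<omega>] by linarith
      then show ?thesis
        using H[rule_format, of s "\<lambda>\<omega>. Re (W \<omega>)"] \<open>0 \<le> s\<close>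
        by (simp add: integral_Re[OF i1, symmetric] integral_Re[OF i2, symmetric] mult.commute)
    qed
    moreover have "\<bar>Im ?D\<bar> \<le> \<epsilon> / 2 * h"
    proof -
      have "\<bar>Im (W \<omega>)\<bar> \<le> 1" for \<omega>
        using abs_Im_le_cmod[of "W \<omega>"] W1[rule_format, of \<omega>] by linarith
      then show ?thesis
        using H[rule_format, of s "\<lambda>\<omega>. Im (W \<omega>)"] \<open>0 \<le> s\<close>
        by (simp add: integral_Im[OF i1, symmetric] integral_Im[OF i2, symmetric] mult.commute)
    qed
    ultimately show "cmod ?D \<le> \<epsilon> * h"
      using cmod_le[of ?D] by simp
  qed
qed

text \<open>Here the function also depends on the present configuration. Expanding its future
  argument in patterns separates the two: the coefficient
  \<open>\<psi> (\<eta> s \<omega>) (config_of b)\<close> is known at time \<open>s\<close> and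
  joins the weight. Each of the \<open>N\<close> patterns receives the error
  \<open>\<epsilon> / N\<close>, and as their number is fixed by the box the bound is uniform in
  \<open>\<psi>\<close>.\<close>

lemma one_step:
  assumes "0 < \<epsilon>"
  shows "\<forall>\<^sub>F h in at_right 0. \<forall>s\<ge>0. \<forall>W \<psi>.
    W \<in> borel_measurable (past M \<eta> s) \<longrightarrow> (\<forall>\<omega>. cmod (W \<omega>) \<le> 1) \<longrightarrow>
    (\<forall>\<zeta> \<zeta>'. cmod (\<psi> \<zeta> \<zeta>') \<le> 1) \<longrightarrow> (\<forall>\<zeta>. local_on (sites n) (\<psi> \<zeta>)) \<longrightarrow>
    (\<forall>\<zeta>'. local_on (sites n) (\<lambda>\<zeta>. \<psi> \<zeta> \<zeta>')) \<longrightarrow>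
    cmod ((\<integral>\<omega>. W \<omega> * \<psi> (\<eta> s \<omega>) (\<eta> (s + h) \<omega>) \<partial>M) -
      (\<integral>\<omega>. W \<omega> * (\<psi> (\<eta> s \<omega>) (\<eta> s \<omega>) + h *\<^sub>R nn_gen n (\<psi> (\<eta> s \<omega>)) (\<eta> s \<omega>)) \<partial>M)) \<le> \<epsilon> * h"
proof -
  let ?L = "sites n" and ?B = "Pow (sites n)"
  define N where "N = real (card ?B)"
  have "N > 0" by (simp add: N_def card_gt_0_iff Pow_not_empty)
  then have "\<epsilon> / N > 0" using assms by simp
  from step_complex[OF local_on_pattern this]
  have "\<forall>\<^sub>F h in at_right 0. \<forall>b\<in>?B. \<forall>s\<ge>0. \<forall>W. W \<in> borel_measurable (past M \<eta> s) \<longrightarrow> (\<forall>\<omega>. cmod (W \<omega>) \<le> 1) \<longrightarrow>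
    cmod ((\<integral>\<omega>. pattern ?L b (\<eta> (s + h) \<omega>) *\<^sub>R W \<omega> \<partial>M)
      - (\<integral>\<omega>. (pattern ?L b (\<eta> s \<omega>) + h * nn_gen n (pattern ?L b) (\<eta> s \<omega>)) *\<^sub>R W \<omega> \<partial>M)) \<le> \<epsilon> / N * h"
    by (intro eventually_ball_finite) auto
  moreover have "\<forall>\<^sub>F h in at_right 0. 0 < (h::real)"
    by (simp add: eventually_at_right_less)
  ultimately show ?thesis
  proof (eventually_elim, intro allI impI)
    fix h s :: real and W :: "'w \<Rightarrow> complex" and \<psi> :: "config \<Rightarrow> config \<Rightarrow> complex"
    assume H: "\<forall>b\<in>?B. \<forall>s\<ge>0. \<forall>W. W \<in> borel_measurable (past M \<eta> s) \<longrightarrow> (\<forall>\<omega>. cmod (W \<omega>) \<le> 1) \<longrightarrow>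
        cmod ((\<integral>\<omega>. pattern ?L b (\<eta> (s + h) \<omega>) *\<^sub>R W \<omega> \<partial>M)
        - (\<integral>\<omega>. (pattern ?L b (\<eta> s \<omega>) + h * nn_gen n (pattern ?L b) (\<eta> s \<omega>)) *\<^sub>R W \<omega> \<partial>M)) \<le> \<epsilon> / N * h"
      and h: "0 < h" and s: "0 \<le> s" and W: "W \<in> borel_measurable (past M \<eta> s)" and W1: "\<forall>\<omega>. cmod (W \<omega>) \<le> 1"
      and \<psi>1: "\<forall>\<zeta> \<zeta>'. cmod (\<psi> \<zeta> \<zeta>') \<le> 1" and l2: "\<forall>\<zeta>. local_on ?L (\<psi> \<zeta>)"
      and l1: "\<forall>\<zeta>'. local_on ?L (\<lambda>\<zeta>. \<psi> \<zeta> \<zeta>')"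
    define V where "V b \<omega> = W \<omega> * \<psi> (\<eta> s \<omega>) (config_of b)" for b \<omega>
    have V: "V b \<in> borel_measurable (past M \<eta> s)" for b
      unfolding V_def[abs_def] using s
      by (intro borel_measurable_times W local_past[OF finite_sites l1[rule_format]]) auto
    have V1: "cmod (V b \<omega>) \<le> 1" for b \<omega>
      unfolding V_def norm_mult using W1 \<psi>1 by (intro mult_le_one) auto
    have e1: "W \<omega> * \<psi> (\<eta> s \<omega>) (\<eta> (s + h) \<omega>) = (\<Sum>b\<in>?B. pattern ?L b (\<eta> (s + h) \<omega>) *\<^sub>R V b \<omega>)" for \<omega>
      by (subst local_on_expansion[OF finite_sites l2[rule_format]])
        (simp add: sum_distrib_left V_def)
    have e2: "W \<omega> * (\<psi> (\<eta> s \<omega>) (\<eta> s \<omega>) + h *\<^sub>R nn_gen n (\<psi> (\<eta> s \<omega>)) (\<eta> s \<omega>)) =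
        (\<Sum>b\<in>?B. (pattern ?L b (\<eta> s \<omega>) + h * nn_gen n (pattern ?L b) (\<eta> s \<omega>)) *\<^sub>R V b \<omega>)" for \<omega>
    proof -
      define v where "v = \<psi> (\<eta> s \<omega>)"
      have v: "v = (\<lambda>\<zeta>. \<Sum>b\<in>?B. pattern ?L b \<zeta> *\<^sub>R v (config_of b))"
        by (rule ext, rule local_on_expansion) (simp_all add: v_def l2)
      have v1: "v \<zeta> = (\<Sum>b\<in>?B. pattern ?L b \<zeta> *\<^sub>R v (config_of b))" for \<zeta>
        by (rule local_on_expansion) (simp_all add: v_def l2)
      have "nn_gen n v \<zeta> = (\<Sum>b\<in>?B. nn_gen n (pattern ?L b) \<zeta> *\<^sub>R v (config_of b))" for \<zeta>
        by (subst v) (rule nn_gen_scaleR_sum)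
      then have "v \<zeta> + h *\<^sub>R nn_gen n v \<zeta> =
          (\<Sum>b\<in>?B. (pattern ?L b \<zeta> + h * nn_gen n (pattern ?L b) \<zeta>) *\<^sub>R v (config_of b))" for \<zeta>
        by (subst v1) (simp add: scaleR_sum_right sum.distrib scaleR_add_left)
      then show ?thesis
        by (simp add: v_def[symmetric] sum_distrib_left V_def)
    qed
    have i1: "integrable M (\<lambda>\<omega>. pattern ?L b (\<eta> (s + h) \<omega>) *\<^sub>R V b \<omega>)" for b
      using h s by (intro integrable_local[OF local_on_pattern _ past_M[OF V] V1]) auto
    have i2: "integrable M (\<lambda>\<omega>. (pattern ?L b (\<eta> s \<omega>) + h * nn_gen n (pattern ?L b) (\<eta> s \<omega>)) *\<^sub>R V b \<omega>)" for b
      by (intro integrable_local[OF local_on_euler[OF local_on_pattern] s past_M[OF V] V1])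
    have "cmod ((\<integral>\<omega>. W \<omega> * \<psi> (\<eta> s \<omega>) (\<eta> (s + h) \<omega>) \<partial>M) -
      (\<integral>\<omega>. W \<omega> * (\<psi> (\<eta> s \<omega>) (\<eta> s \<omega>) + h *\<^sub>R nn_gen n (\<psi> (\<eta> s \<omega>)) (\<eta> s \<omega>)) \<partial>M)) =
      cmod (\<Sum>b\<in>?B. (\<integral>\<omega>. pattern ?L b (\<eta> (s + h) \<omega>) *\<^sub>R V b \<omega> \<partial>M)
        - (\<integral>\<omega>. (pattern ?L b (\<eta> s \<omega>) + h * nn_gen n (pattern ?L b) (\<eta> s \<omega>)) *\<^sub>R V b \<omega> \<partial>M))"
      unfolding e1 e2 sum_subtractf using i1 i2 by (simp only: Bochner_Integration.integral_sum)
    also have "\<dots> \<le> (\<Sum>b\<in>?B. \<epsilon> / N * h)"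
    proof (rule sum_norm_le)
      fix b assume "b \<in> ?B"
      then show "cmod ((\<integral>\<omega>. pattern ?L b (\<eta> (s + h) \<omega>) *\<^sub>R V b \<omega> \<partial>M)
        - (\<integral>\<omega>. (pattern ?L b (\<eta> s \<omega>) + h * nn_gen n (pattern ?L b) (\<eta> s \<omega>)) *\<^sub>R V b \<omega> \<partial>M)) \<le> \<epsilon> / N * h"
        using H[rule_format, OF _ s V V1] by simp
    qed
    also have "\<dots> = \<epsilon> * h"
      using \<open>N > 0\<close> by (simp add: N_def[symmetric])
    finally show "cmod ((\<integral>\<omega>. W \<omega> * \<psi> (\<eta> s \<omega>) (\<eta> (s + h) \<omega>) \<partial>M) -
      (\<integral>\<omega>. W \<omega> * (\<psi> (\<eta> s \<omega>) (\<eta> s \<omega>) + h *\<^sub>R nn_gen n (\<psi> (\<eta> s \<omega>)) (\<eta> s \<omega>)) \<partial>M)) \<le> \<epsilon> * h" .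
  qed
qed

end

section \<open>The twisted semigroup and its dual\<close>

definition overlap :: "nat \<Rightarrow> config \<Rightarrow> config \<Rightarrow> real" where
  "overlap n A \<zeta> = (\<Sum>x\<in>sites n. of_bool (A x \<and> \<zeta> x))"

lemma overlap_bond_swap:
  assumes "y \<in> bonds n"
  shows "overlap n (bond_swap y A) \<zeta> = overlap n A (bond_swap y \<zeta>)"
  unfolding overlap_def bond_swap_apply
  using sum_bond_transpose[OF assms, of "\<lambda>x. of_bool (A (bond_transpose y x) \<and> \<zeta> x) :: real", symmetric]
  by simp

lemma crossing_self [simp]: "crossing x y \<eta> \<eta> = 0"
  by (simp add: crossing_def)

lemma crossing_bond_swap:
  "crossing (-1) 0 \<zeta> (bond_swap y \<zeta>) = (if y = -1 then of_bool (\<zeta> (-1)) - of_bool (\<zeta> 0) else 0)"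
  by (auto simp: crossing_def exchange_def)

text \<open>Inside the box the step configuration is constant across every bond except (-1, 0), so
  only an exchange there changes the number of particles on its support. This is the origin of the
  phase.\<close>

lemma overlap_step_config_swap:
  assumes "y \<in> bonds n"
  shows "overlap n (step_config n) (bond_swap y \<zeta>) - overlap n (step_config n) \<zeta> =
    crossing (-1) 0 \<zeta> (bond_swap y \<zeta>)"
proof -
  have eq: "overlap n (step_config n) \<xi> = pairing n (\<lambda>x. of_bool (step_config n x)) \<xi>" for \<xi>
    by (simp add: overlap_def pairing_def of_bool_conj)
  show ?thesis
    unfolding eq pairing_swap_diff[OF assms] crossing_bond_swap
    using assms by (auto simp: step_config_def bonds_def)
qed

lemma crossing_measurable:
  assumes [measurable]: "u \<in> measurable N config_space" "v \<in> measurable N config_space"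
  shows "(\<lambda>\<omega>. crossing x y (u \<omega>) (v \<omega>)) \<in> borel_measurable N"
proof -
  have [measurable]: "Measurable.pred N (\<lambda>\<omega>. u \<omega> z)" "Measurable.pred N (\<lambda>\<omega>. v \<omega> z)" for z
    by (rule measurable_compose[OF _ measurable_coordinate], fact)+
  show ?thesis unfolding crossing_def by measurable
qed

lemma cmod_cis_diff_le: "cmod (cis a - cis b) \<le> 2"
  using norm_triangle_ineq4[of "cis a" "cis b"] by simp

section \<open>The dual functional and its backward equation\<close>

context stirring_chain
begin

text \<open>The candidate for the conditional characteristic function of the current, given that
  \<open>k\<close> time steps remain and the present configuration is
  \<open>\<zeta>\<close>.\<close>

definition twisted :: "real \<Rightarrow> nat \<Rightarrow> config \<Rightarrow> complex" where
  "twisted \<theta> k \<zeta> = measure_pmf.expectation (\<mu> k)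
     (\<lambda>A. cis (\<theta> * (overlap n A \<zeta> - overlap n (step_config n) \<zeta>)))"

lemma twisted_0: "twisted \<theta> 0 \<zeta> = 1"
  by (simp add: twisted_def)

text \<open>A swap applied last to \<open>A\<close> has the same overlap as a swap applied to
  \<open>\<zeta>\<close>. The subtracted overlap with the step configuration must then be adjusted
  too, and the adjustment is the crossing of (-1, 0): a forward step of the chain turns into a
  phase-weighted backward step in \<open>\<zeta>\<close>.\<close>

lemma twisted_Suc:
  "twisted \<theta> (Suc k) \<zeta> = twisted \<theta> k \<zeta> + r *\<^sub>R (\<Sum>y\<in>bonds n.
     cis (\<theta> * crossing (-1) 0 \<zeta> (bond_swap y \<zeta>)) * twisted \<theta> k (bond_swap y \<zeta>) - twisted \<theta> k \<zeta>)"
proof -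
  have *: "cis (\<theta> * (overlap n (bond_swap y A) \<zeta> - overlap n (step_config n) \<zeta>)) =
      cis (\<theta> * crossing (-1) 0 \<zeta> (bond_swap y \<zeta>)) *
      cis (\<theta> * (overlap n A (bond_swap y \<zeta>) - overlap n (step_config n) (bond_swap y \<zeta>)))"
    if "y \<in> bonds n" for y A
    unfolding overlap_step_config_swap[OF that, symmetric] overlap_bond_swap[OF that] cis_mult
    by (simp add: algebra_simps)
  show ?thesis
    unfolding twisted_def expectation_chain_Suc
    by (simp add: lazy_op_def[abs_def] * cong: sum.cong)
qed

lemma local_on_twisted: "local_on (sites n) (twisted \<theta> k)"
  unfolding local_on_def
proof (intro allI impI)
  fix \<eta> \<zeta> :: config assume "\<forall>x\<in>sites n. \<eta> x = \<zeta> x"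
  then have "overlap n A \<eta> = overlap n A \<zeta>" for A
    unfolding overlap_def by (intro sum.cong) auto
  then show "twisted \<theta> k \<eta> = twisted \<theta> k \<zeta>"
    by (simp only: twisted_def)
qed

lemma cmod_twisted: "cmod (twisted \<theta> k \<zeta>) \<le> 1"
proof -
  have "cmod (twisted \<theta> k \<zeta>) \<le> measure_pmf.expectation (\<mu> k) (\<lambda>_. 1)"
    unfolding twisted_def by (rule integral_norm_bound[THEN order_trans]) simp
  then show ?thesis by simp
qed

text \<open>Where \<open>P\<close> fails the two exponents coincide; elsewhere two points of the
  unit circle are at distance at most 2.\<close>

lemma twisted_swap_diff:
  assumes "\<And>A. \<not> P A \<Longrightarrow> overlap n A (bond_swap y \<zeta>) - overlap n (step_config n) (bond_swap y \<zeta>) =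
    overlap n A \<zeta> - overlap n (step_config n) \<zeta>"
  shows "cmod (twisted \<theta> k (bond_swap y \<zeta>) - twisted \<theta> k \<zeta>) \<le>
    2 * measure_pmf.expectation (\<mu> k) (\<lambda>A. of_bool (P A))"
proof -
  let ?e = "\<lambda>\<xi> A. cis (\<theta> * (overlap n A \<xi> - overlap n (step_config n) \<xi>))"
  have eq: "twisted \<theta> k (bond_swap y \<zeta>) - twisted \<theta> k \<zeta> =
      measure_pmf.expectation (\<mu> k) (\<lambda>A. ?e (bond_swap y \<zeta>) A - ?e \<zeta> A)"
    unfolding twisted_def by (rule Bochner_Integration.integral_diff[symmetric]) (rule integrable_chain)+
  have "cmod (twisted \<theta> k (bond_swap y \<zeta>) - twisted \<theta> k \<zeta>) \<le>
      measure_pmf.expectation (\<mu> k) (\<lambda>A. cmod (?e (bond_swap y \<zeta>) A - ?e \<zeta> A))"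
    unfolding eq by (rule integral_norm_bound)
  also have "\<dots> \<le> measure_pmf.expectation (\<mu> k) (\<lambda>A. 2 * of_bool (P A))"
  proof (rule Bochner_Integration.integral_mono)
    fix A
    show "cmod (?e (bond_swap y \<zeta>) A - ?e \<zeta> A) \<le> 2 * of_bool (P A)"
    proof (cases "P A")
      case True
      then show ?thesis using cmod_cis_diff_le by simp
    next
      case False
      then show ?thesis unfolding assms[OF False] by simp
    qed
  qed (rule integrable_chain)+
  finally show ?thesis by simp
qed

lemma overlap_diff: "overlap n A \<zeta> - overlap n (step_config n) \<zeta> =
    (\<Sum>x\<in>sites n. (of_bool (A x) - of_bool (step_config n x)) * of_bool (\<zeta> x))"
  by (simp add: overlap_def sum_subtractf left_diff_distrib of_bool_conj)

text \<open>The swap changes only the site \<open>int n\<close> of the box, where the coefficient in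
  \<open>overlap_diff\<close> is 0 as soon as \<open>A\<close> still has its particle there. At the
  left end the step configuration is empty, and the exceptional event is a particle of
  \<open>A\<close>.\<close>

lemma twisted_boundary_right:
  "cmod (twisted \<theta> k (bond_swap (int n) \<zeta>) - twisted \<theta> k \<zeta>) \<le> 2 * (1 - dens k (int n))"
proof -
  have "1 - dens k (int n) = measure_pmf.expectation (\<mu> k) (\<lambda>A. 1 - of_bool (A (int n)))"
    unfolding dens_def by (subst Bochner_Integration.integral_diff) auto
  also have "\<dots> = measure_pmf.expectation (\<mu> k) (\<lambda>A. of_bool (\<not> A (int n)))"
    by (intro Bochner_Integration.integral_cong) auto
  finally have eq: "1 - dens k (int n) = measure_pmf.expectation (\<mu> k) (\<lambda>A. of_bool (\<not> A (int n)))" .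
  show ?thesis
    unfolding eq overlap_diff
    by (rule twisted_swap_diff, unfold overlap_diff, rule sum.cong)
       (auto simp: exchange_def step_config_def sites_def)
qed

lemma twisted_boundary_left:
  "cmod (twisted \<theta> k (bond_swap (- int n - 1) \<zeta>) - twisted \<theta> k \<zeta>) \<le> 2 * dens k (- int n)"
  unfolding dens_def
  using n1 by (intro twisted_swap_diff, unfold overlap_diff, intro sum.cong)
    (auto simp: exchange_def step_config_def sites_def)

definition boundary_error :: "nat \<Rightarrow> real" where
  "boundary_error k = 1 - dens k (int n) + dens k (- int n)"

text \<open>The generator swaps a bond at rate 1/2 and the chain with probability \<open>r\<close>
  per step, so a step lasts the time \<open>2 * r\<close>. The two sides differ exactly by the two
  bonds that leave the box, which the chain lacks.\<close>

lemma twisted_generator: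
  "cmod (twisted \<theta> k \<zeta> + (2 * r) *\<^sub>R nn_gen n (\<lambda>\<xi>. cis (\<theta> * crossing (-1) 0 \<zeta> \<xi>) * twisted \<theta> k \<xi>) \<zeta>
     - twisted \<theta> (Suc k) \<zeta>) \<le> 2 * r * boundary_error k"
proof -
  define d where "d y = cis (\<theta> * crossing (-1) 0 \<zeta> (bond_swap y \<zeta>)) * twisted \<theta> k (bond_swap y \<zeta>) - twisted \<theta> k \<zeta>" for y
  have "crossing (-1) 0 \<zeta> (bond_swap (- int n - 1) \<zeta>) = 0"
    unfolding crossing_bond_swap using n1 by auto
  then have dl: "cmod (d (- int n - 1)) \<le> 2 * dens k (- int n)"
    unfolding d_def using twisted_boundary_left[of \<theta> k \<zeta>] by simp
  have "crossing (-1) 0 \<zeta> (bond_swap (int n) \<zeta>) = 0"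
    unfolding crossing_bond_swap by auto
  then have dr: "cmod (d (int n)) \<le> 2 * (1 - dens k (int n))"
    unfolding d_def using twisted_boundary_right[of \<theta> k \<zeta>] by simp
  have split: "{- int n - 1..int n} = insert (- int n - 1) (insert (int n) (bonds n))"
    by (auto simp: bonds_def)
  have gen: "nn_gen n (\<lambda>\<xi>. cis (\<theta> * crossing (-1) 0 \<zeta> \<xi>) * twisted \<theta> k \<xi>) \<zeta> =
      (1 / 2) *\<^sub>R (\<Sum>y\<in>{- int n - 1..int n}. d y)"
    by (simp add: nn_gen_def d_def scaleR_sum_right)
  have "(\<Sum>y\<in>{- int n - 1..int n}. d y) = d (- int n - 1) + (d (int n) + (\<Sum>y\<in>bonds n. d y))"
    unfolding split by (subst sum.insert; simp add: bonds_def)+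
  then have "twisted \<theta> k \<zeta> + (2 * r) *\<^sub>R nn_gen n (\<lambda>\<xi>. cis (\<theta> * crossing (-1) 0 \<zeta> \<xi>) * twisted \<theta> k \<xi>) \<zeta>
     - twisted \<theta> (Suc k) \<zeta> = r *\<^sub>R (d (- int n - 1) + d (int n))"
    unfolding gen twisted_Suc d_def[symmetric] by (simp add: scaleR_add_right)
  also have "cmod \<dots> \<le> r * (cmod (d (- int n - 1)) + cmod (d (int n)))"
    using r0 by (simp add: mult_left_mono norm_triangle_ineq)
  also have "\<dots> \<le> r * (2 * dens k (- int n) + 2 * (1 - dens k (int n)))"
    using dl dr r0 by (intro mult_left_mono add_mono)
  finally show ?thesis by (simp add: boundary_error_def algebra_simps)
qed

end

section \<open>Comparison of the grid current with its dual\<close>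

context nn_exclusion
begin

definition grid_current :: "real \<Rightarrow> nat \<Rightarrow> 'w \<Rightarrow> real" where
  "grid_current h k \<omega> = (\<Sum>j<k. crossing (-1) 0 (\<eta> (real j * h) \<omega>) (\<eta> (real (Suc j) * h) \<omega>))"

lemma grid_current_past:
  assumes "0 \<le> h"
  shows "grid_current h k \<in> borel_measurable (past M \<eta> (real k * h))"
  unfolding grid_current_def[abs_def]
  using assms
  by (intro borel_measurable_sum crossing_measurable measurable_eta_past mult_right_mono mult_nonneg_nonneg) auto

lemma grid_current_Suc:
  "grid_current h (Suc k) \<omega> = grid_current h k \<omega> + crossing (-1) 0 (\<eta> (real k * h) \<omega>) (\<eta> (real k * h + h) \<omega>)"
  by (simp add: grid_current_def algebra_simps)

text \<open>Interpolation: the phase of the current over the first \<open>k\<close> cells,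
  multiplied by the dual functional for the remaining \<open>m - k\<close> steps. The case
  \<open>k = m\<close> is the characteristic function of the grid current, \<open>k = 0\<close> the
  initial average of the dual, and consecutive terms differ by a one-step error and a boundary
  error. As \<open>m\<close> is quantified after \<open>h\<close>, it may later be tied to
  \<open>h\<close>.\<close>

lemma telescoping:
  assumes "0 < \<epsilon>" "1 \<le> n"
  shows "\<forall>\<^sub>F h in at_right 0. \<forall>m. stirring_chain (h / 2) n \<and>
     cmod ((\<integral>\<omega>. cis (\<theta> * grid_current h m \<omega>) \<partial>M) - (\<integral>\<omega>. stirring_chain.twisted (h / 2) n \<theta> m (\<eta> 0 \<omega>) \<partial>M))
       \<le> (\<Sum>k<m. h * (\<epsilon> + stirring_chain.boundary_error (h / 2) n k))"
proof -
  have "\<forall>\<^sub>F h in at_right 0. 0 < (h::real)"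
    by (simp add: eventually_at_right_less)
  \<comment> \<open>For \<open>r = h / 2\<close> this is the condition
    \<open>r * (4 * n) \<le> 1\<close> of the chain.\<close>
  moreover have "\<forall>\<^sub>F h in at_right 0. h < 1 / (2 * real n)"
    using \<open>1 \<le> n\<close> by (intro order_tendstoD(2)[OF tendsto_ident_at]) simp
  moreover note one_step[OF \<open>0 < \<epsilon>\<close>, of n]
  ultimately show ?thesis
  proof (eventually_elim, intro allI)
    fix h :: real and m :: nat
    assume h: "0 < h" "h < 1 / (2 * real n)"
      and step: "\<forall>s\<ge>0. \<forall>W \<psi>.
        W \<in> borel_measurable (past M \<eta> s) \<longrightarrow> (\<forall>\<omega>. cmod (W \<omega>) \<le> 1) \<longrightarrow>
        (\<forall>\<zeta> \<zeta>'. cmod (\<psi> \<zeta> \<zeta>') \<le> 1) \<longrightarrow> (\<forall>\<zeta>. local_on (sites n) (\<psi> \<zeta>)) \<longrightarrow>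
        (\<forall>\<zeta>'. local_on (sites n) (\<lambda>\<zeta>. \<psi> \<zeta> \<zeta>')) \<longrightarrow>
        cmod ((\<integral>\<omega>. W \<omega> * \<psi> (\<eta> s \<omega>) (\<eta> (s + h) \<omega>) \<partial>M) -
          (\<integral>\<omega>. W \<omega> * (\<psi> (\<eta> s \<omega>) (\<eta> s \<omega>) + h *\<^sub>R nn_gen n (\<psi> (\<eta> s \<omega>)) (\<eta> s \<omega>)) \<partial>M)) \<le> \<epsilon> * h"
    have hn: "h / 2 * (4 * real n) \<le> 1"
      using h \<open>1 \<le> n\<close> by (simp add: field_simps)
    interpret S: stirring_chain "h / 2" n
      using h hn \<open>1 \<le> n\<close> by unfold_locales auto
    define W where "W k \<omega> = cis (\<theta> * grid_current h k \<omega>)" for k \<omega>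
    define Z where "Z k = (\<integral>\<omega>. W k \<omega> * S.twisted \<theta> (m - k) (\<eta> (real k * h) \<omega>) \<partial>M)" for k
    have W: "W k \<in> borel_measurable (past M \<eta> (real k * h))" for k
      unfolding W_def[abs_def] using h grid_current_past[of h k]
      by (intro borel_measurable_continuous_on[of cis] continuous_intros borel_measurable_times) auto
    have "cmod (Z (Suc k) - Z k) \<le> h * (\<epsilon> + S.boundary_error (m - Suc k))" if "k < m" for k
    proof -
      define s where "s = real k * h"
      have s: "0 \<le> s" using h by (simp add: s_def)
      define q where "q = m - Suc k"
      \<comment> \<open>At the true future argument the phase extends \<open>W k\<close> to
        \<open>W (Suc k)\<close>. At equal arguments the phase is 1, so the first-order expansion is
        the Euler step treated in \<open>twisted_generator\<close>.\<close>
      define \<psi> where "\<psi> \<zeta> \<xi> = cis (\<theta> * crossing (-1) 0 \<zeta> \<xi>) * S.twisted \<theta> q \<xi>" for \<zeta> \<xi>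
      have \<psi>1: "cmod (\<psi> \<zeta> \<xi>) \<le> 1" for \<zeta> \<xi>
        by (simp add: \<psi>_def norm_mult S.cmod_twisted)
      have in_sites: "-1 \<in> sites n" "0 \<in> sites n" using \<open>1 \<le> n\<close> by (auto simp: sites_def)
      have l2: "local_on (sites n) (\<psi> \<zeta>)" for \<zeta>
        unfolding local_on_def
      proof (intro allI impI)
        fix \<xi> \<xi>' :: config assume eq: "\<forall>x\<in>sites n. \<xi> x = \<xi>' x"
        then have "S.twisted \<theta> q \<xi> = S.twisted \<theta> q \<xi>'"
          by (intro local_onD[OF S.local_on_twisted]) auto
        then show "\<psi> \<zeta> \<xi> = \<psi> \<zeta> \<xi>'"
          using eq in_sites by (simp add: \<psi>_def crossing_def)
      qed
      have l1: "local_on (sites n) (\<lambda>\<zeta>. \<psi> \<zeta> \<xi>)" for \<xi>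
        using in_sites by (simp add: local_on_def \<psi>_def crossing_def)
      have Z1: "Z (Suc k) = (\<integral>\<omega>. W k \<omega> * \<psi> (\<eta> s \<omega>) (\<eta> (s + h) \<omega>) \<partial>M)"
        unfolding Z_def W_def grid_current_Suc \<psi>_def s_def q_def
        by (simp add: cis_mult[symmetric] distrib_left algebra_simps)
      have Z0: "Z k = (\<integral>\<omega>. W k \<omega> * S.twisted \<theta> (Suc q) (\<eta> s \<omega>) \<partial>M)"
        using that by (simp add: Z_def s_def q_def Suc_diff_Suc)
      let ?E = "\<lambda>\<zeta>. \<psi> \<zeta> \<zeta> + h *\<^sub>R nn_gen n (\<psi> \<zeta>) \<zeta>"
      let ?e = "\<lambda>\<zeta>. ?E \<zeta> - S.twisted \<theta> (Suc q) \<zeta>"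
      have e: "cmod (?e \<zeta>) \<le> h * S.boundary_error q" for \<zeta>
        using S.twisted_generator[of \<theta> q \<zeta>] by (simp add: \<psi>_def[abs_def])
      have locE: "local_on (sites (Suc n)) ?E"
        unfolding local_on_def
      proof (intro allI impI)
        fix \<zeta> \<zeta>' :: config assume eq: "\<forall>x\<in>sites (Suc n). \<zeta> x = \<zeta>' x"
        then have eq': "\<forall>x\<in>sites n. \<zeta> x = \<zeta>' x" by (simp add: sites_def)
        have "\<psi> \<zeta> = \<psi> \<zeta>'"
          by (rule ext, rule local_onD[OF l1]) (use eq' in blast)
        moreover have "\<psi> \<zeta>' \<zeta> = \<psi> \<zeta>' \<zeta>'"
          by (rule local_onD[OF l2]) (use eq' in blast)
        moreover have "nn_gen n (\<psi> \<zeta>') \<zeta> = nn_gen n (\<psi> \<zeta>') \<zeta>'"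
          by (rule local_onD[OF local_on_nn_gen[OF l2]]) (use eq in blast)
        ultimately show "?E \<zeta> = ?E \<zeta>'" by simp
      qed
      have locT: "local_on (sites (Suc n)) (S.twisted \<theta> (Suc q))"
        using S.local_on_twisted[of \<theta> "Suc q"] by (auto simp: local_on_def sites_def)
      have int: "integrable M (\<lambda>\<omega>. W k \<omega> * g (\<eta> s \<omega>))" if g: "local_on (sites (Suc n)) g" for g :: "config \<Rightarrow> complex"
      proof -
        obtain K where K: "\<And>\<zeta>. cmod (g \<zeta>) \<le> K"
          using finite_imp_bounded[OF local_on_finite_range[OF finite_sites g]]
          by (auto simp: bounded_iff)
        show ?thesis
        proof (rule integrable_const_bound[where B=K])
          show "AE \<omega> in M. cmod (W k \<omega> * g (\<eta> s \<omega>)) \<le> K"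
            by (intro AE_I2) (simp add: norm_mult W_def K)
          show "(\<lambda>\<omega>. W k \<omega> * g (\<eta> s \<omega>)) \<in> borel_measurable M"
            by (intro borel_measurable_times past_M[OF W] local_M[OF finite_sites g s])
        qed
      qed
      have "(\<integral>\<omega>. W k \<omega> * ?E (\<eta> s \<omega>) \<partial>M) - Z k = (\<integral>\<omega>. W k \<omega> * ?e (\<eta> s \<omega>) \<partial>M)"
        unfolding Z0 right_diff_distrib
        by (rule Bochner_Integration.integral_diff[symmetric]) (intro int locE locT)+
      also have "cmod \<dots> \<le> (\<integral>\<omega>. cmod (W k \<omega> * ?e (\<eta> s \<omega>)) \<partial>M)"
        by (rule integral_norm_bound)
      also have "\<dots> \<le> h * S.boundary_error q"
      proof (rule integral_le_const)
        show "integrable M (\<lambda>\<omega>. cmod (W k \<omega> * ?e (\<eta> s \<omega>)))"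
          unfolding right_diff_distrib
          by (intro integrable_norm Bochner_Integration.integrable_diff int locE locT)
        show "AE \<omega> in M. cmod (W k \<omega> * ?e (\<eta> s \<omega>)) \<le> h * S.boundary_error q"
          unfolding norm_mult W_def norm_cis mult_1 by (intro AE_I2 e)
      qed
      finally have 1: "cmod ((\<integral>\<omega>. W k \<omega> * ?E (\<eta> s \<omega>) \<partial>M) - Z k) \<le> h * S.boundary_error q" .
      have "cmod (Z (Suc k) - (\<integral>\<omega>. W k \<omega> * ?E (\<eta> s \<omega>) \<partial>M)) \<le> \<epsilon> * h"
        unfolding Z1
      proof (intro step[rule_format, OF s] \<psi>1 l1 l2)
        show "W k \<in> borel_measurable (past M \<eta> s)" using W[of k] by (simp only: s_def)
        show "cmod (W k \<omega>) \<le> 1" for \<omega> by (simp add: W_def)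
      qed
      from norm_triangle_mono[OF this 1] show ?thesis
        by (simp add: algebra_simps q_def)
    qed
    then have "cmod (Z m - Z 0) \<le> (\<Sum>k<m. h * (\<epsilon> + S.boundary_error (m - Suc k)))"
      unfolding sum_lessThan_telescope[of Z m, symmetric] by (intro sum_norm_le) auto
    also have "\<dots> = (\<Sum>k<m. h * (\<epsilon> + S.boundary_error k))"
      by (rule sum.nat_diff_reindex)
    finally have "cmod (Z m - Z 0) \<le> (\<Sum>k<m. h * (\<epsilon> + S.boundary_error k))" .
    moreover have "Z m = (\<integral>\<omega>. cis (\<theta> * grid_current h m \<omega>) \<partial>M)"
      by (simp add: Z_def W_def S.twisted_0)
    moreover have "Z 0 = (\<integral>\<omega>. S.twisted \<theta> m (\<eta> 0 \<omega>) \<partial>M)"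
      by (simp add: Z_def W_def grid_current_def)
    ultimately show "stirring_chain (h / 2) n \<and>
     cmod ((\<integral>\<omega>. cis (\<theta> * grid_current h m \<omega>) \<partial>M) - (\<integral>\<omega>. S.twisted \<theta> m (\<eta> 0 \<omega>) \<partial>M))
       \<le> (\<Sum>k<m. h * (\<epsilon> + S.boundary_error k))"
      using S.stirring_chain_axioms by simp
  qed
qed

end

section \<open>Comparison with the simple random walk\<close>

abbreviation walk :: "real \<Rightarrow> nat \<Rightarrow> int pmf" where
  "walk r k \<equiv> lazy_chain r {-1, 1} (+) 0 k"

locale simple_walk =
  fixes r :: real
  assumes r_pos: "0 \<le> r" and r_half: "2 * r \<le> 1"
begin

sublocale lazy r "{-1, 1} :: int set" "(+)"
  using r_pos r_half by unfold_locales auto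

lemma walk_op_eq:
  fixes F :: "int \<Rightarrow> 'c::real_vector"
  shows "lazy_op r {-1, 1} (+) F x = F x + r *\<^sub>R (F (x + 1) + F (x - 1) - 2 *\<^sub>R F x)"
  by (simp add: lazy_op_def scaleR_2 algebra_simps)

lemma walk_second_moment: "measure_pmf.expectation (walk r k) (\<lambda>x. (real_of_int x)\<^sup>2) = 2 * r * k"
proof (induction k)
  case (Suc k)
  have eq: "lazy_op r {-1, 1} (+) (\<lambda>x. (real_of_int x)\<^sup>2) = (\<lambda>x. (real_of_int x)\<^sup>2 + 2 * r)"
    by (rule ext, unfold walk_op_eq) (simp add: power2_eq_square algebra_simps)
  show ?case
    unfolding expectation_chain_Suc eq
    using Suc by (subst Bochner_Integration.integral_add) (simp_all add: algebra_simps)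
qed simp

lemma walk_char:
  "measure_pmf.expectation (walk r k) (\<lambda>x. cis (u * real_of_int x)) = of_real ((1 - 2 * r * (1 - cos u)) ^ k)"
proof (induction k)
  case (Suc k)
  have c: "cis (u * real_of_int (x + 1)) = cis (u * real_of_int x) * cis u"
    "cis (u * real_of_int (x - 1)) = cis (u * real_of_int x) * cis (- u)" for x
    by (simp_all add: cis_mult algebra_simps)
  have d: "cis u + cis (- u) = of_real (2 * cos u)"
    by (simp add: complex_eq_iff)
  have eq: "lazy_op r {-1, 1} (+) (\<lambda>x. cis (u * real_of_int x)) =
      (\<lambda>x. of_real (1 - 2 * r * (1 - cos u)) * cis (u * real_of_int x))"
  proof
    fix x
    have "lazy_op r {-1, 1} (+) (\<lambda>x. cis (u * real_of_int x)) x =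
        cis (u * real_of_int x) * (1 + of_real r * (cis u + cis (- u) - 2))"
      unfolding walk_op_eq c by (simp add: scaleR_conv_of_real algebra_simps)
    also have "\<dots> = of_real (1 - 2 * r * (1 - cos u)) * cis (u * real_of_int x)"
      unfolding d by (simp add: algebra_simps)
    finally show "lazy_op r {-1, 1} (+) (\<lambda>x. cis (u * real_of_int x)) x =
        of_real (1 - 2 * r * (1 - cos u)) * cis (u * real_of_int x)" .
  qed
  show ?case
    unfolding expectation_chain_Suc eq
    by (subst Bochner_Integration.integral_mult_right) (simp_all add: Suc)
qed simp

text \<open>The solution of the discrete heat equation on the whole line with the indicator of the
  half-line as initial value: the counterpart of \<open>dens\<close> without reflection at the ends
  of the box.\<close>

definition free :: "nat \<Rightarrow> int \<Rightarrow> real" where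
  "free k x = measure_pmf.expectation (walk r k) (\<lambda>z. of_bool (0 \<le> x + z))"

lemma free_0: "free 0 x = of_bool (0 \<le> x)"
  by (simp add: free_def)

lemma free_Suc: "free (Suc k) x = free k x + r * (free k (x + 1) + free k (x - 1) - 2 * free k x)"
proof -
  have eq: "lazy_op r {-1, 1} (+) (\<lambda>z. of_bool (0 \<le> x + z) :: real) =
    (\<lambda>z. of_bool (0 \<le> x + z) + r * (of_bool (0 \<le> (x + 1) + z) + of_bool (0 \<le> (x - 1) + z) - 2 * of_bool (0 \<le> x + z)))"
    by (rule ext, unfold walk_op_eq) (simp add: algebra_simps)
  show ?thesis
    unfolding free_def expectation_chain_Suc eq by simp
qed

lemma free_mono: "x \<le> y \<Longrightarrow> free k x \<le> free k y"
  unfolding free_def by (rule Bochner_Integration.integral_mono) (auto simp: of_bool_def)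

lemma free_nonneg: "0 \<le> free k x" and free_le_1: "free k x \<le> 1"
proof -
  show "0 \<le> free k x"
    unfolding free_def by (rule Bochner_Integration.integral_nonneg) simp
  show "free k x \<le> 1"
    unfolding free_def by (rule measure_pmf.integral_le_const) simp_all
qed

lemma of_bool_le_square:
  assumes "int n \<le> \<bar>z\<bar>" "1 \<le> n" shows "1 \<le> (real_of_int z)\<^sup>2 / (real n)\<^sup>2"
proof -
  have "real n \<le> \<bar>real_of_int z\<bar>" using assms(1) by linarith
  then have "(real n)\<^sup>2 \<le> \<bar>real_of_int z\<bar>\<^sup>2" by (intro power_mono) auto
  then show ?thesis using assms(2) by simp
qed

lemma chebyshev_walk:
  assumes "1 \<le> n" "\<And>z. P z \<Longrightarrow> int n \<le> \<bar>z\<bar>"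
  shows "measure_pmf.expectation (walk r k) (\<lambda>z. of_bool (P z)) \<le> 2 * r * k / (real n)\<^sup>2"
proof -
  have "measure_pmf.expectation (walk r k) (\<lambda>z. of_bool (P z)) \<le>
      measure_pmf.expectation (walk r k) (\<lambda>z. (real_of_int z)\<^sup>2 / (real n)\<^sup>2)"
  proof (rule Bochner_Integration.integral_mono)
    fix z
    show "of_bool (P z) \<le> (real_of_int z)\<^sup>2 / (real n)\<^sup>2"
      using of_bool_le_square[OF assms(2) assms(1), of z] by (cases "P z") simp_all
  qed simp_all
  also have "\<dots> = 2 * r * k / (real n)\<^sup>2"
    using walk_second_moment[of k] by simp
  finally show ?thesis .
qed

lemma free_right: "1 \<le> n \<Longrightarrow> 1 - free k (int n) \<le> 2 * r * k / (real n)\<^sup>2"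
proof -
  assume n: "1 \<le> n"
  have "1 - free k (int n) = measure_pmf.expectation (walk r k) (\<lambda>z. 1 - of_bool (0 \<le> int n + z))"
    unfolding free_def by (subst Bochner_Integration.integral_diff) auto
  also have "\<dots> = measure_pmf.expectation (walk r k) (\<lambda>z. of_bool (int n + z < 0))"
    by (intro Bochner_Integration.integral_cong) auto
  also have "\<dots> \<le> 2 * r * k / (real n)\<^sup>2"
    by (rule chebyshev_walk[OF n]) auto
  finally show ?thesis .
qed

lemma free_left: "1 \<le> n \<Longrightarrow> free k (- int n) \<le> 2 * r * k / (real n)\<^sup>2"
  unfolding free_def by (rule chebyshev_walk) auto

text \<open>Layer-cake formula: the number of \<open>x\<close> in \<open>{- int n..-1}\<close> with
  \<open>0 \<le> x + z\<close> is the positive part of \<open>z\<close> capped at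
  \<open>n\<close>.\<close>

lemma sum_free:
  "(\<Sum>x\<in>{- int n..-1}. free k x) = measure_pmf.expectation (walk r k) (\<lambda>z. min (max (real_of_int z) 0) (real n))"
proof -
  have "(\<Sum>x\<in>{- int n..-1}. of_bool (0 \<le> x + z)) = min (max (real_of_int z) 0) (real n)" for z
  proof -
    have "(\<Sum>x\<in>{- int n..-1}. of_bool (0 \<le> x + z) :: real) = real (card ({- int n..-1} \<inter> {x. 0 \<le> x + z}))"
      by simp
    also have "{- int n..-1} \<inter> {x. 0 \<le> x + z} = {max (- int n) (- z)..-1}" by auto
    also have "real (card \<dots>) = min (max (real_of_int z) 0) (real n)"
      by simp
    finally show ?thesis .
  qed
  then show ?thesis
    unfolding free_def by (subst Bochner_Integration.integral_sum[symmetric]) simp_all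
qed

end

lemma walk_op_interior:
  fixes c :: "int \<Rightarrow> real"
  assumes "x \<in> sites n" "1 \<le> n"
  shows "walk_op n r c x = c x + r * (of_bool (x \<noteq> int n) * (c (x + 1) - c x) + of_bool (x \<noteq> - int n) * (c (x - 1) - c x))"
proof -
  have "(\<Sum>y\<in>bonds n. c (bond_transpose y x) - c x) = (\<Sum>y\<in>bonds n. of_bool (y = x) * (c (x + 1) - c x) + of_bool (y = x - 1) * (c (x - 1) - c x))"
    by (intro sum.cong) (auto simp: Transposition.transpose_def)
  also have "\<dots> = of_bool (x \<noteq> int n) * (c (x + 1) - c x) + of_bool (x \<noteq> - int n) * (c (x - 1) - c x)"
    using assms by (auto simp: sum.distrib sum_distrib_right[symmetric] bonds_def sites_def of_bool_def)
  finally show ?thesis by (simp add: lazy_op_def)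
qed

section \<open>The reflected walk on the box against the free walk\<close>

context stirring_chain
begin

sublocale free: simple_walk r
proof
  have "r * 2 \<le> r * (2 * n)" using r0 n1 by (intro mult_left_mono) auto
  then show "2 * r \<le> 1" using r2 by linarith
qed (rule r0)

text \<open>A discrete Duhamel argument. The error is propagated by \<open>walk_op\<close>, which
  does not enlarge its maximum over the box, and each step adds a source living at the two ends.
  There the free solution is nearly constant: its increments are bounded by Chebyshev's inequality
  for the walk.\<close>

lemma dens_free:
  fixes K :: nat
  assumes "k \<le> K" "x \<in> \<Lambda>"
  shows "\<bar>dens k x - free.free k x\<bar> \<le> k * (r * (2 * r * K / (real n)\<^sup>2))"
  using assms
proof (induction k arbitrary: x)
  case 0
  then show ?case by (auto simp: dens_0 free.free_0 step_config_def sites_def)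
next
  case (Suc k)
  define \<delta> where "\<delta> = 2 * r * K / (real n)\<^sup>2"
  have \<delta>: "2 * r * k / (real n)\<^sup>2 \<le> \<delta>"
    unfolding \<delta>_def using Suc.prems r0 by (intro divide_right_mono mult_left_mono) auto
  have in_sites: "int n \<in> \<Lambda>" "- int n \<in> \<Lambda>" by (auto simp: sites_def)
  define e where "e z = dens k z - free.free k z" for z
  have e: "\<bar>e z\<bar> \<le> k * (r * \<delta>)" if "z \<in> \<Lambda>" for z
    using Suc.IH[of z] that Suc.prems by (simp add: e_def \<delta>_def)
  have op: "lazy_op r (bonds n) bond_transpose e x \<le> k * (r * \<delta>)"
    "lazy_op r (bonds n) bond_transpose (\<lambda>z. - e z) x \<le> k * (r * \<delta>)"
  proof -
    have "lazy_op r (bonds n) bond_transpose g x \<le> lazy_op r (bonds n) bond_transpose (\<lambda>_. k * (r * \<delta>)) x"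
      if "\<And>z. z \<in> \<Lambda> \<Longrightarrow> g z \<le> k * (r * \<delta>)" for g
      using that Suc.prems by (intro lazy_op_mono[OF walk.lazy_axioms, where P="\<lambda>z. z \<in> \<Lambda>"])
        (simp_all add: bond_transpose_sites)
    from this[of e] this[of "\<lambda>z. - e z"] show
      "lazy_op r (bonds n) bond_transpose e x \<le> k * (r * \<delta>)"
      "lazy_op r (bonds n) bond_transpose (\<lambda>z. - e z) x \<le> k * (r * \<delta>)"
      using e unfolding lazy_op_const abs_le_iff by blast+
  qed
  \<comment> \<open>The moves out of the box, which the free walk makes and the reflected one does
    not.\<close>
  define b where "b = of_bool (x = int n) * (free.free k (x + 1) - free.free k x) +
      of_bool (x = - int n) * (free.free k (x - 1) - free.free k x)"
  have eq: "dens (Suc k) x - free.free (Suc k) x = lazy_op r (bonds n) bond_transpose e x - r * b"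
    unfolding dens_Suc free.free_Suc walk_op_interior[OF Suc.prems(2) n1] b_def e_def
    by (auto simp: algebra_simps)
  have eq': "lazy_op r (bonds n) bond_transpose (\<lambda>z. - e z) x = - lazy_op r (bonds n) bond_transpose e x"
    unfolding walk_op_interior[OF Suc.prems(2) n1] by (simp add: algebra_simps)
  have b: "\<bar>b\<bar> \<le> \<delta>"
  proof -
    have "0 \<le> \<delta>" using r0 by (simp add: \<delta>_def)
    moreover have "0 \<le> free.free k (int n + 1) - free.free k (int n)"
      "free.free k (int n + 1) - free.free k (int n) \<le> \<delta>"
      using free.free_right[OF n1, of k] \<delta> free.free_le_1[of k "int n + 1"] free.free_mono[of "int n" "int n + 1" k]
      by linarith+
    moreover have "0 \<le> free.free k (- int n) - free.free k (- int n - 1)"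
      "free.free k (- int n) - free.free k (- int n - 1) \<le> \<delta>"
      using free.free_left[OF n1, of k] \<delta> free.free_nonneg[of k "- int n - 1"] free.free_mono[of "- int n - 1" "- int n" k]
      by linarith+
    ultimately show ?thesis using n1 by (auto simp: b_def)
  qed
  then have "\<bar>r * b\<bar> \<le> r * \<delta>" using r0 by (simp add: abs_mult mult_left_mono)
  then show ?case
    using op unfolding eq eq' \<delta>_def[symmetric] by (simp add: algebra_simps abs_le_iff)
qed

text \<open>With T = 2 r K the elapsed time, the free solution deviates at each end by at most T /
  n^2 and the comparison adds T^2 / (2 n^2); the constant collects both ends.\<close>

lemma boundary_dens:
  fixes K :: nat
  assumes "k \<le> K"
  shows "1 - dens k (int n) + dens k (- int n) \<le> (2 * (2 * r * K) + (2 * r * K)\<^sup>2) / (real n)\<^sup>2"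
proof -
  define T where "T = 2 * r * K"
  have T: "2 * r * k \<le> T" unfolding T_def using assms r0 by (intro mult_left_mono) auto
  have "k * (r * (2 * r * K / (real n)\<^sup>2)) \<le> K * (r * (2 * r * K / (real n)\<^sup>2))"
    using assms r0 by (intro mult_right_mono) auto
  also have "\<dots> = T\<^sup>2 / 2 / (real n)\<^sup>2" by (simp add: T_def power2_eq_square)
  finally have 1: "k * (r * (2 * r * K / (real n)\<^sup>2)) \<le> T\<^sup>2 / 2 / (real n)\<^sup>2" .
  have 2: "2 * r * k / (real n)\<^sup>2 \<le> T / (real n)\<^sup>2"
    using T by (intro divide_right_mono) auto
  have "int n \<in> \<Lambda>" "- int n \<in> \<Lambda>" by (auto simp: sites_def)
  define X Y where "X = T / (real n)\<^sup>2" and "Y = T\<^sup>2 / 2 / (real n)\<^sup>2"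
  have "\<bar>dens k (int n) - free.free k (int n)\<bar> \<le> Y" "\<bar>dens k (- int n) - free.free k (- int n)\<bar> \<le> Y"
    "1 - free.free k (int n) \<le> X" "free.free k (- int n) \<le> X"
    unfolding X_def Y_def
    using order_trans[OF dens_free[OF assms \<open>int n \<in> \<Lambda>\<close>] 1] order_trans[OF dens_free[OF assms \<open>- int n \<in> \<Lambda>\<close>] 1]
      order_trans[OF free.free_right[OF n1] 2] order_trans[OF free.free_left[OF n1] 2] by blast+
  then have "1 - dens k (int n) + dens k (- int n) \<le> 2 * (X + Y)"
    unfolding abs_le_iff by argo
  also have "\<dots> = (2 * T + T\<^sup>2) / (real n)\<^sup>2" by (simp add: add_divide_distrib X_def Y_def)
  finally show ?thesis unfolding T_def .
qed

lemma mean_crossed_walk: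
  "\<bar>mean_crossed k - measure_pmf.expectation (walk r k) (\<lambda>z. min (max (real_of_int z) 0) (real n))\<bar> \<le> (2 * r * k)\<^sup>2 / (2 * n)"
proof -
  have "mean_crossed k - measure_pmf.expectation (walk r k) (\<lambda>z. min (max (real_of_int z) 0) (real n)) =
      (\<Sum>x\<in>{- int n..-1}. dens k x - free.free k x)"
    by (simp add: mean_crossed_def free.sum_free[symmetric] sum_subtractf)
  also have "\<bar>\<dots>\<bar> \<le> (\<Sum>x\<in>{- int n..-1}. k * (r * (2 * r * k / (real n)\<^sup>2)))"
    by (intro order_trans[OF sum_abs] sum_mono dens_free) (auto simp: sites_def)
  also have "\<dots> = (2 * r * k)\<^sup>2 / (2 * n)"
    using n1 by (simp add: power2_eq_square field_simps)
  finally show ?thesis .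
qed

end

section \<open>The Bernoulli initial distribution\<close>

lemma space_bernoulli [simp]: "space (bernoulli_config \<rho>) = UNIV"
  by (simp add: bernoulli_config_def space_PiM)

lemma sets_bernoulli: "sets (bernoulli_config \<rho>) = sets config_space"
  unfolding bernoulli_config_def config_space_def by (rule sets_PiM_cong) simp_all

lemma prob_space_bernoulli: "prob_space (bernoulli_config \<rho>)"
  unfolding bernoulli_config_def by (rule prob_space_PiM) (rule measure_pmf.prob_space_axioms)

lemma bernoulli_integral_prod:
  fixes g :: "int \<Rightarrow> bool \<Rightarrow> complex"
  assumes "finite I" "0 \<le> \<rho>" "\<rho> \<le> 1"
  shows "(\<integral>\<eta>. (\<Prod>x\<in>I. g x (\<eta> x)) \<partial>bernoulli_config \<rho>) = (\<Prod>x\<in>I. \<rho> *\<^sub>R g x True + (1 - \<rho>) *\<^sub>R g x False)"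
    and "integrable (bernoulli_config \<rho>) (\<lambda>\<eta>. \<Prod>x\<in>I. g x (\<eta> x))"
proof -
  let ?B = "\<lambda>_ :: int. measure_pmf (bernoulli_pmf \<rho>)"
  interpret P: product_prob_space ?B UNIV ..
  interpret B: prob_space "bernoulli_config \<rho>" by (rule prob_space_bernoulli)
  have marg: "distr (bernoulli_config \<rho>) (?B x) (\<lambda>\<eta>. \<eta> x) = ?B x" for x
    unfolding bernoulli_config_def by (rule P.PiM_component) simp
  have mc: "(\<lambda>\<eta>. \<eta> x) \<in> measurable (bernoulli_config \<rho>) (?B x)" for x
    unfolding bernoulli_config_def by (rule measurable_component_singleton) simp
  have ind: "B.indep_vars ?B (\<lambda>x \<eta>. \<eta> x) UNIV"
  proof (subst B.indep_vars_iff_distr_eq_PiM')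
    show "distr (bernoulli_config \<rho>) (PiM UNIV ?B) (\<lambda>\<eta>. \<lambda>x\<in>UNIV. \<eta> x) =
        PiM UNIV (\<lambda>x. distr (bernoulli_config \<rho>) (?B x) (\<lambda>\<eta>. \<eta> x))"
      unfolding marg by (simp add: bernoulli_config_def restrict_def distr_id)
  qed (simp, rule mc)
  have ind': "B.indep_vars (\<lambda>_. borel) (\<lambda>x \<eta>. g x (\<eta> x)) I"
    by (rule B.indep_vars_compose2[OF B.indep_vars_subset[OF ind]]) simp_all
  have int1: "(\<integral>\<eta>. g x (\<eta> x) \<partial>bernoulli_config \<rho>) = \<rho> *\<^sub>R g x True + (1 - \<rho>) *\<^sub>R g x False" for x
  proof -
    have "(\<integral>\<eta>. g x (\<eta> x) \<partial>bernoulli_config \<rho>) = (\<integral>b. g x b \<partial>distr (bernoulli_config \<rho>) (?B x) (\<lambda>\<eta>. \<eta> x))"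
      by (rule integral_distr[symmetric, OF mc]) simp
    also have "\<dots> = (\<integral>b. g x b \<partial>bernoulli_pmf \<rho>)" unfolding marg ..
    also have "\<dots> = (\<Sum>b\<in>UNIV. pmf (bernoulli_pmf \<rho>) b *\<^sub>R g x b)"
      by (rule integral_measure_pmf) auto
    finally show ?thesis using assms by (simp add: UNIV_bool)
  qed
  have i: "integrable (bernoulli_config \<rho>) (\<lambda>\<eta>. g x (\<eta> x))" for x
  proof (rule B.integrable_const_bound[where B="cmod (g x True) + cmod (g x False)"])
    show "AE \<eta> in bernoulli_config \<rho>. cmod (g x (\<eta> x)) \<le> cmod (g x True) + cmod (g x False)"
    proof (rule AE_I2)
      fix \<eta> :: config
      show "cmod (g x (\<eta> x)) \<le> cmod (g x True) + cmod (g x False)"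
        by (cases "\<eta> x") simp_all
    qed
    show "(\<lambda>\<eta>. g x (\<eta> x)) \<in> borel_measurable (bernoulli_config \<rho>)"
      by (rule measurable_compose[OF mc]) simp
  qed
  show "(\<integral>\<eta>. (\<Prod>x\<in>I. g x (\<eta> x)) \<partial>bernoulli_config \<rho>) = (\<Prod>x\<in>I. \<rho> *\<^sub>R g x True + (1 - \<rho>) *\<^sub>R g x False)"
    unfolding B.indep_vars_lebesgue_integral[OF assms(1) ind' i] int1 ..
  show "integrable (bernoulli_config \<rho>) (\<lambda>\<eta>. \<Prod>x\<in>I. g x (\<eta> x))"
    by (rule B.indep_vars_integrable[OF assms(1) ind' i])
qed

lemma emeasure_bernoulli_origin:
  assumes "0 \<le> \<rho>" "\<rho> \<le> 1"
  shows "measure (bernoulli_config \<rho>) {\<eta>. \<eta> 0} = \<rho>" "{\<eta>. \<eta> 0} \<in> sets (bernoulli_config \<rho>)"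
proof -
  have "(\<lambda>\<eta>. \<eta> 0) -` {True} \<inter> space config_space \<in> sets config_space"
    by (rule measurable_sets[OF measurable_coordinate]) simp
  then show s: "{\<eta>. \<eta> 0} \<in> sets (bernoulli_config \<rho>)"
    by (simp add: sets_bernoulli vimage_def config_space_def space_PiM)
  have mc: "(\<lambda>\<eta>. \<eta> 0) \<in> measurable (bernoulli_config \<rho>) (measure_pmf (bernoulli_pmf \<rho>))"
    unfolding bernoulli_config_def by (rule measurable_component_singleton) simp
  have "measure (bernoulli_config \<rho>) {\<eta>. \<eta> 0} =
      measure (distr (bernoulli_config \<rho>) (measure_pmf (bernoulli_pmf \<rho>)) (\<lambda>\<eta>. \<eta> 0)) {True}"
    by (subst measure_distr[OF mc]) (simp_all add: vimage_def)
  also have "distr (bernoulli_config \<rho>) (measure_pmf (bernoulli_pmf \<rho>)) (\<lambda>\<eta>. \<eta> 0) = measure_pmf (bernoulli_pmf \<rho>)"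
    unfolding bernoulli_config_def by (rule distr_PiM_component) (simp_all add: measure_pmf.prob_space_axioms)
  finally show "measure (bernoulli_config \<rho>) {\<eta>. \<eta> 0} = \<rho>"
    using assms by (simp add: measure_pmf_single)
qed

lemma bernoulli_at_origin_integral:
  fixes F :: "config \<Rightarrow> complex"
  assumes "0 < \<rho>" "\<rho> \<le> 1" "F \<in> borel_measurable config_space"
  shows "(\<integral>\<eta>. F \<eta> \<partial>bernoulli_config_at_origin \<rho>) = (1 / \<rho>) *\<^sub>R (\<integral>\<eta>. of_bool (\<eta> 0) *\<^sub>R F \<eta> \<partial>bernoulli_config \<rho>)"
proof -
  interpret B: prob_space "bernoulli_config \<rho>" by (rule prob_space_bernoulli)
  have s: "{\<eta>. \<eta> 0} \<in> sets (bernoulli_config \<rho>)" and m: "measure (bernoulli_config \<rho>) {\<eta>. \<eta> 0} = \<rho>"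
    using emeasure_bernoulli_origin[of \<rho>] assms by auto
  have F: "F \<in> borel_measurable (bernoulli_config \<rho>)"
    using assms(3) by (simp cong: measurable_cong_sets add: measurable_cong_sets[OF sets_bernoulli refl])
  have "indicator {\<eta>. \<eta> 0} \<eta> / ennreal \<rho> = ennreal (indicator {\<eta>. \<eta> 0} \<eta> / \<rho>)" for \<eta> :: config
    using divide_ennreal[of 1 \<rho>] assms(1) by (cases "\<eta> 0") simp_all
  then have "bernoulli_config_at_origin \<rho> = density (bernoulli_config \<rho>) (\<lambda>\<eta>. ennreal (indicator {\<eta>. \<eta> 0} \<eta> / \<rho>))"
    unfolding bernoulli_config_at_origin_def uniform_measure_def B.emeasure_eq_measure m by simp
  moreover have "(\<lambda>\<eta>. indicator {\<eta>. \<eta> 0} \<eta> / \<rho>) \<in> borel_measurable (bernoulli_config \<rho>)"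
    by (intro borel_measurable_divide borel_measurable_indicator s) simp
  ultimately have "(\<integral>\<eta>. F \<eta> \<partial>bernoulli_config_at_origin \<rho>) = (\<integral>\<eta>. (indicator {\<eta>. \<eta> 0} \<eta> / \<rho>) *\<^sub>R F \<eta> \<partial>bernoulli_config \<rho>)"
    using F assms(1) by (simp add: integral_density)
  also have "\<dots> = (\<integral>\<eta>. (1 / \<rho>) *\<^sub>R (of_bool (\<eta> 0) *\<^sub>R F \<eta>) \<partial>bernoulli_config \<rho>)"
    by (rule Bochner_Integration.integral_cong) (auto simp: indicator_def)
  also have "\<dots> = (1 / \<rho>) *\<^sub>R (\<integral>\<eta>. of_bool (\<eta> 0) *\<^sub>R F \<eta> \<partial>bernoulli_config \<rho>)"
    by (rule integral_scaleR_right)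
  finally show ?thesis .
qed

definition bernoulli_char :: "real \<Rightarrow> real \<Rightarrow> complex" where
  "bernoulli_char \<rho> u = \<rho> *\<^sub>R cis u + of_real (1 - \<rho>)"

lemma cmod_bernoulli_char: "0 \<le> \<rho> \<Longrightarrow> \<rho> \<le> 1 \<Longrightarrow> cmod (bernoulli_char \<rho> u) \<le> 1"
  unfolding bernoulli_char_def by (rule norm_triangle_le) (simp del: of_real_diff)

lemma cmod_cis_minus_1: "cmod (cis u - 1) \<le> \<bar>u\<bar>"
proof -
  have "cmod (iexp u - (\<Sum>k\<le>0. (\<i> * u) ^ k / fact k)) \<le> \<bar>u\<bar> ^ Suc 0 / fact (Suc 0)"
    by (rule iexp_approx1)
  then show ?thesis by (simp add: cis_conv_exp)
qed

text \<open>The second factor is the complex conjugate of the first, so this is a squared modulus.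
  The subtracted quantity is called \<open>q\<close> from here on.\<close>

lemma bernoulli_char_product:
  "bernoulli_char \<rho> u * bernoulli_char \<rho> (- u) = of_real (1 - 2 * \<rho> * (1 - \<rho>) * (1 - cos u))"
proof -
  have "cis u * cis (- u) = 1" by (simp add: cis_mult)
  moreover have "cis u + cis (- u) = of_real (2 * cos u)"
    by (simp add: complex_eq_iff)
  moreover have "bernoulli_char \<rho> u * bernoulli_char \<rho> (- u) =
      of_real (\<rho>\<^sup>2) * (cis u * cis (- u)) + of_real (\<rho> * (1 - \<rho>)) * (cis u + cis (- u)) + of_real ((1 - \<rho>)\<^sup>2)"
    by (simp add: bernoulli_char_def scaleR_conv_of_real power2_eq_square algebra_simps)
  ultimately show ?thesis
    by (simp add: power2_eq_square algebra_simps flip: of_real_mult of_real_add)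
qed

text \<open>Conditioning on a particle at the origin replaces the factor \<open>bernoulli_char \<rho> (\<theta> * D 0)\<close> of the
  product by \<open>cis (\<theta> * D 0)\<close>.\<close>

lemma bernoulli_at_origin_char:
  fixes D :: "int \<Rightarrow> real"
  assumes \<rho>: "0 < \<rho>" "\<rho> \<le> 1" and I: "finite I" "0 \<in> I" and D0: "\<bar>D 0\<bar> \<le> 1"
  shows "cmod ((\<integral>\<eta>. cis (\<theta> * (\<Sum>x\<in>I. D x * of_bool (\<eta> x))) \<partial>bernoulli_config_at_origin \<rho>) -
    (\<Prod>x\<in>I. bernoulli_char \<rho> (\<theta> * D x))) \<le> \<bar>\<theta>\<bar>"
proof -
  define F where "F \<eta> = cis (\<theta> * (\<Sum>x\<in>I. D x * of_bool (\<eta> x)))" for \<eta> :: config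
  have F: "F \<in> borel_measurable config_space"
  proof -
    have "(\<lambda>\<eta>. \<theta> * (\<Sum>x\<in>I. D x * of_bool (\<eta> x))) \<in> borel_measurable config_space"
      by measurable
    then show ?thesis unfolding F_def[abs_def]
      by (rule borel_measurable_continuous_on[of cis, rotated]) (intro continuous_intros)
  qed
  \<comment> \<open>The indicator of a particle at the origin is absorbed into the factor of site 0,
    so that the conditioned integral is again that of a product.\<close>
  define g where "g x b = (if x = 0 then of_bool b else 1) * cis (\<theta> * (D x * of_bool b))" for x :: int and b
  have "cis (\<Sum>x\<in>I. f x) = (\<Prod>x\<in>I. cis (f x))" for f :: "int \<Rightarrow> real"
    using I(1) by (induction I rule: finite_induct) (simp_all add: cis_mult[symmetric])
  then have "F \<eta> = (\<Prod>x\<in>I. cis (\<theta> * (D x * of_bool (\<eta> x))))" for \<eta>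
    unfolding F_def sum_distrib_left .
  then have prod: "of_bool (\<eta> 0) *\<^sub>R F \<eta> = (\<Prod>x\<in>I. g x (\<eta> x))" for \<eta>
    using I by (simp add: g_def prod.distrib prod.delta scaleR_conv_of_real)
  let ?P = "\<Prod>x\<in>I - {0}. bernoulli_char \<rho> (\<theta> * D x)"
  have "(\<integral>\<eta>. F \<eta> \<partial>bernoulli_config_at_origin \<rho>) = (1 / \<rho>) *\<^sub>R (\<Prod>x\<in>I. \<rho> *\<^sub>R g x True + (1 - \<rho>) *\<^sub>R g x False)"
    unfolding bernoulli_at_origin_integral[OF \<rho> F] prod using \<rho> I by (subst bernoulli_integral_prod) auto
  also have "(\<Prod>x\<in>I. \<rho> *\<^sub>R g x True + (1 - \<rho>) *\<^sub>R g x False) =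
      (\<rho> *\<^sub>R g 0 True + (1 - \<rho>) *\<^sub>R g 0 False) * (\<Prod>x\<in>I - {0}. \<rho> *\<^sub>R g x True + (1 - \<rho>) *\<^sub>R g x False)"
    using I by (rule prod.remove)
  also have "(\<Prod>x\<in>I - {0}. \<rho> *\<^sub>R g x True + (1 - \<rho>) *\<^sub>R g x False) = ?P"
    by (intro prod.cong) (auto simp: g_def bernoulli_char_def scaleR_conv_of_real)
  finally have 1: "(\<integral>\<eta>. F \<eta> \<partial>bernoulli_config_at_origin \<rho>) = cis (\<theta> * D 0) * ?P"
    using \<rho> by (simp add: g_def)
  have 2: "(\<Prod>x\<in>I. bernoulli_char \<rho> (\<theta> * D x)) = bernoulli_char \<rho> (\<theta> * D 0) * ?P"
    using I by (rule prod.remove)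
  have "cmod ?P \<le> 1"
    unfolding prod_norm[symmetric] using cmod_bernoulli_char \<rho> by (intro prod_le_1) auto
  have "cis (\<theta> * D 0) - bernoulli_char \<rho> (\<theta> * D 0) = of_real (1 - \<rho>) * (cis (\<theta> * D 0) - 1)"
    by (simp add: bernoulli_char_def scaleR_conv_of_real algebra_simps)
  then have "cmod (cis (\<theta> * D 0) - bernoulli_char \<rho> (\<theta> * D 0)) = (1 - \<rho>) * cmod (cis (\<theta> * D 0) - 1)"
    using \<rho> by (simp only: norm_mult norm_of_real)
  also have "\<dots> \<le> 1 * \<bar>\<theta> * D 0\<bar>"
    using \<rho> cmod_cis_minus_1 by (intro mult_mono) auto
  also have "\<dots> \<le> \<bar>\<theta>\<bar>"
    using D0 by (simp add: abs_mult mult_left_le)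
  finally have 3: "cmod (cis (\<theta> * D 0) - bernoulli_char \<rho> (\<theta> * D 0)) \<le> \<bar>\<theta>\<bar>" .
  have "cmod (cis (\<theta> * D 0) * ?P - bernoulli_char \<rho> (\<theta> * D 0) * ?P) \<le> \<bar>\<theta>\<bar> * 1"
    unfolding left_diff_distrib[symmetric] norm_mult using 3 \<open>cmod ?P \<le> 1\<close>
    by (intro mult_mono) auto
  then show ?thesis
    unfolding 1[unfolded F_def] 2 by simp
qed

section \<open>The characteristic function of the current\<close>

lemma lazy_chain_invariant:
  assumes "finite B" "B \<noteq> {}" "P a" "\<And>y a. y \<in> B \<Longrightarrow> P a \<Longrightarrow> P (f y a)"
    and "b \<in> set_pmf (lazy_chain r B f a k)"
  shows "P b"
  using assms(5)
proof (induction k arbitrary: b)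
  case 0
  then show ?case using assms(3) by simp
next
  case (Suc k)
  then obtain c where "c \<in> set_pmf (lazy_chain r B f a k)" "b \<in> set_pmf (lazy_step r B f c)"
    by auto
  with Suc.IH[OF this(1)] show ?case
    using assms(1,2,4) by (auto simp: lazy_step_def split: if_splits)
qed

text \<open>As a function of the exponent this is exp (- l x) with l = - ln (1 - q), whose slope on
  the nonnegative axis is at most l; and l is at most 2 q for q at most 1/2. It allows a random
  exponent to be replaced by its mean.\<close>

lemma powr_one_minus_lipschitz:
  fixes q x y :: real
  assumes "0 \<le> q" "q \<le> 1 / 2" "0 \<le> x" "0 \<le> y"
  shows "\<bar>(1 - q) powr x - (1 - q) powr y\<bar> \<le> 2 * q * \<bar>x - y\<bar>"
proof -
  define l where "l = - ln (1 - q)"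
  have l0: "0 \<le> l" using assms by (simp add: l_def)
  have "- q - 2 * q\<^sup>2 \<le> ln (1 - q)" using assms by (intro ln_one_minus_pos_lower_bound) auto
  moreover have "2 * q\<^sup>2 \<le> q"
    using mult_left_mono[of q "1 / 2" "2 * q"] assms by (simp add: power2_eq_square)
  ultimately have l2: "l \<le> 2 * q" by (simp add: l_def)
  have p: "(1 - q) powr z = exp (- (l * z))" for z
    using assms by (simp add: powr_def l_def mult.commute)
  have "\<bar>exp (- (l * u)) - exp (- (l * v))\<bar> \<le> l * \<bar>u - v\<bar>" if "u \<le> v" "0 \<le> u" for u v
  proof -
    have "exp (- (l * v)) = exp (- (l * u)) * exp (- (l * (v - u)))"
      by (simp add: exp_add[symmetric] algebra_simps)
    then have "exp (- (l * u)) - exp (- (l * v)) = exp (- (l * u)) * (1 - exp (- (l * (v - u))))"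
      by (simp add: algebra_simps)
    also have "\<dots> \<le> 1 * (1 - exp (- (l * (v - u))))"
      using l0 that by (intro mult_right_mono) auto
    also have "\<dots> \<le> l * (v - u)"
      using exp_ge_add_one_self[of "- (l * (v - u))"] by simp
    finally have "exp (- (l * u)) - exp (- (l * v)) \<le> l * (v - u)" .
    moreover have "exp (- (l * v)) \<le> exp (- (l * u))"
      using l0 that by (simp add: mult_left_mono)
    ultimately show ?thesis using that by simp
  qed
  note lip = this
  have "\<bar>exp (- (l * x)) - exp (- (l * y))\<bar> \<le> l * \<bar>x - y\<bar>"
  proof (cases "x \<le> y")
    case True
    then show ?thesis by (rule lip[OF _ assms(3)])
  next
    case False
    then have "y \<le> x" by simp
    from lip[OF this assms(4)] show ?thesis
      by (simp only: abs_minus_commute[of x y] abs_minus_commute[of "exp (- (l * x))"])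
  qed
  also have "\<dots> \<le> 2 * q * \<bar>x - y\<bar>"
    using l2 by (intro mult_right_mono) auto
  finally show ?thesis by (simp add: p)
qed

lemma prob_space_at_origin:
  assumes "0 < \<rho>" "\<rho> \<le> 1"
  shows "prob_space (bernoulli_config_at_origin \<rho>)"
  unfolding bernoulli_config_at_origin_def
proof (rule prob_space_uniform_measure)
  interpret B: prob_space "bernoulli_config \<rho>" by (rule prob_space_bernoulli)
  show "emeasure (bernoulli_config \<rho>) {\<eta>. \<eta> 0} \<noteq> 0"
    using emeasure_bernoulli_origin(1)[of \<rho>] assms by (simp add: B.emeasure_eq_measure)
  show "emeasure (bernoulli_config \<rho>) {\<eta>. \<eta> 0} \<noteq> \<infinity>"
    by (simp add: B.emeasure_eq_measure)
qed

lemma sets_at_origin: "sets (bernoulli_config_at_origin \<rho>) = sets config_space"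
  by (simp add: bernoulli_config_at_origin_def sets_bernoulli)

context stirring_chain
begin

lemma pairing_total:
  assumes "A \<in> set_pmf (\<mu> k)"
  shows "pairing n (\<lambda>_. 1) A = real n + 1"
proof (rule lazy_chain_invariant[where P="\<lambda>A. pairing n (\<lambda>_. 1) A = real n + 1", OF finite_B B_ne _ _ assms])
  have "pairing n (\<lambda>_. 1) (step_config n) = (\<Sum>x\<in>{0..int n}. 1)"
    unfolding pairing_def step_config_def
    by (intro sum.mono_neutral_cong_right) (auto simp: sites_def)
  then show "pairing n (\<lambda>_. 1) (step_config n) = real n + 1" by simp
qed (simp add: pairing_bond_swap)

text \<open>Relative to the step configuration, \<open>A\<close> has +1 at its particles on the left
  and -1 at its holes on the right. Conservation of particles makes these equally many, so the
  factors pair up to a real base. The power is written with \<open>powr\<close> since the exponent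
  will be replaced by a mean, which need not be an integer.\<close>

lemma bernoulli_char_stirring:
  assumes A: "A \<in> set_pmf (\<mu> k)" and q: "2 * \<rho> * (1 - \<rho>) * (1 - cos \<theta>) < 1"
  shows "(\<Prod>x\<in>\<Lambda>. bernoulli_char \<rho> (\<theta> * (of_bool (A x) - of_bool (step_config n x)))) =
    of_real ((1 - 2 * \<rho> * (1 - \<rho>) * (1 - cos \<theta>)) powr crossed A)"
proof -
  let ?L = "{- int n..-1}" and ?R = "{0..int n}"
  let ?f = "\<lambda>x. bernoulli_char \<rho> (\<theta> * (of_bool (A x) - of_bool (step_config n x)))"
  define N where "N = card {x\<in>?L. A x}"
  have split: "\<Lambda> = ?L \<union> ?R" by (auto simp: sites_def)
  have one: "bernoulli_char \<rho> 0 = 1" by (simp add: bernoulli_char_def scaleR_conv_of_real)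
  have cr: "crossed A = real N"
    by (simp add: crossed_def N_def Int_def)
  have "pairing n (\<lambda>_. 1) A = (\<Sum>x\<in>?L. of_bool (A x)) + (\<Sum>x\<in>?R. of_bool (A x))"
    unfolding pairing_def split by (subst sum.union_disjoint) auto
  moreover have "(\<Sum>x\<in>?R. of_bool (\<not> A x)) = (\<Sum>x\<in>?R. 1 - of_bool (A x) :: real)"
    by (intro sum.cong) auto
  ultimately have "(\<Sum>x\<in>?R. of_bool (\<not> A x)) = real N"
    using pairing_total[OF A] cr by (simp add: crossed_def sum_subtractf del: sum_of_bool_eq)
  then have card: "card {x\<in>?R. \<not> A x} = N"
    by (simp add: Int_def)
  have "(\<Prod>x\<in>?L. ?f x) = (\<Prod>x\<in>?L. if A x then bernoulli_char \<rho> \<theta> else 1)"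
    by (intro prod.cong) (auto simp: step_config_def one)
  also have "\<dots> = bernoulli_char \<rho> \<theta> ^ N"
    by (simp add: prod.inter_filter[symmetric] N_def)
  finally have 1: "(\<Prod>x\<in>?L. ?f x) = bernoulli_char \<rho> \<theta> ^ N" .
  have "(\<Prod>x\<in>?R. ?f x) = (\<Prod>x\<in>?R. if \<not> A x then bernoulli_char \<rho> (- \<theta>) else 1)"
    by (intro prod.cong) (auto simp: step_config_def one)
  also have "\<dots> = bernoulli_char \<rho> (- \<theta>) ^ N"
    using card by (simp only: prod.inter_filter[symmetric] finite_atLeastAtMost_int prod_constant)
  finally have 2: "(\<Prod>x\<in>?R. ?f x) = bernoulli_char \<rho> (- \<theta>) ^ N" .
  have "(\<Prod>x\<in>\<Lambda>. ?f x) = (\<Prod>x\<in>?L. ?f x) * (\<Prod>x\<in>?R. ?f x)"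
    unfolding split by (rule prod.union_disjoint) auto
  also have "\<dots> = of_real ((1 - 2 * \<rho> * (1 - \<rho>) * (1 - cos \<theta>)) ^ N)"
    unfolding 1 2 power_mult_distrib[symmetric] bernoulli_char_product of_real_power ..
  also have "(1 - 2 * \<rho> * (1 - \<rho>) * (1 - cos \<theta>)) ^ N = (1 - 2 * \<rho> * (1 - \<rho>) * (1 - cos \<theta>)) powr crossed A"
    unfolding cr using q by (subst powr_realpow) auto
  finally show ?thesis .
qed

lemma mean_crossed_nonneg: "0 \<le> mean_crossed k"
  unfolding mean_crossed_def by (intro sum_nonneg dens_nonneg)

text \<open>For each fixed \<open>A\<close> the conditioning at the origin costs
  \<open>\<bar>\<theta>\<bar>\<close>. Replacing the exponent by its mean costs \<open>2 * q\<close>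
  times the mean absolute deviation, which the variance bound controls.\<close>

lemma twisted_initial:
  assumes \<rho>: "0 < \<rho>" "\<rho> \<le> 1" and q_def: "q = 2 * \<rho> * (1 - \<rho>) * (1 - cos \<theta>)" and q: "q \<le> 1 / 2"
  shows "cmod ((\<integral>\<eta>. twisted \<theta> k \<eta> \<partial>bernoulli_config_at_origin \<rho>) - of_real ((1 - q) powr mean_crossed k))
    \<le> \<bar>\<theta>\<bar> + 2 * q * sqrt (2 * mean_crossed k)"
proof -
  let ?\<nu> = "bernoulli_config_at_origin \<rho>"
  interpret V: prob_space ?\<nu> by (rule prob_space_at_origin[OF \<rho>])
  define D where "D A x = (of_bool (A x) - of_bool (step_config n x) :: real)" for A :: config and x
  define F where "F A \<eta> = cis (\<theta> * (\<Sum>x\<in>\<Lambda>. D A x * of_bool (\<eta> x)))" for A \<eta>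
  define c :: complex where "c = of_real ((1 - q) powr mean_crossed k)"
  have q0: "0 \<le> q" unfolding q_def using \<rho> by simp
  have F: "F A \<in> borel_measurable ?\<nu>" for A
  proof -
    have "(\<lambda>\<eta>. \<theta> * (\<Sum>x\<in>\<Lambda>. D A x * of_bool (\<eta> x))) \<in> borel_measurable config_space"
      by measurable
    then have "F A \<in> borel_measurable config_space" unfolding F_def[abs_def]
      by (rule borel_measurable_continuous_on[of cis, rotated]) (intro continuous_intros)
    then show ?thesis by (simp add: measurable_cong_sets[OF sets_at_origin refl])
  qed
  have iF: "integrable ?\<nu> (F A)" for A
    by (rule V.integrable_const_bound[where B=1]) (simp_all add: F F_def)
  let ?S = "set_pmf (\<mu> k)"
  have "(\<integral>\<eta>. twisted \<theta> k \<eta> \<partial>?\<nu>) = (\<integral>\<eta>. (\<Sum>A\<in>?S. pmf (\<mu> k) A *\<^sub>R F A \<eta>) \<partial>?\<nu>)"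
    unfolding twisted_def overlap_diff F_def D_def
    by (intro Bochner_Integration.integral_cong refl integral_measure_pmf finite_set_chain)
  also have "\<dots> = (\<Sum>A\<in>?S. pmf (\<mu> k) A *\<^sub>R (\<integral>\<eta>. F A \<eta> \<partial>?\<nu>))"
    using iF by (subst Bochner_Integration.integral_sum) simp_all
  also have "\<dots> = measure_pmf.expectation (\<mu> k) (\<lambda>A. \<integral>\<eta>. F A \<eta> \<partial>?\<nu>)"
    by (rule integral_measure_pmf[symmetric]) (simp_all add: finite_set_chain)
  finally have eq: "(\<integral>\<eta>. twisted \<theta> k \<eta> \<partial>?\<nu>) - c = measure_pmf.expectation (\<mu> k) (\<lambda>A. (\<integral>\<eta>. F A \<eta> \<partial>?\<nu>) - c)"
    by (subst Bochner_Integration.integral_diff) simp_all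
  have bd: "cmod ((\<integral>\<eta>. F A \<eta> \<partial>?\<nu>) - c) \<le> \<bar>\<theta>\<bar> + 2 * q * \<bar>crossed A - mean_crossed k\<bar>" if A: "A \<in> ?S" for A
  proof -
    have "cmod ((\<integral>\<eta>. F A \<eta> \<partial>?\<nu>) - of_real ((1 - q) powr crossed A)) \<le> \<bar>\<theta>\<bar>"
    proof -
      have "0 \<in> \<Lambda>" by (simp add: sites_def)
      moreover have "\<bar>D A 0\<bar> \<le> 1" by (simp add: D_def of_bool_def)
      ultimately have "cmod ((\<integral>\<eta>. F A \<eta> \<partial>?\<nu>) - (\<Prod>x\<in>\<Lambda>. bernoulli_char \<rho> (\<theta> * D A x))) \<le> \<bar>\<theta>\<bar>"
        unfolding F_def by (intro bernoulli_at_origin_char[OF \<rho> finite_sites])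
      moreover have "2 * \<rho> * (1 - \<rho>) * (1 - cos \<theta>) < 1" using q by (simp add: q_def)
      ultimately show ?thesis
        unfolding D_def bernoulli_char_stirring[OF A \<open>2 * \<rho> * (1 - \<rho>) * (1 - cos \<theta>) < 1\<close>] q_def by simp
    qed
    moreover have "cmod (of_real ((1 - q) powr crossed A) - c) \<le> 2 * q * \<bar>crossed A - mean_crossed k\<bar>"
    proof -
      have "0 \<le> crossed A" unfolding crossed_def by (intro sum_nonneg) simp
      then show ?thesis
        unfolding c_def of_real_diff[symmetric] norm_of_real
        by (intro powr_one_minus_lipschitz q0 q mean_crossed_nonneg)
    qed
    ultimately show ?thesis
      using norm_triangle_mono[of "(\<integral>\<eta>. F A \<eta> \<partial>?\<nu>) - of_real ((1 - q) powr crossed A)" "\<bar>\<theta>\<bar>"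
        "of_real ((1 - q) powr crossed A) - c"] by simp
  qed
  have "cmod ((\<integral>\<eta>. twisted \<theta> k \<eta> \<partial>?\<nu>) - c) \<le> measure_pmf.expectation (\<mu> k) (\<lambda>A. cmod ((\<integral>\<eta>. F A \<eta> \<partial>?\<nu>) - c))"
    unfolding eq by (rule integral_norm_bound)
  also have "\<dots> \<le> measure_pmf.expectation (\<mu> k) (\<lambda>A. \<bar>\<theta>\<bar> + 2 * q * \<bar>crossed A - mean_crossed k\<bar>)"
    using bd by (intro integral_mono_AE AE_pmfI) simp_all
  also have "\<dots> = \<bar>\<theta>\<bar> + 2 * q * measure_pmf.expectation (\<mu> k) (\<lambda>A. \<bar>crossed A - mean_crossed k\<bar>)"
    by (subst Bochner_Integration.integral_add) simp_all
  also have "\<dots> \<le> \<bar>\<theta>\<bar> + 2 * q * sqrt (2 * mean_crossed k)"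
    using q0 by (intro add_left_mono mult_left_mono crossed_abs_deviation) auto
  finally show ?thesis by (simp add: c_def)
qed

end

section \<open>From the grid to continuous time at a fixed time t\<close>

context nn_exclusion
begin

abbreviation J :: "real \<Rightarrow> 'w \<Rightarrow> real" where
  "J t \<omega> \<equiv> current (-1) 0 (\<lambda>s. \<eta> s \<omega>) t"

lemma grid_current_eventually:
  assumes "0 < t" "\<omega> \<in> space M"
  shows "\<forall>\<^sub>F m in sequentially. grid_current (t / real m) m \<omega> = J t \<omega>"
  using current_eq_sum_crossing[OF cadlag_eta[OF assms(2)] assms(1), of "-1" 0]
  by eventually_elim (simp add: grid_current_def)

lemma grid_current_M:
  assumes "0 \<le> h" shows "grid_current h m \<in> borel_measurable M"
  by (rule past_M[OF grid_current_past[OF assms]])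

text \<open>The definition by counting jump times does not exhibit measurability; it is inherited
  from the grid currents, which coincide with \<open>J t\<close> for all fine grids, path by
  path.\<close>

lemma measurable_J: "J t \<in> borel_measurable M"
proof (cases "0 < t")
  case True
  show ?thesis
  proof (rule borel_measurable_LIMSEQ_real)
    fix \<omega> assume "\<omega> \<in> space M"
    then show "(\<lambda>m. grid_current (t / real m) m \<omega>) \<longlonglongrightarrow> J t \<omega>"
      by (intro tendsto_eventually grid_current_eventually True)
  qed (use True in \<open>intro grid_current_M, simp\<close>)
next
  case False
  then have "jump_times x y w \<inter> {..t} = {}" for x y and w :: "real \<Rightarrow> config"
    by (auto simp: jump_times_def)
  then have "J t = (\<lambda>_. 0)"
    by (simp add: current_def fun_eq_iff)
  then show ?thesis by simp
qed

lemma char_grid_current: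
  assumes "0 < t"
  shows "(\<lambda>m. \<integral>\<omega>. cis (\<theta> * grid_current (t / real m) m \<omega>) \<partial>M) \<longlonglongrightarrow> (\<integral>\<omega>. cis (\<theta> * J t \<omega>) \<partial>M)"
proof (rule integral_dominated_convergence[where w="\<lambda>_. 1"])
  have cis: "(\<lambda>\<omega>. cis (\<theta> * f \<omega>)) \<in> borel_measurable M" if "f \<in> borel_measurable M" for f
  proof -
    have "(\<lambda>\<omega>. \<theta> * f \<omega>) \<in> borel_measurable M" using that by simp
    then show ?thesis
      by (rule borel_measurable_continuous_on[of cis, rotated]) (intro continuous_intros)
  qed
  show "(\<lambda>\<omega>. cis (\<theta> * J t \<omega>)) \<in> borel_measurable M"
    by (rule cis[OF measurable_J])
  show "(\<lambda>\<omega>. cis (\<theta> * grid_current (t / real m) m \<omega>)) \<in> borel_measurable M" for m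
    using assms by (intro cis grid_current_M) simp
  show "AE \<omega> in M. (\<lambda>m. cis (\<theta> * grid_current (t / real m) m \<omega>)) \<longlonglongrightarrow> cis (\<theta> * J t \<omega>)"
  proof (rule AE_I2)
    fix \<omega> assume "\<omega> \<in> space M"
    then have "\<forall>\<^sub>F m in sequentially. grid_current (t / real m) m \<omega> = J t \<omega>"
      by (intro grid_current_eventually assms)
    then show "(\<lambda>m. cis (\<theta> * grid_current (t / real m) m \<omega>)) \<longlonglongrightarrow> cis (\<theta> * J t \<omega>)"
      by (intro tendsto_eventually) (auto elim: eventually_mono)
  qed
qed simp_all

text \<open>For fixed \<open>t\<close>, \<open>n\<close> and \<open>\<epsilon>\<close> one
  sufficiently fine grid is enough. All that has to be remembered of the chain is its mean
  \<open>a\<close>, tied to a walk of total time \<open>2 * r * real m = t\<close>. Since no control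
  on \<open>r\<close> and \<open>m\<close> separately is retained, they appear under an existential
  quantifier.\<close>

lemma char_current:
  assumes \<rho>: "0 < \<rho>" "\<rho> \<le> 1" and init: "distr M config_space (\<eta> 0) = bernoulli_config_at_origin \<rho>"
    and t: "0 < t" and n: "1 \<le> n" and \<epsilon>: "0 < \<epsilon>"
    and q_def: "q = 2 * \<rho> * (1 - \<rho>) * (1 - cos \<theta>)" and q: "q \<le> 1 / 2"
  shows "\<exists>a r m. 2 * r * real m = t \<and> simple_walk r \<and>
     \<bar>a - measure_pmf.expectation (walk r m) (\<lambda>z. min (max (real_of_int z) 0) (real n))\<bar> \<le> t\<^sup>2 / (2 * n) \<and> 0 \<le> a \<and>
     cmod ((\<integral>\<omega>. cis (\<theta> * J t \<omega>) \<partial>M) - of_real ((1 - q) powr a)) \<le>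
       \<epsilon> + t * (\<epsilon> + (2 * t + t\<^sup>2) / (real n)\<^sup>2) + \<bar>\<theta>\<bar> + 2 * q * sqrt (2 * a)"
proof -
  \<comment> \<open>This turns the eventual statement in \<open>h\<close> of
    \<open>telescoping\<close> into one along \<open>h = t / real m\<close>, where it is used with
    the same \<open>m\<close> as the number of steps.\<close>
  have lim: "filterlim (\<lambda>m. t / real m) (at_right 0) sequentially"
  proof (rule filterlim_at_withinI)
    show "((\<lambda>m. t / real m) \<longlongrightarrow> 0) sequentially"
      by (rule lim_const_over_n)
    show "\<forall>\<^sub>F m in sequentially. t / real m \<in> {0<..} - {0}"
      using eventually_gt_at_top[of 0] by eventually_elim (use t in simp)
  qed
  have "\<forall>\<^sub>F m in sequentially. cmod ((\<integral>\<omega>. cis (\<theta> * grid_current (t / real m) m \<omega>) \<partial>M) - (\<integral>\<omega>. cis (\<theta> * J t \<omega>) \<partial>M)) < \<epsilon>"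
    using tendstoD[OF char_grid_current[OF t] \<epsilon>] by (simp add: dist_norm)
  moreover have "\<forall>\<^sub>F m in sequentially. m > 0" by (rule eventually_gt_at_top)
  ultimately have "\<forall>\<^sub>F m in sequentially. \<exists>a r m. 2 * r * real m = t \<and> simple_walk r \<and>
     \<bar>a - measure_pmf.expectation (walk r m) (\<lambda>z. min (max (real_of_int z) 0) (real n))\<bar> \<le> t\<^sup>2 / (2 * n) \<and> 0 \<le> a \<and>
     cmod ((\<integral>\<omega>. cis (\<theta> * J t \<omega>) \<partial>M) - of_real ((1 - q) powr a)) \<le>
       \<epsilon> + t * (\<epsilon> + (2 * t + t\<^sup>2) / (real n)\<^sup>2) + \<bar>\<theta>\<bar> + 2 * q * sqrt (2 * a)"
    using filterlim_iff[THEN iffD1, OF lim, rule_format, OF telescoping[OF \<epsilon> n, of \<theta>]]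
  proof eventually_elim
    case (elim m)
    define h where "h = t / real m"
    have tel: "stirring_chain (h / 2) n"
      "cmod ((\<integral>\<omega>. cis (\<theta> * grid_current h m \<omega>) \<partial>M) - (\<integral>\<omega>. stirring_chain.twisted (h / 2) n \<theta> m (\<eta> 0 \<omega>) \<partial>M))
       \<le> (\<Sum>k<m. h * (\<epsilon> + stirring_chain.boundary_error (h / 2) n k))"
      using elim(3)[rule_format, of m] by (simp_all add: h_def)
    interpret S: stirring_chain "h / 2" n by (rule tel(1))
    have hm: "2 * (h / 2) * real m = t" and h0: "0 < h"
      using elim(2) t by (simp_all add: h_def)
    define a where "a = S.mean_crossed m"
    have "(\<integral>\<omega>. S.twisted \<theta> m (\<eta> 0 \<omega>) \<partial>M) = (\<integral>\<zeta>. S.twisted \<theta> m \<zeta> \<partial>bernoulli_config_at_origin \<rho>)"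
      unfolding init[symmetric]
      by (intro integral_distr[symmetric] measurable_eta local_on_measurable[OF finite_sites S.local_on_twisted]) simp
    then have i: "cmod ((\<integral>\<omega>. S.twisted \<theta> m (\<eta> 0 \<omega>) \<partial>M) - of_real ((1 - q) powr a)) \<le> \<bar>\<theta>\<bar> + 2 * q * sqrt (2 * a)"
      unfolding a_def using S.twisted_initial[OF \<rho> q_def q, of m] by simp
    have "(\<Sum>k<m. h * (\<epsilon> + S.boundary_error k)) \<le> (\<Sum>k<m. h * (\<epsilon> + (2 * t + t\<^sup>2) / (real n)\<^sup>2))"
    proof (intro sum_mono mult_left_mono add_left_mono)
      fix k assume "k \<in> {..<m}"
      then show "S.boundary_error k \<le> (2 * t + t\<^sup>2) / (real n)\<^sup>2"
        using S.boundary_dens[of k m] unfolding hm S.boundary_error_def by simp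
    qed (use h0 in simp)
    also have "\<dots> = t * (\<epsilon> + (2 * t + t\<^sup>2) / (real n)\<^sup>2)"
      using elim(2) by (simp add: h_def)
    finally have s: "(\<Sum>k<m. h * (\<epsilon> + S.boundary_error k)) \<le> t * (\<epsilon> + (2 * t + t\<^sup>2) / (real n)\<^sup>2)" .
    define X Y Z :: complex where "X = (\<integral>\<omega>. cis (\<theta> * J t \<omega>) \<partial>M)" and "Y = (\<integral>\<omega>. cis (\<theta> * grid_current h m \<omega>) \<partial>M)"
      and "Z = (\<integral>\<omega>. S.twisted \<theta> m (\<eta> 0 \<omega>) \<partial>M)"
    define c :: complex where "c = of_real ((1 - q) powr a)"
    have "cmod (X - c) \<le> cmod (X - Y) + (cmod (Y - Z) + cmod (Z - c))"
      using norm_triangle_ineq[of "X - Y" "Y - c"] norm_triangle_ineq[of "Y - Z" "Z - c"] by simp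
    moreover have "cmod (X - Y) \<le> \<epsilon>"
      using elim(1) by (simp add: X_def Y_def h_def norm_minus_commute)
    moreover have "cmod (Y - Z) \<le> t * (\<epsilon> + (2 * t + t\<^sup>2) / (real n)\<^sup>2)"
      using tel(2) s unfolding Y_def Z_def by (rule order_trans)
    moreover have "cmod (Z - c) \<le> \<bar>\<theta>\<bar> + 2 * q * sqrt (2 * a)"
      using i unfolding Z_def c_def .
    ultimately have fin: "cmod (X - c) \<le> \<epsilon> + t * (\<epsilon> + (2 * t + t\<^sup>2) / (real n)\<^sup>2) + \<bar>\<theta>\<bar> + 2 * q * sqrt (2 * a)"
      by linarith
    show ?case
    proof (intro exI conjI)
      show "2 * (h / 2) * real m = t" by (rule hm)
      show "simple_walk (h / 2)" by (rule S.free.simple_walk_axioms)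
      show "\<bar>a - measure_pmf.expectation (walk (h / 2) m) (\<lambda>z. min (max (real_of_int z) 0) (real n))\<bar> \<le> t\<^sup>2 / (2 * n)"
        using S.mean_crossed_walk[of m] unfolding hm a_def .
      show "0 \<le> a" unfolding a_def by (rule S.mean_crossed_nonneg)
      show "cmod ((\<integral>\<omega>. cis (\<theta> * J t \<omega>) \<partial>M) - of_real ((1 - q) powr a)) \<le>
        \<epsilon> + t * (\<epsilon> + (2 * t + t\<^sup>2) / (real n)\<^sup>2) + \<bar>\<theta>\<bar> + 2 * q * sqrt (2 * a)"
        using fin unfolding X_def c_def .
    qed
  qed
  from eventually_happens'[OF sequentially_bot this] show ?thesis
    by (simp only: simp_thms)
qed

end

section \<open>Central limit theorem for the walk\<close>

abbreviation clip :: "real \<Rightarrow> real \<Rightarrow> real" where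
  "clip K x \<equiv> min (max x 0) K"

lemma clip_upper: "0 < K \<Longrightarrow> max x 0 \<le> clip K x + x\<^sup>2 / K"
proof -
  assume K: "0 < K"
  show ?thesis
  proof (cases "x \<le> K")
    case True
    then show ?thesis using K by simp
  next
    case False
    then have "x * K \<le> x * x" using K by (intro mult_left_mono) auto
    then have "x \<le> x\<^sup>2 / K" using K by (simp add: power2_eq_square field_simps)
    then show ?thesis using False K by simp
  qed
qed

lemma std_normal_mean_abs:
  "integrable std_normal_distribution (\<lambda>x. max x 0)"
  "(\<integral>x. max x 0 \<partial>std_normal_distribution) = sqrt (2 / pi) / 2"
  "integrable std_normal_distribution (\<lambda>x. x\<^sup>2)"
  "(\<integral>x. x\<^sup>2 \<partial>std_normal_distribution) = 1"
proof -
  have 1: "integrable std_normal_distribution (\<lambda>x. \<bar>x\<bar>)"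
    using integrable_std_normal_distribution_moment[of 1] by simp
  have 2: "integrable std_normal_distribution (\<lambda>x. x)"
    using integrable_std_normal_distribution_moment[of 1] by simp
  have eq: "max x 0 = (\<bar>x\<bar> + x) / 2" for x :: real by auto
  show "integrable std_normal_distribution (\<lambda>x. max x 0)"
    unfolding eq using 1 2 by simp
  have "(\<integral>x. \<bar>x\<bar> \<partial>std_normal_distribution) = sqrt (2 / pi)"
    using std_normal_distribution_odd_moments_abs[of 0] by simp
  moreover have "(\<integral>x. x \<partial>std_normal_distribution) = 0"
    using integral_std_normal_distribution_moment_odd[of 1] by simp
  ultimately show "(\<integral>x. max x 0 \<partial>std_normal_distribution) = sqrt (2 / pi) / 2"
    unfolding eq using 1 2 by simp
  show "integrable std_normal_distribution (\<lambda>x. x\<^sup>2)"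
    using std_normal_distribution_even_moments(2)[of 1] by simp
  show "(\<integral>x. x\<^sup>2 \<partial>std_normal_distribution) = 1"
    using std_normal_distribution_even_moments(1)[of 1] by simp
qed

text \<open>The second moment bounds the part removed by clipping, uniformly in the law: this
  supplies the uniform integrability that weak convergence alone does not give.\<close>

lemma clip_integral_gap:
  assumes "prob_space N" "sets N = sets borel" "0 < K" "K \<le> K'"
    and "integrable N (\<lambda>x. x\<^sup>2)" "(\<integral>x. x\<^sup>2 \<partial>N) \<le> 1"
  shows "\<bar>(\<integral>x. clip K' x \<partial>N) - (\<integral>x. clip K x \<partial>N)\<bar> \<le> 1 / K"
proof -
  interpret prob_space N by fact
  have meas: "(\<lambda>x. clip L x) \<in> borel_measurable N" for L
    unfolding measurable_cong_sets[OF assms(2) refl] by measurable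
  have int: "integrable N (clip L)" if "0 < L" for L
    using that by (intro integrable_const_bound[where B=L] meas) auto
  have i: "integrable N (clip K)" "integrable N (clip K')" using int assms by auto
  have "(\<integral>x. clip K x \<partial>N) \<le> (\<integral>x. clip K' x \<partial>N)"
    using assms(3,4) i by (intro Bochner_Integration.integral_mono) auto
  moreover have "(\<integral>x. clip K' x \<partial>N) \<le> (\<integral>x. clip K x + x\<^sup>2 / K \<partial>N)"
    using i assms(5) clip_upper[OF assms(3)]
    by (intro Bochner_Integration.integral_mono) (auto intro: order_trans[OF min.cobounded1])
  moreover have "(\<integral>x. clip K x + x\<^sup>2 / K \<partial>N) = (\<integral>x. clip K x \<partial>N) + (\<integral>x. x\<^sup>2 \<partial>N) / K"
    using i assms(5) by simp
  moreover have "(\<integral>x. x\<^sup>2 \<partial>N) / K \<le> 1 / K"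
    using assms by (intro divide_right_mono) auto
  ultimately show ?thesis by linarith
qed

lemma std_normal_clip_gap:
  assumes "0 < K"
  shows "\<bar>sqrt (2 / pi) / 2 - (\<integral>x. clip K x \<partial>std_normal_distribution)\<bar> \<le> 1 / K"
proof -
  interpret real_distribution std_normal_distribution by (rule real_dist_normal_dist)
  have i: "integrable std_normal_distribution (clip K)"
    using assms by (intro integrable_const_bound[where B=K]) auto
  note s = std_normal_mean_abs
  have "(\<integral>x. clip K x \<partial>std_normal_distribution) \<le> (\<integral>x. max x 0 \<partial>std_normal_distribution)"
    using i s(1) by (intro Bochner_Integration.integral_mono) auto
  moreover have "(\<integral>x. max x 0 \<partial>std_normal_distribution) \<le> (\<integral>x. clip K x + x\<^sup>2 / K \<partial>std_normal_distribution)"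
    using i s clip_upper[OF assms] by (intro Bochner_Integration.integral_mono) auto
  moreover have "(\<integral>x. clip K x + x\<^sup>2 / K \<partial>std_normal_distribution) = (\<integral>x. clip K x \<partial>std_normal_distribution) + 1 / K"
    using i s(3,4) by simp
  ultimately show ?thesis unfolding s(2) by linarith
qed

lemma exp_minus_approx: "0 \<le> p \<Longrightarrow> \<bar>exp (- p) - (1 - p)\<bar> \<le> p\<^sup>2" for p :: real
proof -
  assume p: "0 \<le> p"
  have "1 - p \<le> exp (- p)" using exp_ge_add_one_self[of "- p"] by simp
  moreover have "exp (- p) \<le> 1 - p + p\<^sup>2"
  proof -
    have "exp (- p) \<le> 1 / (1 + p)"
      using p exp_ge_add_one_self[of p] by (simp add: exp_minus field_simps)
    also have "\<dots> \<le> 1 - p + p\<^sup>2"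
    proof -
      have "1 \<le> (1 - p + p\<^sup>2) * (1 + p)"
        using p by (simp add: power2_eq_square algebra_simps)
      then show ?thesis using p by (simp add: field_simps)
    qed
    finally show ?thesis .
  qed
  ultimately show ?thesis by linarith
qed

lemma one_minus_cos_le: "1 - cos (x::real) \<le> x\<^sup>2 / 2"
proof -
  have "1 - cos x = 2 * (sin (x / 2))\<^sup>2"
    using cos_double_sin[of "x / 2"] by simp
  also have "\<dots> \<le> 2 * (x / 2)\<^sup>2"
    by (intro mult_left_mono abs_le_square_iff[THEN iffD1] abs_sin_x_le_abs_x) simp
  finally show ?thesis by (simp add: power2_eq_square)
qed

lemma one_minus_cos_limit: "((\<lambda>x::real. (1 - cos x) / x\<^sup>2) \<longlongrightarrow> 1 / 2) (at 0)"
proof -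
  have "((\<lambda>x::real. sin x / x) \<longlongrightarrow> 1) (at 0)"
    using DERIV_sin[of 0] by (simp add: has_field_derivative_iff)
  then have "((\<lambda>x::real. sin (x / 2) / (x / 2)) \<longlongrightarrow> 1) (at 0)"
    by (rule filterlim_compose) (auto simp: filterlim_at eventually_at_filter intro!: tendsto_eq_intros)
  then have "((\<lambda>x::real. (sin (x / 2) / (x / 2))\<^sup>2 / 2) \<longlongrightarrow> 1\<^sup>2 / 2) (at 0)"
    by (intro tendsto_intros) auto
  moreover have "(\<lambda>x::real. (sin (x / 2) / (x / 2))\<^sup>2 / 2) = (\<lambda>x. (1 - cos x) / x\<^sup>2)"
  proof
    fix x :: real
    show "(sin (x / 2) / (x / 2))\<^sup>2 / 2 = (1 - cos x) / x\<^sup>2"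
      using cos_double_sin[of "x / 2"] by (simp add: power_divide)
  qed
  ultimately show ?thesis by (simp only: power_one)
qed

lemma scaled_one_minus_cos:
  fixes s :: "nat \<Rightarrow> real"
  assumes "filterlim s at_top sequentially"
  shows "(\<lambda>j. (s j)\<^sup>2 * (1 - cos (u / s j))) \<longlonglongrightarrow> u\<^sup>2 / 2"
proof (cases "u = 0")
  case False
  have "(\<lambda>j. u / s j) \<longlonglongrightarrow> 0"
    by (rule real_tendsto_divide_at_top[OF tendsto_const assms])
  moreover have pos: "\<forall>\<^sub>F j in sequentially. 0 < s j"
    using assms by (simp add: filterlim_at_top_dense)
  ultimately have "filterlim (\<lambda>j. u / s j) (at 0) sequentially"
    using False by (auto simp: filterlim_at elim: eventually_mono)
  from filterlim_compose[OF one_minus_cos_limit this]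
  have "(\<lambda>j. u\<^sup>2 * ((1 - cos (u / s j)) / (u / s j)\<^sup>2)) \<longlonglongrightarrow> u\<^sup>2 * (1 / 2)"
    by (rule tendsto_mult_left)
  then have "(\<lambda>j. u\<^sup>2 * ((1 - cos (u / s j)) / (u / s j)\<^sup>2)) \<longlonglongrightarrow> u\<^sup>2 / 2" by simp
  then show ?thesis
  proof (rule Lim_transform_eventually)
    show "\<forall>\<^sub>F j in sequentially. u\<^sup>2 * ((1 - cos (u / s j)) / (u / s j)\<^sup>2) = (s j)\<^sup>2 * (1 - cos (u / s j))"
      using pos by eventually_elim (use False in \<open>simp add: power_divide\<close>)
  qed
qed simp

text \<open>The bases 1 - p and exp (- p) both have modulus at most 1, so their \<open>m\<close>-th
  powers differ by at most m p^2, with p at most r u^2 / t. The resulting bound depends only on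
  \<open>t\<close>, in whatever way \<open>r\<close> and \<open>m\<close> share it.\<close>

lemma walk_char_bound:
  assumes "simple_walk r" "2 * r * real m = t" "0 < t"
  shows "\<bar>(1 - 2 * r * (1 - cos (u / sqrt t))) ^ m - exp (- (t * (1 - cos (u / sqrt t))))\<bar> \<le> u ^ 4 / (4 * t)"
proof -
  interpret simple_walk r by fact
  define p where "p = 2 * r * (1 - cos (u / sqrt t))"
  have p0: "0 \<le> p" using r_pos by (simp add: p_def)
  have p2: "p \<le> 2" unfolding p_def using r_pos r_half cos_ge_minus_one[of "u / sqrt t"]
    mult_mono[of "2 * r" 1 "1 - cos (u / sqrt t)" 2] by simp
  have pu: "p \<le> 2 * r * (u\<^sup>2 / (2 * t))"
    unfolding p_def using r_pos one_minus_cos_le[of "u / sqrt t"] assms(3)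
    by (intro mult_left_mono) (simp_all add: power_divide)
  have mp: "real m * p = t * (1 - cos (u / sqrt t))"
    using assms(2) by (simp add: p_def algebra_simps)
  have "\<bar>(1 - p) ^ m - exp (- p) ^ m\<bar> \<le> real m * \<bar>(1 - p) - exp (- p)\<bar>"
    using norm_power_diff[of "1 - p" "exp (- p)" m] p0 p2 by simp
  also have "\<dots> \<le> real m * p\<^sup>2"
    using exp_minus_approx[OF p0] by (intro mult_left_mono) (simp_all add: abs_minus_commute)
  also have "\<dots> \<le> real m * (2 * r * (u\<^sup>2 / (2 * t)))\<^sup>2"
    using pu p0 by (intro mult_left_mono power_mono) auto
  also have "\<dots> = 2 * r * ((2 * r * real m) * u ^ 4 / (4 * t\<^sup>2))"
    by (simp add: power2_eq_square power4_eq_xxxx)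
  also have "\<dots> \<le> 1 * ((2 * r * real m) * u ^ 4 / (4 * t\<^sup>2))"
    using r_half r_pos by (intro mult_right_mono) auto
  also have "\<dots> = u ^ 4 / (4 * t)"
    unfolding assms(2) using assms(3) by (simp add: power2_eq_square)
  finally show ?thesis
    unfolding p_def[symmetric] by (simp add: exp_of_nat_mult[symmetric] mp)
qed

section \<open>Weak limit of the rescaled walk and of its mean positive part\<close>

definition scaled_walk :: "real \<Rightarrow> nat \<Rightarrow> real \<Rightarrow> real measure" where
  "scaled_walk r m t = distr (measure_pmf (walk r m)) borel (\<lambda>z. real_of_int z / sqrt t)"

lemma real_distribution_scaled_walk: "real_distribution (scaled_walk r m t)"
  unfolding scaled_walk_def by (rule prob_space.real_distribution_distr[OF measure_pmf.prob_space_axioms]) simp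

lemma integral_scaled_walk:
  fixes f :: "real \<Rightarrow> 'a::{banach, second_countable_topology}"
  assumes "f \<in> borel_measurable borel"
  shows "(\<integral>x. f x \<partial>scaled_walk r m t) = measure_pmf.expectation (walk r m) (\<lambda>z. f (real_of_int z / sqrt t))"
  unfolding scaled_walk_def using assms by (intro integral_distr) simp_all

lemma scaled_walk_weak_conv:
  assumes w: "\<And>j. simple_walk (r j)" "\<And>j. 2 * r j * real (m j) = t j" "\<And>j. 0 < t j"
    and t: "filterlim t at_top sequentially"
  shows "weak_conv_m (\<lambda>j. scaled_walk (r j) (m j) (t j)) std_normal_distribution"
proof (rule levy_continuity[OF real_distribution_scaled_walk real_dist_normal_dist])
  fix u
  have sq: "filterlim (\<lambda>j. sqrt (t j)) at_top sequentially"
    by (rule filterlim_compose[OF sqrt_at_top t])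
  have ch: "char (scaled_walk (r j) (m j) (t j)) u = of_real ((1 - 2 * r j * (1 - cos (u / sqrt (t j)))) ^ m j)" for j
  proof -
    interpret simple_walk "r j" by (rule w)
    have "(\<lambda>x. iexp (u * x)) \<in> borel_measurable borel"
      by measurable
    then have "char (scaled_walk (r j) (m j) (t j)) u = measure_pmf.expectation (walk (r j) (m j)) (\<lambda>z. iexp (u * (real_of_int z / sqrt (t j))))"
      unfolding char_def by (rule integral_scaled_walk)
    also have "\<dots> = measure_pmf.expectation (walk (r j) (m j)) (\<lambda>z. cis (u / sqrt (t j) * real_of_int z))"
      by (simp add: cis_conv_exp)
    finally show ?thesis unfolding walk_char .
  qed
  have "(\<lambda>j. exp (- ((sqrt (t j))\<^sup>2 * (1 - cos (u / sqrt (t j)))))) \<longlonglongrightarrow> exp (- (u\<^sup>2 / 2))"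
    by (intro tendsto_intros scaled_one_minus_cos sq)
  moreover have "(sqrt (t j))\<^sup>2 = t j" for j using w(3)[of j] by simp
  ultimately have 1: "(\<lambda>j. exp (- (t j * (1 - cos (u / sqrt (t j)))))) \<longlonglongrightarrow> exp (- (u\<^sup>2 / 2))" by simp
  have 2: "(\<lambda>j. (1 - 2 * r j * (1 - cos (u / sqrt (t j)))) ^ m j - exp (- (t j * (1 - cos (u / sqrt (t j)))))) \<longlonglongrightarrow> 0"
  proof (rule Lim_null_comparison)
    show "\<forall>\<^sub>F j in sequentially. norm ((1 - 2 * r j * (1 - cos (u / sqrt (t j)))) ^ m j - exp (- (t j * (1 - cos (u / sqrt (t j))))))
        \<le> u ^ 4 / 4 / t j"
      using walk_char_bound[OF w(1,2,3)] by (intro always_eventually allI) simp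
    show "(\<lambda>j. u ^ 4 / 4 / t j) \<longlonglongrightarrow> 0"
      by (rule real_tendsto_divide_at_top[OF tendsto_const t])
  qed
  from tendsto_add[OF 2 1]
  have "(\<lambda>j. (1 - 2 * r j * (1 - cos (u / sqrt (t j)))) ^ m j) \<longlonglongrightarrow> exp (- (u\<^sup>2) / 2)" by simp
  then show "(\<lambda>j. char (scaled_walk (r j) (m j) (t j)) u) \<longlonglongrightarrow> char std_normal_distribution u"
    unfolding ch char_std_normal_distribution by (rule tendsto_of_real)
qed

text \<open>The clipping level grows with \<open>j\<close>, so weak convergence is applied at a
  fixed level \<open>K\<close>; raising \<open>K\<close> to the growing level for the walk, and to
  infinity for the normal law, costs at most \<open>1 / K\<close> each.\<close>

lemma walk_mean_limit:
  assumes w: "\<And>j. simple_walk (r j)" "\<And>j. 2 * r j * real (m j) = t j" "\<And>j. 0 < t j"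
    and t: "filterlim t at_top sequentially"
    and n: "filterlim (\<lambda>j. real (n j) / sqrt (t j)) at_top sequentially"
  shows "(\<lambda>j. measure_pmf.expectation (walk (r j) (m j)) (\<lambda>z. clip (real (n j)) (real_of_int z)) / sqrt (t j))
    \<longlonglongrightarrow> sqrt (2 / pi) / 2"
proof (rule LIMSEQ_I)
  fix e :: real assume e: "0 < e"
  \<comment> \<open>Three errors of at most \<open>e / 4\<close> arise: two clipping gaps
    \<open>1 / K\<close> and the weak convergence at level \<open>K\<close>.\<close>
  define K where "K = 4 / e"
  have K: "0 < K" "1 / K = e / 4" using e by (simp_all add: K_def)
  let ?N = "\<lambda>j. scaled_walk (r j) (m j) (t j)"
  have b: "measure_pmf.expectation (walk (r j) (m j)) (\<lambda>z. clip (real (n j)) (real_of_int z)) / sqrt (t j) =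
      (\<integral>x. clip (real (n j) / sqrt (t j)) x \<partial>?N j)" for j
  proof -
    have "clip (real (n j)) (real_of_int z) / sqrt (t j) = clip (real (n j) / sqrt (t j)) (real_of_int z / sqrt (t j))" for z
      using w(3)[of j] by (simp add: min_def max_def divide_le_cancel zero_le_divide_iff divide_le_0_iff)
    then show ?thesis
      by (subst integral_scaled_walk) (simp_all flip: integral_divide_zero)
  qed
  have wc: "(\<lambda>j. \<integral>x. clip K x \<partial>?N j) \<longlonglongrightarrow> (\<integral>x. clip K x \<partial>std_normal_distribution)"
    using K by (intro weak_conv_imp_integral_bdd_continuous_conv[where B=K]
      real_distribution_scaled_walk real_dist_normal_dist scaled_walk_weak_conv w t)
      (auto intro!: continuous_intros)
  have gap: "\<bar>(\<integral>x. clip L x \<partial>?N j) - (\<integral>x. clip K x \<partial>?N j)\<bar> \<le> 1 / K" if "K \<le> L" for j L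
  proof (rule clip_integral_gap[OF _ _ K(1) that])
    interpret simple_walk "r j" by (rule w)
    interpret real_distribution "?N j" by (rule real_distribution_scaled_walk)
    show "prob_space (?N j)" by unfold_locales
    show "sets (?N j) = sets borel" by simp
    show "integrable (?N j) (\<lambda>x. x\<^sup>2)"
      unfolding scaled_walk_def by (subst integrable_distr_eq) simp_all
    have "(\<integral>x. x\<^sup>2 \<partial>?N j) = measure_pmf.expectation (walk (r j) (m j)) (\<lambda>z. (real_of_int z)\<^sup>2) / t j"
      using w(3)[of j] by (subst integral_scaled_walk) (simp_all add: power_divide)
    also have "\<dots> = 1"
      unfolding walk_second_moment w(2) using w(3)[of j] by simp
    finally show "(\<integral>x. x\<^sup>2 \<partial>?N j) \<le> 1" by simp
  qed
  have "\<forall>\<^sub>F j in sequentially. K \<le> real (n j) / sqrt (t j)"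
    using n by (simp add: filterlim_at_top)
  moreover have "\<forall>\<^sub>F j in sequentially. \<bar>(\<integral>x. clip K x \<partial>?N j) - (\<integral>x. clip K x \<partial>std_normal_distribution)\<bar> < e / 4"
    using tendstoD[OF wc, of "e / 4"] e by (simp add: dist_real_def)
  ultimately have "\<forall>\<^sub>F j in sequentially. norm ((\<integral>x. clip (real (n j) / sqrt (t j)) x \<partial>?N j) - sqrt (2 / pi) / 2) < e"
  proof eventually_elim
    case (elim j)
    show ?case
      using gap[OF elim(1), of j] elim(2) std_normal_clip_gap[OF K(1)] e unfolding K(2) real_norm_def by linarith
  qed
  then show "\<exists>no. \<forall>j\<ge>no. norm (measure_pmf.expectation (walk (r j) (m j)) (\<lambda>z. clip (real (n j)) (real_of_int z)) / sqrt (t j)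
      - sqrt (2 / pi) / 2) < e"
    unfolding b by (simp add: eventually_sequentially)
qed

section \<open>Convergence in distribution\<close>

lemma normal_law_distr:
  assumes "0 < v"
  shows "normal_law 0 v = distr std_normal_distribution borel (\<lambda>x. sqrt v * x)"
proof -
  interpret real_distribution std_normal_distribution by (rule real_dist_normal_dist)
  have "distributed std_normal_distribution lborel (\<lambda>x. x) std_normal_density"
    by (auto simp: distributed_def distr_id2)
  from normal_density_affine[OF this, of "sqrt v" 0]
  have "distributed std_normal_distribution lborel (\<lambda>x. sqrt v * x) (normal_density 0 (sqrt v))"
    using assms by simp
  then have "distr std_normal_distribution lborel (\<lambda>x. sqrt v * x) = normal_law 0 v"
    by (simp add: distributed_def normal_law_def)
  moreover have "distr std_normal_distribution lborel (\<lambda>x. sqrt v * x) = distr std_normal_distribution borel (\<lambda>x. sqrt v * x)"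
    by (rule distr_cong) simp_all
  ultimately show ?thesis by simp
qed

lemma real_distribution_normal_law:
  assumes "0 < v" shows "real_distribution (normal_law 0 v)"
proof -
  interpret real_distribution std_normal_distribution by (rule real_dist_normal_dist)
  show ?thesis unfolding normal_law_distr[OF assms] by (rule real_distribution_distr) simp
qed

lemma char_normal_law:
  assumes "0 < v"
  shows "char (normal_law 0 v) u = of_real (exp (- (v * u\<^sup>2 / 2)))"
proof -
  have "char (normal_law 0 v) u = (\<integral>x. iexp (u * (sqrt v * x)) \<partial>std_normal_distribution)"
    unfolding normal_law_distr[OF assms] char_def by (subst integral_distr) simp_all
  also have "\<dots> = char std_normal_distribution (u * sqrt v)"
    by (simp add: char_def mult.assoc)
  also have "\<dots> = of_real (exp (- (v * u\<^sup>2 / 2)))"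
    using assms by (simp add: char_std_normal_distribution power_mult_distrib mult.commute)
  finally show ?thesis .
qed

text \<open>ln (1 - q) equals - q up to 2 q^2. The product a q = (a / s) (s q) converges to A Q, and
  a q^2 = (a q) q vanishes because q = (s q) / s does.\<close>

lemma powr_one_minus_limit:
  fixes a q s :: "nat \<Rightarrow> real"
  assumes a: "(\<lambda>j. a j / s j) \<longlonglongrightarrow> A" and q: "(\<lambda>j. s j * q j) \<longlonglongrightarrow> Q"
    and s: "filterlim s at_top sequentially"
    and bounds: "\<forall>\<^sub>F j in sequentially. 0 \<le> q j \<and> q j \<le> 1 / 2"
  shows "(\<lambda>j. (1 - q j) powr a j) \<longlonglongrightarrow> exp (- (A * Q))"
proof -
  have pos: "\<forall>\<^sub>F j in sequentially. 0 < s j"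
    using s by (simp add: filterlim_at_top_dense)
  have aq: "(\<lambda>j. a j / s j * (s j * q j)) \<longlonglongrightarrow> A * Q"
    by (intro tendsto_mult a q)
  have q0: "(\<lambda>j. s j * q j / s j) \<longlonglongrightarrow> 0"
    using q s by (rule real_tendsto_divide_at_top)
  have "(\<lambda>j. \<bar>a j / s j * (s j * q j)\<bar> * (2 * (s j * q j / s j))) \<longlonglongrightarrow> \<bar>A * Q\<bar> * (2 * 0)"
    by (intro tendsto_intros aq q0)
  then have small: "(\<lambda>j. \<bar>a j / s j * (s j * q j)\<bar> * (2 * (s j * q j / s j))) \<longlonglongrightarrow> 0" by simp
  have "(\<lambda>j. a j * ln (1 - q j) + a j / s j * (s j * q j)) \<longlonglongrightarrow> 0"
  proof (rule Lim_null_comparison[OF _ small])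
    show "\<forall>\<^sub>F j in sequentially. norm (a j * ln (1 - q j) + a j / s j * (s j * q j))
        \<le> \<bar>a j / s j * (s j * q j)\<bar> * (2 * (s j * q j / s j))"
      using pos bounds
    proof eventually_elim
      case (elim j)
      have "\<bar>ln (1 - q j) + q j\<bar> \<le> 2 * (q j)\<^sup>2"
        using abs_ln_one_plus_x_minus_x_bound_nonpos[of "- q j"] elim by simp
      then have "\<bar>a j\<bar> * \<bar>ln (1 - q j) + q j\<bar> \<le> \<bar>a j\<bar> * (2 * (q j)\<^sup>2)"
        by (intro mult_left_mono) auto
      then show ?case
        using elim by (simp add: abs_mult[symmetric] distrib_left power2_eq_square abs_mult)
    qed
  qed
  from tendsto_diff[OF this aq]
  have "(\<lambda>j. a j * ln (1 - q j)) \<longlonglongrightarrow> - (A * Q)" by simp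
  then have "(\<lambda>j. exp (a j * ln (1 - q j))) \<longlonglongrightarrow> exp (- (A * Q))" by (rule tendsto_exp)
  then show ?thesis
  proof (rule Lim_transform_eventually)
    show "\<forall>\<^sub>F j in sequentially. exp (a j * ln (1 - q j)) = (1 - q j) powr a j"
      using bounds by eventually_elim (simp add: powr_def)
  qed
qed

section \<open>The characteristic function of the current at scale t^(1/4)\<close>

context nn_exclusion
begin

text \<open>For \<theta> = u / t^(1/4), \<open>sqrt t * q\<close> tends to \<rho> (1 - \<rho>) u^2
  and \<open>a / sqrt t\<close> to the mean positive part of a standard normal variable; the limit
  of (1 - q)^a follows. The errors |\<theta>| and q sqrt (2 a) are at most of order
  t^(-1/4).\<close>

lemma char_current_limit:
  assumes \<rho>: "0 < \<rho>" "\<rho> \<le> 1" and init: "distr M config_space (\<eta> 0) = bernoulli_config_at_origin \<rho>"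
    and T: "filterlim T at_top sequentially"
  shows "(\<lambda>j. \<integral>\<omega>. cis (u / T j powr (1 / 4) * J (T j) \<omega>) \<partial>M) \<longlonglongrightarrow>
    of_real (exp (- (sqrt (2 / pi) / 2 * (\<rho> * (1 - \<rho>) * u\<^sup>2))))"
proof -
  \<comment> \<open>Truncation at 1 makes the estimates valid for every index and alters only
    finitely many times.\<close>
  define t where "t j = max 1 (T j)" for j
  have t1: "1 \<le> t j" for j by (simp add: t_def)
  have t0: "0 < t j" for j using t1[of j] by linarith
  have tT: "\<forall>\<^sub>F j in sequentially. t j = T j"
  proof -
    have "\<forall>\<^sub>F j in sequentially. 1 \<le> T j" using T by (simp add: filterlim_at_top)
    then show ?thesis by eventually_elim (simp add: t_def)
  qed
  have t: "filterlim t at_top sequentially"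
    by (rule filterlim_at_top_mono[OF T]) (simp add: t_def)
  define s where "s j = t j powr (1 / 4)" for j
  have s0: "0 < s j" for j using t0[of j] by (simp add: s_def)
  have s2: "(s j)\<^sup>2 = sqrt (t j)" for j
    using t0[of j] by (simp add: s_def powr_power powr_half_sqrt)
  have sqt: "filterlim (\<lambda>j. sqrt (t j)) at_top sequentially"
    by (rule filterlim_compose[OF sqrt_at_top t])
  have s: "filterlim s at_top sequentially"
  proof -
    have "s j = sqrt (sqrt (t j))" for j
      using s0[of j] by (simp add: s2[symmetric])
    then have "s = (\<lambda>j. sqrt (sqrt (t j)))" by (rule ext)
    then show ?thesis using filterlim_compose[OF sqrt_at_top sqt] by simp
  qed
  define \<theta> where "\<theta> j = u / s j" for j
  define q where "q j = 2 * \<rho> * (1 - \<rho>) * (1 - cos (\<theta> j))" for j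
  \<comment> \<open>A box of size t^3 makes the accumulated boundary error, at most 3 t^3 / n^2, and
    the error t^2 / (2 n) of the mean vanish, and it dwarfs sqrt t. The accuracy 1 / t^2 below is
    chosen so that t steps of unit time still cost o(1).\<close>
  define n where "n j = nat \<lceil>t j ^ 3\<rceil>" for j
  define \<epsilon> where "\<epsilon> j = 1 / (t j)\<^sup>2" for j
  have n_ge: "t j ^ 3 \<le> real (n j)" for j unfolding n_def by linarith
  have t3: "1 \<le> t j ^ 3" for j using t1[of j] by simp
  have n1: "1 \<le> n j" for j using n_ge[of j] t3[of j] by linarith
  have q0: "0 \<le> q j" for j unfolding q_def using \<rho> by simp
  have sq: "(\<lambda>j. sqrt (t j) * q j) \<longlonglongrightarrow> \<rho> * (1 - \<rho>) * u\<^sup>2"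
  proof -
    have "(\<lambda>j. 2 * \<rho> * (1 - \<rho>) * ((s j)\<^sup>2 * (1 - cos (u / s j)))) \<longlonglongrightarrow> 2 * \<rho> * (1 - \<rho>) * (u\<^sup>2 / 2)"
      by (intro tendsto_mult tendsto_const scaled_one_minus_cos s)
    then show ?thesis by (simp add: q_def \<theta>_def s2 algebra_simps)
  qed
  have "(\<lambda>j. sqrt (t j) * q j / sqrt (t j)) \<longlonglongrightarrow> 0"
    using sq sqt by (rule real_tendsto_divide_at_top)
  moreover have "sqrt (t j) * q j / sqrt (t j) = q j" for j using t0[of j] by simp
  ultimately have "q \<longlonglongrightarrow> 0" by simp
  then have qev: "\<forall>\<^sub>F j in sequentially. q j \<le> 1 / 2"
    using order_tendstoD(2)[of q 0 sequentially "1 / 2"] by (auto elim: eventually_mono)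
  define err where "err j a = \<epsilon> j + t j * (\<epsilon> j + (2 * t j + (t j)\<^sup>2) / (real (n j))\<^sup>2) + \<bar>\<theta> j\<bar> + 2 * q j * sqrt (2 * a)" for j a
  \<comment> \<open>The last clause is conditional because \<open>q j\<close> may exceed 1/2 for
    finitely many \<open>j\<close>. At those indices any walk of total time \<open>t j\<close> with
    its own mean serves, so that sequences defined for all \<open>j\<close> can be chosen, as
    \<open>walk_mean_limit\<close> requires.\<close>
  have "\<exists>a r m. 2 * r * real m = t j \<and> simple_walk r \<and>
     (\<bar>a - measure_pmf.expectation (walk r m) (\<lambda>z. clip (real (n j)) (real_of_int z))\<bar> \<le> (t j)\<^sup>2 / (2 * n j)) \<and> 0 \<le> a \<and>
     (q j \<le> 1 / 2 \<longrightarrow> cmod ((\<integral>\<omega>. cis (\<theta> j * J (t j) \<omega>) \<partial>M) - of_real ((1 - q j) powr a)) \<le> err j a)" for j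
  proof (cases "q j \<le> 1 / 2")
    case True
    have "0 < \<epsilon> j" using t0[of j] by (simp add: \<epsilon>_def)
    from char_current[OF \<rho> init t0 n1 this q_def True] show ?thesis
      unfolding err_def by blast
  next
    case False
    obtain m :: nat where m: "t j < real m" using reals_Archimedean2 by blast
    define r where "r = t j / (2 * real m)"
    have r: "2 * r * real m = t j" "simple_walk r"
      using m t0[of j] by (simp_all add: r_def simple_walk_def field_simps)
    define a where "a = measure_pmf.expectation (walk r m) (\<lambda>z. clip (real (n j)) (real_of_int z))"
    have "0 \<le> a" unfolding a_def by (rule Bochner_Integration.integral_nonneg) simp
    then show ?thesis using False r by (intro exI[of _ a] exI[of _ r] exI[of _ m]) (simp add: a_def)
  qed
  then obtain a r m where w: "\<And>j. simple_walk (r j)" "\<And>j. 2 * r j * real (m j) = t j"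
    and am: "\<And>j. \<bar>a j - measure_pmf.expectation (walk (r j) (m j)) (\<lambda>z. clip (real (n j)) (real_of_int z))\<bar> \<le> (t j)\<^sup>2 / (2 * n j)"
    and a0: "\<And>j. 0 \<le> a j"
    and main: "\<And>j. q j \<le> 1 / 2 \<Longrightarrow> cmod ((\<integral>\<omega>. cis (\<theta> j * J (t j) \<omega>) \<partial>M) - of_real ((1 - q j) powr a j)) \<le> err j (a j)"
    by metis
  have inv_t: "(\<lambda>j. 1 / t j) \<longlonglongrightarrow> 0"
    by (rule real_tendsto_divide_at_top[OF tendsto_const t])
  have inv_t2: "(\<lambda>j. 1 / (t j)\<^sup>2) \<longlonglongrightarrow> 0"
    using tendsto_power[OF inv_t, of 2] by (simp add: power_divide)
  have alim: "(\<lambda>j. a j / sqrt (t j)) \<longlonglongrightarrow> sqrt (2 / pi) / 2"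
  proof -
    define b where "b j = measure_pmf.expectation (walk (r j) (m j)) (\<lambda>z. clip (real (n j)) (real_of_int z))" for j
    have nt: "filterlim (\<lambda>j. real (n j) / sqrt (t j)) at_top sequentially"
    proof (rule filterlim_at_top_mono[OF t], rule always_eventually, rule allI)
      fix j
      have "sqrt (t j) \<le> t j" using t1[of j] real_sqrt_le_mono[of "t j" "(t j)\<^sup>2"] by (simp add: power2_eq_square)
      then have "t j * sqrt (t j) \<le> t j * t j" using t0[of j] by (intro mult_left_mono) auto
      also have "\<dots> \<le> t j ^ 3" using t1[of j] mult_right_mono[of 1 "t j" "t j * t j"] by (simp add: power3_eq_cube)
      also have "\<dots> \<le> real (n j)" by (rule n_ge)
      finally show "t j \<le> real (n j) / sqrt (t j)" using t0[of j] by (simp add: field_simps)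
    qed
    have blim: "(\<lambda>j. b j / sqrt (t j)) \<longlonglongrightarrow> sqrt (2 / pi) / 2"
      unfolding b_def by (rule walk_mean_limit[OF w(1,2) t0 t nt])
    have "(\<lambda>j. a j / sqrt (t j) - b j / sqrt (t j)) \<longlonglongrightarrow> 0"
    proof (rule Lim_null_comparison[OF always_eventually inv_t], rule allI)
      fix j
      have "\<bar>a j - b j\<bar> \<le> (t j)\<^sup>2 / (2 * n j)" using am[of j] by (simp add: b_def)
      also have "\<dots> \<le> (t j)\<^sup>2 / (1 * t j ^ 3)"
        using n_ge[of j] t0[of j] n1[of j] by (intro divide_left_mono mult_pos_pos) auto
      also have "\<dots> = 1 / t j" using t0[of j] by (simp add: power2_eq_square power3_eq_cube)
      finally have ab: "\<bar>a j - b j\<bar> \<le> 1 / t j" .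
      have "\<bar>a j - b j\<bar> / sqrt (t j) \<le> \<bar>a j - b j\<bar>"
        using t1[of j] divide_left_mono[of 1 "sqrt (t j)" "\<bar>a j - b j\<bar>"] by simp
      from this ab have "\<bar>a j - b j\<bar> / sqrt (t j) \<le> 1 / t j" by (rule order_trans)
      then show "norm (a j / sqrt (t j) - b j / sqrt (t j)) \<le> 1 / t j"
        using t0[of j] by (simp add: diff_divide_distrib[symmetric])
    qed
    from tendsto_add[OF this blim] show ?thesis by simp
  qed
  have powr: "(\<lambda>j. (1 - q j) powr a j) \<longlonglongrightarrow> exp (- (sqrt (2 / pi) / 2 * (\<rho> * (1 - \<rho>) * u\<^sup>2)))"
    using q0 qev by (intro powr_one_minus_limit[OF alim sq sqt]) (auto elim: eventually_mono)
  have err: "(\<lambda>j. err j (a j)) \<longlonglongrightarrow> 0"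
  proof -
    have th: "\<theta> \<longlonglongrightarrow> 0"
      unfolding \<theta>_def[abs_def] by (rule real_tendsto_divide_at_top[OF tendsto_const s])
    have t_eps: "(\<lambda>j. t j * \<epsilon> j) \<longlonglongrightarrow> 0"
    proof -
      have "t j * \<epsilon> j = 1 / t j" for j using t0[of j] by (simp add: \<epsilon>_def power2_eq_square)
      then show ?thesis using inv_t by simp
    qed
    have bd: "(\<lambda>j. t j * ((2 * t j + (t j)\<^sup>2) / (real (n j))\<^sup>2)) \<longlonglongrightarrow> 0"
    proof (rule Lim_null_comparison)
      show "(\<lambda>j. 3 * (1 / t j)) \<longlonglongrightarrow> 0" using tendsto_mult[OF tendsto_const inv_t, of 3] by simp
      show "\<forall>\<^sub>F j in sequentially. norm (t j * ((2 * t j + (t j)\<^sup>2) / (real (n j))\<^sup>2)) \<le> 3 * (1 / t j)"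
      proof (rule always_eventually, rule allI)
        fix j
        have "t j \<le> (t j)\<^sup>2" using mult_left_mono[OF t1[of j], of "t j"] t0[of j] by (simp add: power2_eq_square)
        then have 1: "2 * t j + (t j)\<^sup>2 \<le> 3 * (t j)\<^sup>2" by linarith
        have "(t j) ^ 4 \<le> (t j ^ 3)\<^sup>2"
          using power_increasing[of 4 6 "t j"] t1[of j] by (simp flip: power_mult)
        also have "\<dots> \<le> (real (n j))\<^sup>2" using n_ge[of j] t0[of j] by (intro power_mono) auto
        finally have 2: "(t j) ^ 4 \<le> (real (n j))\<^sup>2" .
        have "(2 * t j + (t j)\<^sup>2) / (real (n j))\<^sup>2 \<le> 3 * (t j)\<^sup>2 / (t j) ^ 4"
          using 1 2 t0[of j] by (intro frac_le) auto
        also have "\<dots> = 3 / (t j)\<^sup>2" using t0[of j] by (simp add: power2_eq_square power4_eq_xxxx)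
        finally have "t j * ((2 * t j + (t j)\<^sup>2) / (real (n j))\<^sup>2) \<le> t j * (3 / (t j)\<^sup>2)"
          using t0[of j] by (intro mult_left_mono) auto
        then show "norm (t j * ((2 * t j + (t j)\<^sup>2) / (real (n j))\<^sup>2)) \<le> 3 * (1 / t j)"
          using t0[of j] by (simp add: power2_eq_square)
      qed
    qed
    \<comment> \<open>Since s^2 = sqrt t, the term q sqrt (2 a) equals (sqrt t q) sqrt (2 a / sqrt
      t) / s: two convergent factors over a divergent one.\<close>
    have "(\<lambda>j. 2 * (sqrt (t j) * q j) * sqrt (2 * (a j / sqrt (t j))))
        \<longlonglongrightarrow> 2 * (\<rho> * (1 - \<rho>) * u\<^sup>2) * sqrt (2 * (sqrt (2 / pi) / 2))"
      by (intro tendsto_mult tendsto_const tendsto_real_sqrt sq alim)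
    from real_tendsto_divide_at_top[OF this s]
    have "(\<lambda>j. 2 * (sqrt (t j) * q j) * sqrt (2 * (a j / sqrt (t j))) / s j) \<longlonglongrightarrow> 0" .
    moreover have "2 * (sqrt (t j) * q j) * sqrt (2 * (a j / sqrt (t j))) / s j = 2 * q j * sqrt (2 * a j)" for j
    proof -
      have "sqrt (2 * (a j / sqrt (t j))) = sqrt (2 * a j) / s j"
        using s0[of j] by (simp add: s2[symmetric] real_sqrt_divide)
      then show ?thesis using s0[of j] by (simp add: s2[symmetric] power2_eq_square)
    qed
    ultimately have qa: "(\<lambda>j. 2 * q j * sqrt (2 * a j)) \<longlonglongrightarrow> 0" by simp
    have "(\<lambda>j. \<epsilon> j + (t j * \<epsilon> j + t j * ((2 * t j + (t j)\<^sup>2) / (real (n j))\<^sup>2)) + \<bar>\<theta> j\<bar> + 2 * q j * sqrt (2 * a j)) \<longlonglongrightarrow> 0 + (0 + 0) + \<bar>0\<bar> + 0"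
      using inv_t2 t_eps bd th qa unfolding \<epsilon>_def by (intro tendsto_add tendsto_rabs)
    then show ?thesis by (simp add: err_def distrib_left)
  qed
  have "(\<lambda>j. (\<integral>\<omega>. cis (\<theta> j * J (t j) \<omega>) \<partial>M) - of_real ((1 - q j) powr a j)) \<longlonglongrightarrow> 0"
    by (rule Lim_null_comparison[OF eventually_mono[OF qev main] err])
  from tendsto_add[OF this tendsto_of_real[OF powr]]
  have "(\<lambda>j. \<integral>\<omega>. cis (\<theta> j * J (t j) \<omega>) \<partial>M) \<longlonglongrightarrow> of_real (exp (- (sqrt (2 / pi) / 2 * (\<rho> * (1 - \<rho>) * u\<^sup>2))))"
    by simp
  then show ?thesis
  proof (rule Lim_transform_eventually)
    show "\<forall>\<^sub>F j in sequentially. (\<integral>\<omega>. cis (\<theta> j * J (t j) \<omega>) \<partial>M) = (\<integral>\<omega>. cis (u / T j powr (1 / 4) * J (T j) \<omega>) \<partial>M)"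
      using tT by eventually_elim (simp only: \<theta>_def s_def)
  qed
qed

end

theorem theorem10p4p2:
  fixes M :: "'w measure" and \<eta> :: "real \<Rightarrow> 'w \<Rightarrow> config" and \<rho> :: real
  assumes "0 < \<rho>" and "\<rho> < 1"
    and "exclusion_process nn_symmetric M \<eta>"
    and "distr M config_space (\<eta> 0) = bernoulli_config_at_origin \<rho>"
  shows "converges_in_distribution_at_top M
           (\<lambda>t \<omega>. 1 / t powr (1 / 4) * current (-1) 0 (\<lambda>s. \<eta> s \<omega>) t)
           (normal_law 0 (\<rho>\<^sup>2 * (sqrt (2 / pi) * ((1 - \<rho>) / \<rho>))))"
proof -
  interpret nn_exclusion M \<eta> by unfold_locales (rule assms(3))
  define v where "v = \<rho>\<^sup>2 * (sqrt (2 / pi) * ((1 - \<rho>) / \<rho>))"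
  \<comment> \<open>One factor \<rho> cancels; v / 2 is then the mean positive part sqrt (2 / pi) /
    2 times \<rho> (1 - \<rho>), which matches the exponent of
    \<open>char_current_limit\<close>.\<close>
  have v: "v = sqrt (2 / pi) * (\<rho> * (1 - \<rho>))" using assms(1) by (simp add: v_def power2_eq_square)
  have v0: "0 < v" unfolding v using assms(1,2) by simp
  have meas: "(\<lambda>\<omega>. 1 / t powr (1 / 4) * J t \<omega>) \<in> borel_measurable M" for t
    using measurable_J by simp
  have "weak_conv_m (\<lambda>j. distr M borel (\<lambda>\<omega>. 1 / T j powr (1 / 4) * J (T j) \<omega>)) (normal_law 0 v)"
    if T: "filterlim T at_top sequentially" for T :: "nat \<Rightarrow> real"
  proof (rule levy_continuity)
    show "real_distribution (distr M borel (\<lambda>\<omega>. 1 / T j powr (1 / 4) * J (T j) \<omega>))" for j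
      by (rule real_distribution_distr[OF meas])
    show "real_distribution (normal_law 0 v)" by (rule real_distribution_normal_law[OF v0])
    fix u
    have "char (distr M borel (\<lambda>\<omega>. 1 / T j powr (1 / 4) * J (T j) \<omega>)) u = (\<integral>\<omega>. cis (u / T j powr (1 / 4) * J (T j) \<omega>) \<partial>M)" for j
      unfolding char_def by (subst integral_distr[OF meas]) (simp_all add: cis_conv_exp)
    moreover have "char (normal_law 0 v) u = of_real (exp (- (sqrt (2 / pi) / 2 * (\<rho> * (1 - \<rho>) * u\<^sup>2))))"
    proof -
      have "v * u\<^sup>2 / 2 = sqrt (2 / pi) / 2 * (\<rho> * (1 - \<rho>) * u\<^sup>2)" by (simp add: v)
      then show ?thesis using char_normal_law[OF v0, of u] by (simp only:)
    qed
    ultimately show "(\<lambda>j. char (distr M borel (\<lambda>\<omega>. 1 / T j powr (1 / 4) * J (T j) \<omega>)) u) \<longlonglongrightarrow> char (normal_law 0 v) u"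
      using char_current_limit[OF assms(1) _ assms(4) T, of u] assms(2) by simp
  qed
  then show ?thesis
    unfolding converges_in_distribution_at_top_def v_def by blast
qed

end
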